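(* Let $R\subseteq T$ be rings forming a regular conductor square with conductor $C$, and set $A=R/C$, $B=T/C$. Assume that $T$ is flat as an $R$-module, that $C$ is a principal ideal of $T$, and that every non-zero finitely generated ideal $I$ of $R$ satisfies the following condition: there are elements $r,s\in R$ and an ideal $U\subseteq R$ such that $UT=T=rT$ and $rI=sU$, and such that the multiplication maps $I\xrightarrow{r}rI$ and $U\xrightarrow{s}sU$ are isomorphisms. Assume further that $A$ is locally a domain and has finite Krull dimension. Then $R$ is coherent if and only if $A$ is coherent; each of these conditions implies that $T$ is coherent.
   Context: All rings are commutative with identity. A conductor square consists of a ring $T$, a subring $R\subseteq T$ such that $R$ and $T$ have a common non-zero ideal, the largest common ideal $C$ of $R$ and $T$ (called the conductor of $T$ into $R$), and the rings $A=R/C$ and $B=T/C$, together with the inclusions $R\hookrightarrow T$, $A\hookrightarrow B$ and the projections $\eta_2\colon R\twoheadrightarrow A$, $\eta_1\colon T\twoheadrightarrow B$; equivalently, $R$ is the pullback $\{(a,t)\in A\times T\mid a=\eta_1(t)\text{ in }B\}$ and $C=\operatorname{Ker}(\eta_1)=\operatorname{Ker}(\eta_2)$ is the largest common ideal. The square is regular if $C$ contains a non-zero-divisor of $T$. A ring is coherent if every finitely generated ideal of it is finitely presented. A ring $A$ is locally a domain if $A_{\mathfrak p}$ is an integral domain for every prime ideal $\mathfrak p$ of $A$. *)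

theory Defs
  imports "HOL-Algebra.Algebra" "HOL-Library.Extended_Nat"
begin

section \<open>Modules and their homomorphisms\<close>

definition mod_hom ::
  "('r, 'x) ring_scheme \<Rightarrow> ('r, 'a, 'y) module_scheme \<Rightarrow> ('r, 'b, 'z) module_scheme \<Rightarrow> ('a \<Rightarrow> 'b) set"
  where "mod_hom R M N = {f \<in> carrier M \<rightarrow> carrier N.
     (\<forall>x\<in>carrier M. \<forall>y\<in>carrier M. f (x \<oplus>\<^bsub>M\<^esub> y) = f x \<oplus>\<^bsub>N\<^esub> f y) \<and>
     (\<forall>a\<in>carrier R. \<forall>x\<in>carrier M. f (a \<odot>\<^bsub>M\<^esub> x) = a \<odot>\<^bsub>N\<^esub> f x)}"

definition mod_iso ::
  "('r, 'x) ring_scheme \<Rightarrow> ('r, 'a, 'y) module_scheme \<Rightarrow> ('r, 'b, 'z) module_scheme \<Rightarrow> ('a \<Rightarrow> 'b) set"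
  where "mod_iso R M N = {f \<in> mod_hom R M N. bij_betw f (carrier M) (carrier N)}"

text \<open>A subset of a ring \<open>S\<close> as a module whose scalar action is the multiplication of \<open>S\<close>. It is
  used both for an ideal of \<open>R\<close> as an \<open>R\<close>-module (with \<open>S = R\<close>) and for an overring \<open>T\<close> of \<open>R\<close>
  as an \<open>R\<close>-module (with \<open>S = T\<close>, and the scalars cut down to \<open>R\<close> by whoever uses the module).\<close>

definition mult_module :: "('a, 'x) ring_scheme \<Rightarrow> 'a set \<Rightarrow> ('a, 'a) module"
  where "mult_module S N =
    \<lparr>carrier = N, monoid.mult = monoid.mult S, monoid.one = \<one>\<^bsub>S\<^esub>, ring.zero = \<zero>\<^bsub>S\<^esub>,
     ring.add = ring.add S, module.smult = monoid.mult S\<rparr>"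

text \<open>\<open>R\<^sup>n\<close>. The \<open>mult\<close> and \<open>one\<close> fields exist only because module records extend ring records;
  no definition below looks at them for a module.\<close>

definition free_module :: "('a, 'x) ring_scheme \<Rightarrow> nat \<Rightarrow> ('a, nat \<Rightarrow> 'a) module"
  where "free_module R n =
    \<lparr>carrier = {..<n} \<rightarrow>\<^sub>E carrier R,
     monoid.mult = (\<lambda>v w. \<lambda>i\<in>{..<n}. v i \<otimes>\<^bsub>R\<^esub> w i),
     monoid.one = (\<lambda>i\<in>{..<n}. \<one>\<^bsub>R\<^esub>),
     ring.zero = (\<lambda>i\<in>{..<n}. \<zero>\<^bsub>R\<^esub>),
     ring.add = (\<lambda>v w. \<lambda>i\<in>{..<n}. v i \<oplus>\<^bsub>R\<^esub> w i),
     module.smult = (\<lambda>a v. \<lambda>i\<in>{..<n}. a \<otimes>\<^bsub>R\<^esub> v i)\<rparr>"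

text \<open>An exact sequence \<open>R\<^sup>m \<rightarrow> R\<^sup>n \<rightarrow> M \<rightarrow> 0\<close>.\<close>

definition finitely_presented :: "('r, 'x) ring_scheme \<Rightarrow> ('r, 'a, 'y) module_scheme \<Rightarrow> bool"
  where "finitely_presented R M \<longleftrightarrow>
    (\<exists>n m. \<exists>f \<in> mod_hom R (free_module R n) M. \<exists>g \<in> mod_hom R (free_module R m) (free_module R n).
       f ` carrier (free_module R n) = carrier M \<and>
       g ` carrier (free_module R m) = a_kernel (free_module R n) M f)"


section \<open>Coherent rings\<close>

definition fg_ideal :: "'a set \<Rightarrow> ('a, 'x) ring_scheme \<Rightarrow> bool"
  where "fg_ideal I R \<longleftrightarrow> (\<exists>W. finite W \<and> W \<subseteq> carrier R \<and> I = Idl\<^bsub>R\<^esub> W)"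

definition coherent_ring :: "('a, 'x) ring_scheme \<Rightarrow> bool"
  where "coherent_ring R \<longleftrightarrow>
    cring R \<and> (\<forall>I. fg_ideal I R \<longrightarrow> finitely_presented R (mult_module R I))"


section \<open>Tensor products and flat modules\<close>

text \<open>\<open>N \<otimes>\<^sub>R M\<close> as an abelian group: the free abelian group on pairs modulo the bilinearity and
  balancing relations. Groups are written multiplicatively in the record, although the operation
  of \<^const>\<open>free_Abelian_group\<close> is the addition of formal sums.\<close>

definition tensor_rel ::
  "('r, 'x) ring_scheme \<Rightarrow> ('r, 'n, 'y) module_scheme \<Rightarrow> ('r, 'm, 'z) module_scheme \<Rightarrow> ('n \<times> 'm \<Rightarrow>\<^sub>0 int) set"
  where "tensor_rel R N M = generate (free_Abelian_group (carrier N \<times> carrier M))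
    ({frag_of (x \<oplus>\<^bsub>N\<^esub> x', y) - frag_of (x, y) - frag_of (x', y) | x x' y.
        x \<in> carrier N \<and> x' \<in> carrier N \<and> y \<in> carrier M} \<union>
     {frag_of (x, y \<oplus>\<^bsub>M\<^esub> y') - frag_of (x, y) - frag_of (x, y') | x y y'.
        x \<in> carrier N \<and> y \<in> carrier M \<and> y' \<in> carrier M} \<union>
     {frag_of (a \<odot>\<^bsub>N\<^esub> x, y) - frag_of (x, a \<odot>\<^bsub>M\<^esub> y) | a x y.
        a \<in> carrier R \<and> x \<in> carrier N \<and> y \<in> carrier M})"

definition tensor ::
  "('r, 'x) ring_scheme \<Rightarrow> ('r, 'n, 'y) module_scheme \<Rightarrow> ('r, 'm, 'z) module_scheme
    \<Rightarrow> ('n \<times> 'm \<Rightarrow>\<^sub>0 int) set monoid"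
  where "tensor R N M = free_Abelian_group (carrier N \<times> carrier M) Mod tensor_rel R N M"

text \<open>The map \<open>f \<otimes> id\<^sub>M : N \<otimes>\<^sub>R M \<rightarrow> N' \<otimes>\<^sub>R M\<close>. All members of the union coincide when \<open>W\<close> is a
  coset and \<open>f\<close> is \<open>R\<close>-linear.\<close>

definition tensor_map ::
  "('r, 'x) ring_scheme \<Rightarrow> ('r, 'n, 'y) module_scheme \<Rightarrow> ('r, 'm, 'z) module_scheme \<Rightarrow> ('k \<Rightarrow> 'n)
    \<Rightarrow> ('k \<times> 'm \<Rightarrow>\<^sub>0 int) set \<Rightarrow> ('n \<times> 'm \<Rightarrow>\<^sub>0 int) set"
  where "tensor_map R N' M f W =
    (\<Union>z\<in>W. tensor_rel R N' M #>\<^bsub>free_Abelian_group (carrier N' \<times> carrier M)\<^esub>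
             frag_extend (\<lambda>(x, y). frag_of (f x, y)) z)"

text \<open>\<open>M\<close> is flat if \<open>- \<otimes>\<^sub>R M\<close> preserves injections. A definition cannot quantify over types, so the
  test modules are those carried by the type of sets of sequences in \<open>R\<close>. Up to isomorphism these
  include every quotient of a submodule of \<open>R\<^sup>(\<^sup>\<nat>\<^sup>)\<close>, in particular all countably generated modules
  and all ideals; as flatness can be tested on the inclusions of ideals into \<open>R\<close>, this is
  the usual notion.\<close>

definition flat_module :: "('r, 'x) ring_scheme \<Rightarrow> ('r, 'm, 'z) module_scheme \<Rightarrow> bool"
  where "flat_module R M \<longleftrightarrow> module R M \<and>
    (\<forall>(N :: ('r, (nat \<Rightarrow> 'r) set) module) (N' :: ('r, (nat \<Rightarrow> 'r) set) module) f.
       module R N \<and> module R N' \<and> f \<in> mod_hom R N N' \<and> inj_on f (carrier N) \<longrightarrow>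
       inj_on (tensor_map R N' M f) (carrier (tensor R N M)))"


section \<open>Localization and Krull dimension\<close>

text \<open>The fraction \<open>a/s\<close> as an equivalence class of pairs; \<open>S\<close> is a multiplicative subset.\<close>

definition fraction :: "('a, 'x) ring_scheme \<Rightarrow> 'a set \<Rightarrow> 'a \<Rightarrow> 'a \<Rightarrow> ('a \<times> 'a) set"
  where "fraction R S a s =
    {(b, t). b \<in> carrier R \<and> t \<in> S \<and> (\<exists>u\<in>S. u \<otimes>\<^bsub>R\<^esub> (a \<otimes>\<^bsub>R\<^esub> t \<ominus>\<^bsub>R\<^esub> b \<otimes>\<^bsub>R\<^esub> s) = \<zero>\<^bsub>R\<^esub>)}"

definition localization :: "('a, 'x) ring_scheme \<Rightarrow> 'a set \<Rightarrow> ('a \<times> 'a) set ring"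
  where "localization R S =
    \<lparr>carrier = {fraction R S a s | a s. a \<in> carrier R \<and> s \<in> S},
     monoid.mult = (\<lambda>W Z. \<Union>(a, s)\<in>W. \<Union>(b, t)\<in>Z. fraction R S (a \<otimes>\<^bsub>R\<^esub> b) (s \<otimes>\<^bsub>R\<^esub> t)),
     monoid.one = fraction R S \<one>\<^bsub>R\<^esub> \<one>\<^bsub>R\<^esub>,
     ring.zero = fraction R S \<zero>\<^bsub>R\<^esub> \<one>\<^bsub>R\<^esub>,
     ring.add = (\<lambda>W Z. \<Union>(a, s)\<in>W. \<Union>(b, t)\<in>Z.
              fraction R S (a \<otimes>\<^bsub>R\<^esub> t \<oplus>\<^bsub>R\<^esub> b \<otimes>\<^bsub>R\<^esub> s) (s \<otimes>\<^bsub>R\<^esub> t))\<rparr>"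

definition locally_domain :: "('a, 'x) ring_scheme \<Rightarrow> bool"
  where "locally_domain A \<longleftrightarrow>
    cring A \<and> (\<forall>p. primeideal p A \<longrightarrow> domain (localization A (carrier A - p)))"

text \<open>The supremum of the lengths of chains of primes; with values in \<^typ>\<open>enat\<close>, the zero ring
  (which has no primes) gets dimension \<open>0\<close>, and counts as finite-dimensional.\<close>

definition krull_dim :: "('a, 'x) ring_scheme \<Rightarrow> enat"
  where "krull_dim A = Sup (enat ` {n. \<exists>p :: nat \<Rightarrow> 'a set.
     (\<forall>i\<le>n. primeideal (p i) A) \<and> (\<forall>i<n. p i \<subset> p (Suc i))})"


section \<open>Conductor squares\<close>

definition common_ideal :: "'a set \<Rightarrow> ('a, 'x) ring_scheme \<Rightarrow> ('a, 'x) ring_scheme \<Rightarrow> bool"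
  where "common_ideal I R T \<longleftrightarrow> ideal I R \<and> ideal I T"

text \<open>\<open>R\<close> is a ring record that differs from \<open>T\<close> only in its carrier. The remaining corners of the
  square are \<open>R Quot C\<close> and \<open>T Quot C\<close>.\<close>

definition conductor_square ::
  "('a, 'x) ring_scheme \<Rightarrow> ('a, 'x) ring_scheme \<Rightarrow> 'a set \<Rightarrow> bool"
  where "conductor_square R T C \<longleftrightarrow>
    cring T \<and> subring (carrier R) T \<and> R = T\<lparr>carrier := carrier R\<rparr> \<and>
    (\<exists>I. common_ideal I R T \<and> I \<noteq> {\<zero>\<^bsub>T\<^esub>}) \<and>
    common_ideal C R T \<and> (\<forall>I. common_ideal I R T \<longrightarrow> I \<subseteq> C)"

definition non_zero_divisor :: "('a, 'x) ring_scheme \<Rightarrow> 'a \<Rightarrow> bool"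
  where "non_zero_divisor T c \<longleftrightarrow>
    c \<in> carrier T \<and> (\<forall>t\<in>carrier T. c \<otimes>\<^bsub>T\<^esub> t = \<zero>\<^bsub>T\<^esub> \<longrightarrow> t = \<zero>\<^bsub>T\<^esub>)"

definition regular_conductor_square ::
  "('a, 'x) ring_scheme \<Rightarrow> ('a, 'x) ring_scheme \<Rightarrow> 'a set \<Rightarrow> bool"
  where "regular_conductor_square R T C \<longleftrightarrow>
    conductor_square R T C \<and> (\<exists>c\<in>C. non_zero_divisor T c)"

end

(* The factorisation r I = s U turns every non-zero finitely generated ideal I of R into d U with d
   regular in T and U T = T; then C = C U T lies in U. Hence finitely generated ideals of T are
   principal with regular generators, and T is coherent. For such U, the relations among generators
   of U with entries in C are combinations of Koszul relations (as U T = T), so U is finitely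
   presented over R iff U/C is so over A. This gives the descent of coherence from A to R. Conversely,
   a finitely generated ideal J of A is a quotient of some such U/C, and the kernel is finitely
   generated because annihilators of finitely generated ideals are pure in a locally integral ring. *)

theory Submission
  imports Defs
begin

text \<open>The element \<open>d\<close> is \<open>s / r\<close>, where \<open>r\<close> is a unit
  of \<open>T\<close> because \<open>r T = T\<close>; it need not lie in \<open>R\<close>. The
  hypothesis makes \<open>s\<close> injective on \<open>U\<close> only. Regularity on all of
  \<open>T\<close> comes from \<open>C\<close> lying in \<open>U\<close> together with a regular
  generator \<open>c\<close> of \<open>C\<close>: if \<open>s\<close> kills \<open>t\<close>, it
  kills \<open>c t\<close>, an element of \<open>U\<close>.

  The obstacle in passing from \<open>R\<close> to \<open>A\<close> is that \<open>A\<close> is only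
  locally a domain. For an ideal \<open>J\<close> of \<open>A\<close> lifted to
  \<open>I = d U\<close> with \<open>c = d c'\<close> in \<open>I\<close>, multiplication by
  \<open>d\<close> maps \<open>U / C\<close> onto \<open>J\<close>, but it kills the residues of all
  elements of \<open>U\<close> that are \<open>T\<close>-multiples of \<open>c'\<close>. Over a
  domain \<open>c' J = 0\<close> would leave two cases: \<open>J = 0\<close>, or \<open>c'\<close>
  in \<open>C\<close>, and then the map is injective. Purity replaces this dichotomy by a single
  element \<open>y\<close> that kills \<open>J\<close> and acts as the identity on \<open>c'\<close>
  modulo \<open>C\<close>. The kernel is then a multiple of a finitely generated module, which is
  all that a finite presentation of \<open>J\<close> needs.\<close>

section \<open>Finitely generated submodules\<close>

text \<open>Linear combinations are built one term at a time, so facts about spans go by rule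
  induction and no finite sums over a module record are needed.\<close>

inductive_set lspan for R :: "('r, 'x) ring_scheme" and M :: "('r, 'm, 'y) module_scheme" and W where
  zero: "\<zero>\<^bsub>M\<^esub> \<in> lspan R M W"
| step: "a \<in> carrier R \<Longrightarrow> w \<in> W \<Longrightarrow> x \<in> lspan R M W \<Longrightarrow> a \<odot>\<^bsub>M\<^esub> w \<oplus>\<^bsub>M\<^esub> x \<in> lspan R M W"

definition fg_sub :: "('r, 'x) ring_scheme \<Rightarrow> ('r, 'm, 'y) module_scheme \<Rightarrow> 'm set \<Rightarrow> bool"
  where "fg_sub R M N \<longleftrightarrow> (\<exists>W. finite W \<and> W \<subseteq> N \<and> N = lspan R M W)"

lemma lspan_mono: "V \<subseteq> W \<Longrightarrow> lspan R M V \<subseteq> lspan R M W"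
proof
  fix x assume "V \<subseteq> W" "x \<in> lspan R M V"
  from this(2,1) show "x \<in> lspan R M W"
    by induction (auto intro: lspan.intros)
qed

lemma lspan_least:
  assumes "\<zero>\<^bsub>M\<^esub> \<in> N" and "\<And>a w x. a \<in> carrier R \<Longrightarrow> w \<in> W \<Longrightarrow> x \<in> N \<Longrightarrow> a \<odot>\<^bsub>M\<^esub> w \<oplus>\<^bsub>M\<^esub> x \<in> N"
  shows "lspan R M W \<subseteq> N"
proof
  fix x assume "x \<in> lspan R M W"
  then show "x \<in> N" by induction (use assms in auto)
qed

context module
begin

lemma lspan_closed: "W \<subseteq> carrier M \<Longrightarrow> lspan R M W \<subseteq> carrier M"
  by (rule lspan_least) auto

lemma lspan_add:
  assumes "W \<subseteq> carrier M" "x \<in> lspan R M W" "y \<in> lspan R M W"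
  shows "x \<oplus>\<^bsub>M\<^esub> y \<in> lspan R M W"
  using assms(2)
proof induction
  case zero
  have "y \<in> carrier M" using assms lspan_closed by blast
  then show ?case using assms by simp
next
  case (step a w x)
  then have "a \<odot>\<^bsub>M\<^esub> w \<in> carrier M" "x \<in> carrier M" "y \<in> carrier M"
    using assms lspan_closed by auto
  then show ?case using step by (auto simp: M.a_assoc intro!: lspan.step)
qed

lemma lspan_smult:
  assumes "W \<subseteq> carrier M" "a \<in> carrier R" "x \<in> lspan R M W"
  shows "a \<odot>\<^bsub>M\<^esub> x \<in> lspan R M W"
  using assms(3)
proof induction
  case zero
  then show ?case using assms by (auto intro: lspan.zero)
next
  case (step b w x)
  then have "w \<in> carrier M" "x \<in> carrier M"
    using assms lspan_closed by auto
  then have "a \<odot>\<^bsub>M\<^esub> (b \<odot>\<^bsub>M\<^esub> w \<oplus>\<^bsub>M\<^esub> x) = (a \<otimes> b) \<odot>\<^bsub>M\<^esub> w \<oplus>\<^bsub>M\<^esub> a \<odot>\<^bsub>M\<^esub> x"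
    using step assms by (simp add: smult_r_distr smult_assoc1)
  then show ?case using step assms by (auto intro!: lspan.step)
qed

lemma lspan_incl:
  assumes "W \<subseteq> carrier M" shows "W \<subseteq> lspan R M W"
proof
  fix w assume "w \<in> W"
  then have "\<one> \<odot>\<^bsub>M\<^esub> w \<oplus>\<^bsub>M\<^esub> \<zero>\<^bsub>M\<^esub> \<in> lspan R M W" by (intro lspan.intros) auto
  with \<open>w \<in> W\<close> assms show "w \<in> lspan R M W" by auto
qed

lemma lspan_insert:
  assumes "W \<subseteq> carrier M" "m \<in> carrier M"
  shows "lspan R M (insert m W) = {x \<oplus>\<^bsub>M\<^esub> a \<odot>\<^bsub>M\<^esub> m |x a. x \<in> lspan R M W \<and> a \<in> carrier R}"
    (is "_ = ?N")
proof
  show "?N \<subseteq> lspan R M (insert m W)"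
    using lspan_mono[of W "insert m W" R M] lspan_incl[of "insert m W"] assms
    by (auto intro!: lspan_add lspan_smult)
  show "lspan R M (insert m W) \<subseteq> ?N"
  proof (rule lspan_least)
    have "\<zero>\<^bsub>M\<^esub> = \<zero>\<^bsub>M\<^esub> \<oplus>\<^bsub>M\<^esub> \<zero> \<odot>\<^bsub>M\<^esub> m" using assms by simp
    then show "\<zero>\<^bsub>M\<^esub> \<in> ?N" using lspan.zero R.zero_closed by blast
  next
    fix a w x assume a: "a \<in> carrier R" and w: "w \<in> insert m W" and "x \<in> ?N"
    then obtain y b where y: "x = y \<oplus>\<^bsub>M\<^esub> b \<odot>\<^bsub>M\<^esub> m" "y \<in> lspan R M W" "b \<in> carrier R" by blast
    have yc: "y \<in> carrier M" using y assms lspan_closed by auto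
    show "a \<odot>\<^bsub>M\<^esub> w \<oplus>\<^bsub>M\<^esub> x \<in> ?N"
    proof (cases "w = m")
      case True
      have "a \<odot>\<^bsub>M\<^esub> w \<oplus>\<^bsub>M\<^esub> x = y \<oplus>\<^bsub>M\<^esub> (a \<oplus> b) \<odot>\<^bsub>M\<^esub> m"
        using a y yc assms True by (simp add: smult_l_distr M.a_lcomm)
      then show ?thesis using y a by blast
    next
      case False
      then have "w \<in> W" using w by auto
      moreover from this have "a \<odot>\<^bsub>M\<^esub> w \<oplus>\<^bsub>M\<^esub> x = (a \<odot>\<^bsub>M\<^esub> w \<oplus>\<^bsub>M\<^esub> y) \<oplus>\<^bsub>M\<^esub> b \<odot>\<^bsub>M\<^esub> m"
        using a y yc assms by (auto simp: M.a_assoc)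
      ultimately show ?thesis using lspan.step[of a R w W y M] a y by blast
    qed
  qed
qed

end

text \<open>One statement serves two uses: linear maps, with \<open>\<pi>\<close> the identity, and
  reduction from \<open>R\<close> to \<open>A\<close>, where the scalars change as well. That
  \<open>\<pi>\<close> is onto is what lifts the coefficients of a combination in \<open>N\<close>
  back to \<open>R\<close>.\<close>

lemma semilinear_image_lspan:
  assumes M: "module R M" and N: "module A N" and W: "W \<subseteq> carrier M"
    and \<pi>: "\<pi> ` carrier R = carrier A"
    and f: "f \<in> carrier M \<rightarrow> carrier N" "f \<zero>\<^bsub>M\<^esub> = \<zero>\<^bsub>N\<^esub>"
      "\<And>x y. x \<in> carrier M \<Longrightarrow> y \<in> carrier M \<Longrightarrow> f (x \<oplus>\<^bsub>M\<^esub> y) = f x \<oplus>\<^bsub>N\<^esub> f y"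
      "\<And>a x. a \<in> carrier R \<Longrightarrow> x \<in> carrier M \<Longrightarrow> f (a \<odot>\<^bsub>M\<^esub> x) = \<pi> a \<odot>\<^bsub>N\<^esub> f x"
  shows "f ` lspan R M W = lspan A N (f ` W)"
proof -
  interpret M: module R M by fact
  interpret N: module A N by fact
  have sp: "x \<in> carrier M" if "x \<in> lspan R M W" for x using M.lspan_closed[OF W] that by auto
  have "f x \<in> lspan A N (f ` W)" if "x \<in> lspan R M W" for x
    using that
  proof induction
    case zero
    then show ?case using f by (auto intro: lspan.zero)
  next
    case (step a w x)
    then have "f (a \<odot>\<^bsub>M\<^esub> w \<oplus>\<^bsub>M\<^esub> x) = \<pi> a \<odot>\<^bsub>N\<^esub> f w \<oplus>\<^bsub>N\<^esub> f x"
      using f(3)[of "a \<odot>\<^bsub>M\<^esub> w" x] f(4)[of a w] W sp[of x] by auto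
    then show ?case using step \<pi> by (auto intro!: lspan.step)
  qed
  moreover have "lspan A N (f ` W) \<subseteq> f ` lspan R M W"
  proof (rule lspan_least)
    show "\<zero>\<^bsub>N\<^esub> \<in> f ` lspan R M W" using f by (metis imageI lspan.zero)
  next
    fix a w x assume "a \<in> carrier A" "w \<in> f ` W" "x \<in> f ` lspan R M W"
    then obtain a' w' x' where *: "a' \<in> carrier R" "a = \<pi> a'" "w' \<in> W" "w = f w'"
      "x' \<in> lspan R M W" "x = f x'" using \<pi> by blast
    then have "a \<odot>\<^bsub>N\<^esub> w \<oplus>\<^bsub>N\<^esub> x = f (a' \<odot>\<^bsub>M\<^esub> w' \<oplus>\<^bsub>M\<^esub> x')"
      using f(3)[of "a' \<odot>\<^bsub>M\<^esub> w'" x'] f(4)[of a' w'] W sp[of x'] by auto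
    then show "a \<odot>\<^bsub>N\<^esub> w \<oplus>\<^bsub>N\<^esub> x \<in> f ` lspan R M W"
      using * by (auto intro!: imageI lspan.step)
  qed
  ultimately show ?thesis by auto
qed


section \<open>Homomorphisms out of free modules\<close>

lemma mod_homD:
  assumes "f \<in> mod_hom R M N"
  shows "x \<in> carrier M \<Longrightarrow> f x \<in> carrier N"
    "x \<in> carrier M \<Longrightarrow> y \<in> carrier M \<Longrightarrow> f (x \<oplus>\<^bsub>M\<^esub> y) = f x \<oplus>\<^bsub>N\<^esub> f y"
    "a \<in> carrier R \<Longrightarrow> x \<in> carrier M \<Longrightarrow> f (a \<odot>\<^bsub>M\<^esub> x) = a \<odot>\<^bsub>N\<^esub> f x"
  using assms by (auto simp: mod_hom_def)

lemma mod_hom_zero: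
  assumes "module R M" "module R N" "f \<in> mod_hom R M N"
  shows "f \<zero>\<^bsub>M\<^esub> = \<zero>\<^bsub>N\<^esub>"
proof -
  interpret M: module R M by fact
  interpret N: module R N by fact
  have "f (\<zero>\<^bsub>R\<^esub> \<odot>\<^bsub>M\<^esub> \<zero>\<^bsub>M\<^esub>) = \<zero>\<^bsub>R\<^esub> \<odot>\<^bsub>N\<^esub> f \<zero>\<^bsub>M\<^esub>"
    by (rule mod_homD(3)[OF assms(3)]) auto
  with mod_homD(1)[OF assms(3), of "\<zero>\<^bsub>M\<^esub>"] show ?thesis by simp
qed

lemma mod_hom_comp:
  "f \<in> mod_hom R M N \<Longrightarrow> g \<in> mod_hom R N P \<Longrightarrow> g \<circ> f \<in> mod_hom R M P"
  by (auto simp: mod_hom_def Pi_iff)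

lemma image_lspan:
  assumes "module R M" "module R N" "f \<in> mod_hom R M N" "W \<subseteq> carrier M"
  shows "f ` lspan R M W = lspan R N (f ` W)"
  by (rule semilinear_image_lspan[where \<pi> = "\<lambda>x. x"])
    (use assms mod_hom_zero[OF assms(1-3)] in \<open>auto simp: mod_homD[OF assms(3)]\<close>)

lemma free_module_simps [simp]:
  "carrier (free_module R n) = {..<n} \<rightarrow>\<^sub>E carrier R"
  "\<zero>\<^bsub>free_module R n\<^esub> = (\<lambda>i\<in>{..<n}. \<zero>\<^bsub>R\<^esub>)"
  "v \<oplus>\<^bsub>free_module R n\<^esub> w = (\<lambda>i\<in>{..<n}. v i \<oplus>\<^bsub>R\<^esub> w i)"
  "a \<odot>\<^bsub>free_module R n\<^esub> v = (\<lambda>i\<in>{..<n}. a \<otimes>\<^bsub>R\<^esub> v i)"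
  by (simp_all add: free_module_def)

lemma (in cring) module_free_module: "module R (free_module R n)"
proof (rule moduleI)
  show "abelian_group (free_module R n)"
  proof (rule abelian_groupI)
    fix v assume "v \<in> carrier (free_module R n)"
    then show "\<exists>w\<in>carrier (free_module R n). w \<oplus>\<^bsub>free_module R n\<^esub> v = \<zero>\<^bsub>free_module R n\<^esub>"
      by (intro bexI[of _ "\<lambda>i\<in>{..<n}. \<ominus> v i"]) (auto simp: l_neg PiE_iff)
  qed (auto simp: PiE_iff a_ac extensional_def fun_eq_iff)
qed (auto simp: PiE_iff l_distr r_distr m_assoc extensional_def fun_eq_iff is_cring)

definition unit_vec :: "('a, 'x) ring_scheme \<Rightarrow> nat \<Rightarrow> nat \<Rightarrow> nat \<Rightarrow> 'a" where
  "unit_vec R n i = (\<lambda>j\<in>{..<n}. if j = i then \<one>\<^bsub>R\<^esub> else \<zero>\<^bsub>R\<^esub>)"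

text \<open>Peels off the last basis vector: \<open>m\<close> is its image, and \<open>g\<close> is
  \<open>f\<close> on the vectors whose last entry is zero. Induction on the rank then replaces the
  formula for \<open>f v\<close> as a sum of multiples of the images of unit vectors.\<close>

lemma free_module_hom_Suc:
  assumes M: "module R M" and f: "f \<in> mod_hom R (free_module R (Suc n)) M"
  obtains g m where "g \<in> mod_hom R (free_module R n) M" "m \<in> carrier M"
    "\<And>v. v \<in> carrier (free_module R (Suc n)) \<Longrightarrow> f v = g (restrict v {..<n}) \<oplus>\<^bsub>M\<^esub> v n \<odot>\<^bsub>M\<^esub> m"
proof -
  interpret M: module R M by fact
  let ?e = "unit_vec R (Suc n) n"
  have e: "?e \<in> carrier (free_module R (Suc n))" by (auto simp: unit_vec_def)
  \<comment> \<open>A vector of length \<open>n\<close> has the value \<open>undefined\<close> at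
    \<open>n\<close>, so the embedding into length \<open>n + 1\<close> has to set that entry to
    zero.\<close>
  have ext: "v(n := \<zero>\<^bsub>R\<^esub>) \<in> carrier (free_module R (Suc n))" if "v \<in> carrier (free_module R n)" for v
    using that by (auto simp: PiE_iff extensional_def)
  define g where "g = (\<lambda>v. f (v(n := \<zero>\<^bsub>R\<^esub>)))"
  have "g \<in> mod_hom R (free_module R n) M"
    unfolding mod_hom_def
  proof (intro CollectI conjI ballI funcsetI)
    fix v assume v: "v \<in> carrier (free_module R n)"
    show "g v \<in> carrier M" unfolding g_def by (rule mod_homD(1)[OF f ext[OF v]])
    fix w assume w: "w \<in> carrier (free_module R n)"
    have "(v \<oplus>\<^bsub>free_module R n\<^esub> w)(n := \<zero>\<^bsub>R\<^esub>) = v(n := \<zero>\<^bsub>R\<^esub>) \<oplus>\<^bsub>free_module R (Suc n)\<^esub> w(n := \<zero>\<^bsub>R\<^esub>)"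
      by (auto simp: fun_eq_iff)
    then show "g (v \<oplus>\<^bsub>free_module R n\<^esub> w) = g v \<oplus>\<^bsub>M\<^esub> g w"
      unfolding g_def using mod_homD(2)[OF f ext[OF v] ext[OF w]] by simp
  next
    fix a v assume a: "a \<in> carrier R" and v: "v \<in> carrier (free_module R n)"
    have "(a \<odot>\<^bsub>free_module R n\<^esub> v)(n := \<zero>\<^bsub>R\<^esub>) = a \<odot>\<^bsub>free_module R (Suc n)\<^esub> v(n := \<zero>\<^bsub>R\<^esub>)"
      using a by (auto simp: fun_eq_iff)
    then show "g (a \<odot>\<^bsub>free_module R n\<^esub> v) = a \<odot>\<^bsub>M\<^esub> g v"
      unfolding g_def using mod_homD(3)[OF f a ext[OF v]] by simp
  qed
  moreover have "f ?e \<in> carrier M" by (rule mod_homD(1)[OF f e])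
  moreover have "f v = g (restrict v {..<n}) \<oplus>\<^bsub>M\<^esub> v n \<odot>\<^bsub>M\<^esub> f ?e"
    if v: "v \<in> carrier (free_module R (Suc n))" for v
  proof -
    have r: "restrict v {..<n} \<in> carrier (free_module R n)" using v by (auto simp: PiE_iff)
    have vn: "v n \<in> carrier R" using v by (auto simp: PiE_iff)
    have ve: "v n \<odot>\<^bsub>free_module R (Suc n)\<^esub> ?e \<in> carrier (free_module R (Suc n))"
      using vn by (auto simp: unit_vec_def)
    have *: "v = (restrict v {..<n})(n := \<zero>\<^bsub>R\<^esub>) \<oplus>\<^bsub>free_module R (Suc n)\<^esub> v n \<odot>\<^bsub>free_module R (Suc n)\<^esub> ?e"
      using v vn by (auto simp: fun_eq_iff unit_vec_def PiE_iff extensional_def)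
    have "f v = f ((restrict v {..<n})(n := \<zero>\<^bsub>R\<^esub>) \<oplus>\<^bsub>free_module R (Suc n)\<^esub> v n \<odot>\<^bsub>free_module R (Suc n)\<^esub> ?e)"
      using * by simp
    also have "\<dots> = g (restrict v {..<n}) \<oplus>\<^bsub>M\<^esub> v n \<odot>\<^bsub>M\<^esub> f ?e"
      using mod_homD(2)[OF f ext[OF r] ve] mod_homD(3)[OF f vn e] by (simp only: g_def)
    finally show ?thesis .
  qed
  ultimately show ?thesis using that by blast
qed

text \<open>The inverse of the splitting in \<open>free_module_hom_Suc\<close>; the two together
  give the universal property of \<open>R^n\<close>, one basis vector at a time.\<close>

lemma free_module_hom_extend:
  assumes M: "module R M" and f: "f \<in> mod_hom R (free_module R n) M" and m: "m \<in> carrier M"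
  shows "(\<lambda>v. f (restrict v {..<n}) \<oplus>\<^bsub>M\<^esub> v n \<odot>\<^bsub>M\<^esub> m) \<in> mod_hom R (free_module R (Suc n)) M"
proof -
  interpret M: module R M by fact
  have r: "restrict v {..<n} \<in> carrier (free_module R n)" "v n \<in> carrier R"
    if "v \<in> carrier (free_module R (Suc n))" for v
    using that by (auto simp: PiE_iff)
  show ?thesis
    unfolding mod_hom_def
  proof (intro CollectI conjI ballI funcsetI)
    fix v assume v: "v \<in> carrier (free_module R (Suc n))"
    note rv = r[OF v] mod_homD(1)[OF f r(1)[OF v]]
    then show "f (restrict v {..<n}) \<oplus>\<^bsub>M\<^esub> v n \<odot>\<^bsub>M\<^esub> m \<in> carrier M" using m by simp
    fix w assume w: "w \<in> carrier (free_module R (Suc n))"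
    note rw = r[OF w] mod_homD(1)[OF f r(1)[OF w]]
    have "restrict (v \<oplus>\<^bsub>free_module R (Suc n)\<^esub> w) {..<n} =
        restrict v {..<n} \<oplus>\<^bsub>free_module R n\<^esub> restrict w {..<n}"
      by (auto simp: fun_eq_iff)
    moreover have "(v \<oplus>\<^bsub>free_module R (Suc n)\<^esub> w) n = v n \<oplus>\<^bsub>R\<^esub> w n" by simp
    moreover have "f (restrict v {..<n} \<oplus>\<^bsub>free_module R n\<^esub> restrict w {..<n})
       = f (restrict v {..<n}) \<oplus>\<^bsub>M\<^esub> f (restrict w {..<n})"
      by (rule mod_homD(2)[OF f rv(1) rw(1)])
    ultimately show "f (restrict (v \<oplus>\<^bsub>free_module R (Suc n)\<^esub> w) {..<n}) \<oplus>\<^bsub>M\<^esub>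
        (v \<oplus>\<^bsub>free_module R (Suc n)\<^esub> w) n \<odot>\<^bsub>M\<^esub> m =
      (f (restrict v {..<n}) \<oplus>\<^bsub>M\<^esub> v n \<odot>\<^bsub>M\<^esub> m) \<oplus>\<^bsub>M\<^esub> (f (restrict w {..<n}) \<oplus>\<^bsub>M\<^esub> w n \<odot>\<^bsub>M\<^esub> m)"
      using rv(2,3) rw(2,3) m by (simp only: M.smult_l_distr) (simp add: M.M.a_ac)
  next
    fix a v assume a: "a \<in> carrier R" and v: "v \<in> carrier (free_module R (Suc n))"
    note rv = r[OF v] mod_homD(1)[OF f r(1)[OF v]]
    have "restrict (a \<odot>\<^bsub>free_module R (Suc n)\<^esub> v) {..<n} = a \<odot>\<^bsub>free_module R n\<^esub> restrict v {..<n}"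
      by (auto simp: fun_eq_iff)
    moreover have "(a \<odot>\<^bsub>free_module R (Suc n)\<^esub> v) n = a \<otimes>\<^bsub>R\<^esub> v n" by simp
    moreover have "f (a \<odot>\<^bsub>free_module R n\<^esub> restrict v {..<n}) = a \<odot>\<^bsub>M\<^esub> f (restrict v {..<n})"
      by (rule mod_homD(3)[OF f a rv(1)])
    ultimately show "f (restrict (a \<odot>\<^bsub>free_module R (Suc n)\<^esub> v) {..<n}) \<oplus>\<^bsub>M\<^esub>
        (a \<odot>\<^bsub>free_module R (Suc n)\<^esub> v) n \<odot>\<^bsub>M\<^esub> m =
      a \<odot>\<^bsub>M\<^esub> (f (restrict v {..<n}) \<oplus>\<^bsub>M\<^esub> v n \<odot>\<^bsub>M\<^esub> m)"
      using rv(2,3) a m by (simp only: M.smult_r_distr M.smult_assoc1 M.smult_closed)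
  qed
qed

lemma free_module_0_hom:
  assumes "module R M" shows "(\<lambda>_. \<zero>\<^bsub>M\<^esub>) \<in> mod_hom R (free_module R n) M"
proof -
  interpret module R M by fact
  show ?thesis by (auto simp: mod_hom_def)
qed

lemma free_module_hom_0:
  assumes M: "module R M" and f: "f \<in> mod_hom R (free_module R 0) M"
    and v: "v \<in> carrier (free_module R 0)"
  shows "f v = \<zero>\<^bsub>M\<^esub>"
proof -
  interpret M: module R M by fact
  have "v = \<zero>\<^bsub>free_module R 0\<^esub>" using v by (auto simp: fun_eq_iff)
  with mod_hom_zero[OF M.module_free_module M f] show ?thesis by simp
qed

lemma free_module_Suc_ex:
  assumes "x \<in> carrier (free_module R n)" "a \<in> carrier R"
  shows "\<exists>v\<in>carrier (free_module R (Suc n)). restrict v {..<n} = x \<and> v n = a"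
  using assms by (intro bexI[of _ "x(n := a)"]) (auto simp: PiE_iff extensional_def fun_eq_iff)

lemma free_module_image_Suc:
  assumes M: "module R M" and W: "W \<subseteq> carrier M" and m: "m \<in> carrier M"
    and g: "g ` carrier (free_module R n) = lspan R M W"
    and f: "\<And>v. v \<in> carrier (free_module R (Suc n)) \<Longrightarrow> f v = g (restrict v {..<n}) \<oplus>\<^bsub>M\<^esub> v n \<odot>\<^bsub>M\<^esub> m"
  shows "f ` carrier (free_module R (Suc n)) = lspan R M (insert m W)"
proof -
  interpret M: module R M by fact
  have "f ` carrier (free_module R (Suc n)) =
     {x \<oplus>\<^bsub>M\<^esub> a \<odot>\<^bsub>M\<^esub> m |x a. x \<in> lspan R M W \<and> a \<in> carrier R}"
  proof (intro equalityI subsetI)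
    fix y assume "y \<in> f ` carrier (free_module R (Suc n))"
    then obtain v where v: "v \<in> carrier (free_module R (Suc n))" "y = f v" by blast
    then have "restrict v {..<n} \<in> carrier (free_module R n)" "v n \<in> carrier R"
      by (auto simp: PiE_iff)
    then show "y \<in> {x \<oplus>\<^bsub>M\<^esub> a \<odot>\<^bsub>M\<^esub> m |x a. x \<in> lspan R M W \<and> a \<in> carrier R}"
      using f[OF v(1)] v(2) g by blast
  next
    fix y assume "y \<in> {x \<oplus>\<^bsub>M\<^esub> a \<odot>\<^bsub>M\<^esub> m |x a. x \<in> lspan R M W \<and> a \<in> carrier R}"
    then obtain x a where x: "x \<in> carrier (free_module R n)" "a \<in> carrier R" "y = g x \<oplus>\<^bsub>M\<^esub> a \<odot>\<^bsub>M\<^esub> m"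
      unfolding g[symmetric] by blast
    then show "y \<in> f ` carrier (free_module R (Suc n))"
      using free_module_Suc_ex[OF x(1,2)] f by (metis imageI)
  qed
  then show ?thesis by (simp only: M.lspan_insert[OF W m])
qed

lemma free_module_image:
  assumes M: "module R M" and f: "f \<in> mod_hom R (free_module R n) M"
  obtains W where "finite W" "W \<subseteq> carrier M" "f ` carrier (free_module R n) = lspan R M W"
  using f
proof (induction n arbitrary: f thesis)
  case 0
  interpret M: module R M by fact
  have "f ` carrier (free_module R 0) = {\<zero>\<^bsub>M\<^esub>}"
    using free_module_hom_0[OF M 0(2)] by auto
  moreover have "lspan R M {} = {\<zero>\<^bsub>M\<^esub>}"
    using lspan.zero[of M R "{}"] lspan_least[of M "{\<zero>\<^bsub>M\<^esub>}" R "{}"] by blast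
  ultimately show ?case using 0(1)[of "{}"] by auto
next
  case (Suc n)
  interpret M: module R M by fact
  obtain g m where g: "g \<in> mod_hom R (free_module R n) M" "m \<in> carrier M"
    "\<And>v. v \<in> carrier (free_module R (Suc n)) \<Longrightarrow> f v = g (restrict v {..<n}) \<oplus>\<^bsub>M\<^esub> v n \<odot>\<^bsub>M\<^esub> m"
    using free_module_hom_Suc[OF M Suc.prems(2)] by metis
  obtain W where W: "finite W" "W \<subseteq> carrier M" "g ` carrier (free_module R n) = lspan R M W"
    using Suc.IH[OF _ g(1)] by metis
  then show ?case
    using Suc.prems(1)[of "insert m W"] g(2) free_module_image_Suc[OF M W(2) g(2) W(3) g(3)] by auto
qed

text \<open>Together with \<open>free_module_image\<close> this identifies finite spans with images
  of free modules of finite rank. It is the translation between finitely generated kernels and the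
  second free module in \<open>finitely_presented\<close>.\<close>

lemma free_module_onto_lspan:
  assumes M: "module R M" and W: "finite W" "W \<subseteq> carrier M"
  obtains n f where "f \<in> mod_hom R (free_module R n) M" "f ` carrier (free_module R n) = lspan R M W"
  using W
proof (induction W arbitrary: thesis)
  case empty
  interpret M: module R M by fact
  have "lspan R M {} = {\<zero>\<^bsub>M\<^esub>}"
    using lspan.zero[of M R "{}"] lspan_least[of M "{\<zero>\<^bsub>M\<^esub>}" R "{}"] by blast
  then show ?case using empty(1)[OF free_module_0_hom[OF M, of 0]] by auto
next
  case (insert m W)
  interpret M: module R M by fact
  obtain n g where g: "g \<in> mod_hom R (free_module R n) M" "g ` carrier (free_module R n) = lspan R M W"
    using insert by auto
  have m: "m \<in> carrier M" "W \<subseteq> carrier M" using insert by auto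
  let ?f = "\<lambda>v. g (restrict v {..<n}) \<oplus>\<^bsub>M\<^esub> v n \<odot>\<^bsub>M\<^esub> m"
  have "?f ` carrier (free_module R (Suc n)) = lspan R M (insert m W)"
    by (rule free_module_image_Suc[OF M m(2,1) g(2)]) auto
  then show ?case
    using insert.prems(1)[OF free_module_hom_extend[OF M g(1) m(1)]] by blast
qed

text \<open>Free modules are projective: a preimage under \<open>h\<close> is chosen for the image
  of each basis vector, one induction step at a time.\<close>

lemma free_module_lift:
  assumes M: "module R M" and P: "module R P" and f: "f \<in> mod_hom R (free_module R n) M"
    and h: "h \<in> mod_hom R P M" "h ` carrier P = carrier M"
  obtains g where "g \<in> mod_hom R (free_module R n) P"
    "\<And>v. v \<in> carrier (free_module R n) \<Longrightarrow> h (g v) = f v"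
  using f
proof (induction n arbitrary: f thesis)
  case 0
  have "h \<zero>\<^bsub>P\<^esub> = \<zero>\<^bsub>M\<^esub>" by (rule mod_hom_zero[OF P M h(1)])
  then show ?case
    using 0(1)[OF free_module_0_hom[OF P]] free_module_hom_0[OF M 0(2)] by auto
next
  case (Suc n)
  interpret P: module R P by fact
  obtain g m where g: "g \<in> mod_hom R (free_module R n) M" "m \<in> carrier M"
    "\<And>v. v \<in> carrier (free_module R (Suc n)) \<Longrightarrow> f v = g (restrict v {..<n}) \<oplus>\<^bsub>M\<^esub> v n \<odot>\<^bsub>M\<^esub> m"
    using free_module_hom_Suc[OF M Suc.prems(2)] by metis
  obtain g' where g': "g' \<in> mod_hom R (free_module R n) P"
    "\<And>v. v \<in> carrier (free_module R n) \<Longrightarrow> h (g' v) = g v"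
    using Suc.IH[OF _ g(1)] by metis
  obtain p where p: "p \<in> carrier P" "h p = m" using h(2) g(2) by (metis imageE)
  show ?case
  proof (rule Suc.prems(1)[OF free_module_hom_extend[OF P g'(1) p(1)]])
    fix v assume v: "v \<in> carrier (free_module R (Suc n))"
    then have r: "restrict v {..<n} \<in> carrier (free_module R n)" "v n \<in> carrier R"
      by (auto simp: PiE_iff)
    have "h (g' (restrict v {..<n}) \<oplus>\<^bsub>P\<^esub> v n \<odot>\<^bsub>P\<^esub> p) = h (g' (restrict v {..<n})) \<oplus>\<^bsub>M\<^esub> v n \<odot>\<^bsub>M\<^esub> h p"
      using mod_homD(2)[OF h(1)] mod_homD(3)[OF h(1)] mod_homD(1)[OF g'(1) r(1)] r(2) p(1)
      by simp
    then show "h (g' (restrict v {..<n}) \<oplus>\<^bsub>P\<^esub> v n \<odot>\<^bsub>P\<^esub> p) = f v"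
      using g(3)[OF v] g'(2)[OF r(1)] p by simp
  qed
qed

text \<open>From here on vectors are mostly elements of an abstract module; with these rules active
  the simplifier would unfold every sum and scalar multiple into coordinates.\<close>

declare free_module_simps [simp del]

section \<open>Finite presentation\<close>

text \<open>The definition of \<open>mod_hom\<close> speaks of sums, not differences. That
  \<open>f (x - y)\<close> vanishes when \<open>f x = f y\<close> is therefore read off from
  \<open>(x - y) + y = x\<close> by this rule and the next.\<close>

lemma (in abelian_group) minus_add_cancel:
  "x \<in> carrier G \<Longrightarrow> y \<in> carrier G \<Longrightarrow> (x \<ominus> y) \<oplus> y = x"
  by (simp add: a_minus_def a_assoc l_neg)

lemma (in abelian_group) add_eq_right_imp_zero:
  "x \<oplus> y = y \<Longrightarrow> x \<in> carrier G \<Longrightarrow> y \<in> carrier G \<Longrightarrow> x = \<zero>"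
  by (simp add: add.r_cancel_one)

lemma (in module) smult_minus_distr:
  "a \<in> carrier R \<Longrightarrow> x \<in> carrier M \<Longrightarrow> y \<in> carrier M \<Longrightarrow>
    a \<odot>\<^bsub>M\<^esub> (x \<ominus>\<^bsub>M\<^esub> y) = a \<odot>\<^bsub>M\<^esub> x \<ominus>\<^bsub>M\<^esub> a \<odot>\<^bsub>M\<^esub> y"
  by (simp add: a_minus_def smult_r_distr smult_r_minus)

lemma fg_subI:
  "module R M \<Longrightarrow> finite W \<Longrightarrow> W \<subseteq> carrier M \<Longrightarrow> N = lspan R M W \<Longrightarrow> fg_sub R M N"
  using module.lspan_incl[of R M W] unfolding fg_sub_def by blast

lemma finitely_presentedI:
  assumes M: "module R M" and f: "f \<in> mod_hom R (free_module R n) M"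
    "f ` carrier (free_module R n) = carrier M"
    and k: "fg_sub R (free_module R n) (a_kernel (free_module R n) M f)"
  shows "finitely_presented R M"
proof -
  interpret M: module R M by fact
  obtain W where W: "finite W" "W \<subseteq> a_kernel (free_module R n) M f"
    "a_kernel (free_module R n) M f = lspan R (free_module R n) W"
    using k by (auto simp: fg_sub_def)
  then have "W \<subseteq> carrier (free_module R n)" by (auto simp: a_kernel_def')
  from free_module_onto_lspan[OF M.module_free_module W(1) this] f W(3) show ?thesis
    unfolding finitely_presented_def by metis
qed

lemma finitely_presentedE:
  assumes "module R M" "finitely_presented R M"
  obtains n f where "f \<in> mod_hom R (free_module R n) M" "f ` carrier (free_module R n) = carrier M"
    "fg_sub R (free_module R n) (a_kernel (free_module R n) M f)"
proof -
  interpret M: module R M by fact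
  obtain n m f g where *: "f \<in> mod_hom R (free_module R n) M" "f ` carrier (free_module R n) = carrier M"
    "g \<in> mod_hom R (free_module R m) (free_module R n)"
    "g ` carrier (free_module R m) = a_kernel (free_module R n) M f"
    using assms(2) unfolding finitely_presented_def by blast
  obtain W where W: "finite W" "W \<subseteq> carrier (free_module R n)"
    "a_kernel (free_module R n) M f = lspan R (free_module R n) W"
    using free_module_image[OF M.module_free_module *(3)] *(4) by metis
  then have "fg_sub R (free_module R n) (a_kernel (free_module R n) M f)"
    by (rule fg_subI[OF M.module_free_module])
  then show ?thesis using * that by blast
qed

lemma mod_hom_kernel_closed:
  assumes M: "module R M" and N: "module R N" and f: "f \<in> mod_hom R M N" and W: "W \<subseteq> a_kernel M N f"
  shows "lspan R M W \<subseteq> a_kernel M N f"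
proof (rule lspan_least)
  interpret M: module R M by fact
  interpret N: module R N by fact
  show "\<zero>\<^bsub>M\<^esub> \<in> a_kernel M N f" using mod_hom_zero[OF M N f] by (simp add: a_kernel_def')
  fix a w x assume "a \<in> carrier R" "w \<in> W" "x \<in> a_kernel M N f"
  with W show "a \<odot>\<^bsub>M\<^esub> w \<oplus>\<^bsub>M\<^esub> x \<in> a_kernel M N f"
    by (auto simp: a_kernel_def' mod_homD[OF f] subset_iff)
qed

text \<open>With \<open>h \<circ> \<alpha> = f\<close> and \<open>f \<circ> \<beta> = h\<close>, write \<open>x = (x - \<alpha> (\<beta> x)) + \<alpha> (\<beta> x)\<close>.\<close>

lemma finitely_presented_kernel:
  assumes M: "module R M" and fp: "finitely_presented R M"
    and h: "h \<in> mod_hom R (free_module R p) M" "h ` carrier (free_module R p) = carrier M"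
  shows "fg_sub R (free_module R p) (a_kernel (free_module R p) M h)"
proof -
  interpret M: module R M by fact
  let ?F = "free_module R p"
  interpret F: module R ?F by (rule M.module_free_module)
  obtain n f where f: "f \<in> mod_hom R (free_module R n) M" "f ` carrier (free_module R n) = carrier M"
    "fg_sub R (free_module R n) (a_kernel (free_module R n) M f)"
    by (rule finitely_presentedE[OF M fp])
  let ?G = "free_module R n"
  interpret G: module R ?G by (rule M.module_free_module)
  obtain \<alpha> where \<alpha>: "\<alpha> \<in> mod_hom R ?G ?F" "\<And>v. v \<in> carrier ?G \<Longrightarrow> h (\<alpha> v) = f v"
    by (rule free_module_lift[OF M F.module_axioms f(1) h]) blast
  obtain \<beta> where \<beta>: "\<beta> \<in> mod_hom R ?F ?G" "\<And>v. v \<in> carrier ?F \<Longrightarrow> f (\<beta> v) = h v"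
    by (rule free_module_lift[OF M G.module_axioms h(1) f(1,2)]) blast
  obtain W where W: "finite W" "W \<subseteq> a_kernel ?G M f" "a_kernel ?G M f = lspan R ?G W"
    using f(3) by (auto simp: fg_sub_def)
  \<comment> \<open>Since \<open>h \<circ> \<alpha> \<circ> \<beta> = h\<close>, the map
    \<open>\<phi>\<close> takes values in the kernel of \<open>h\<close>, and its image is finitely
    generated because \<open>?F\<close> is. On that kernel \<open>\<beta>\<close> lands in the
    kernel of \<open>f\<close>, so the images of \<open>W\<close> under \<open>\<alpha>\<close>
    supply the remaining generators.\<close>
  define \<phi> where "\<phi> = (\<lambda>x. x \<ominus>\<^bsub>?F\<^esub> \<alpha> (\<beta> x))"
  note cl = mod_homD(1)[OF \<alpha>(1)] mod_homD(1)[OF \<beta>(1)] mod_homD(1)[OF h(1)]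
  note \<alpha>\<beta> = cl mod_homD(2,3)[OF \<alpha>(1)] mod_homD(2,3)[OF \<beta>(1)]
  have \<phi>: "\<phi> \<in> mod_hom R ?F ?F"
    unfolding mod_hom_def \<phi>_def
  proof (intro CollectI conjI ballI funcsetI)
    fix x assume x: "x \<in> carrier ?F"
    then show "x \<ominus>\<^bsub>?F\<^esub> \<alpha> (\<beta> x) \<in> carrier ?F" by (intro F.M.minus_closed cl)
    fix y assume y: "y \<in> carrier ?F"
    have "\<alpha> (\<beta> (x \<oplus>\<^bsub>?F\<^esub> y)) = \<alpha> (\<beta> x) \<oplus>\<^bsub>?F\<^esub> \<alpha> (\<beta> y)"
      using x y by (simp only: \<alpha>\<beta>)
    then show "x \<oplus>\<^bsub>?F\<^esub> y \<ominus>\<^bsub>?F\<^esub> \<alpha> (\<beta> (x \<oplus>\<^bsub>?F\<^esub> y)) =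
        (x \<ominus>\<^bsub>?F\<^esub> \<alpha> (\<beta> x)) \<oplus>\<^bsub>?F\<^esub> (y \<ominus>\<^bsub>?F\<^esub> \<alpha> (\<beta> y))"
      using x y cl(1)[OF cl(2)[OF x]] cl(1)[OF cl(2)[OF y]]
      by (simp only: a_minus_def F.M.minus_add F.M.a_assoc F.M.a_lcomm F.M.a_closed F.M.a_inv_closed)
  next
    fix a x assume "a \<in> carrier R" "x \<in> carrier ?F"
    then show "a \<odot>\<^bsub>?F\<^esub> x \<ominus>\<^bsub>?F\<^esub> \<alpha> (\<beta> (a \<odot>\<^bsub>?F\<^esub> x)) = a \<odot>\<^bsub>?F\<^esub> (x \<ominus>\<^bsub>?F\<^esub> \<alpha> (\<beta> x))"
      by (simp only: F.smult_minus_distr \<alpha>\<beta>)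
  qed
  obtain V where V: "finite V" "V \<subseteq> carrier ?F" "\<phi> ` carrier ?F = lspan R ?F V"
    by (rule free_module_image[OF F.module_axioms \<phi>])
  have Wc: "W \<subseteq> carrier ?G" using W(2) by (auto simp: a_kernel_def')
  have ker: "lspan R ?F (V \<union> \<alpha> ` W) = a_kernel ?F M h"
  proof
    have "\<phi> x \<in> a_kernel ?F M h" if x: "x \<in> carrier ?F" for x
    proof -
      have ax: "\<alpha> (\<beta> x) \<in> carrier ?F" using cl x by blast
      have eq: "\<phi> x \<oplus>\<^bsub>?F\<^esub> \<alpha> (\<beta> x) = x"
        unfolding \<phi>_def using x ax by (rule F.M.minus_add_cancel)
      have "h (\<phi> x) \<oplus>\<^bsub>M\<^esub> h (\<alpha> (\<beta> x)) = h x"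
        using mod_homD(2)[OF h(1) mod_homD(1)[OF \<phi> x] ax] by (simp only: eq)
      then have "h (\<phi> x) \<oplus>\<^bsub>M\<^esub> h x = h x"
        by (simp only: \<alpha>(2)[OF cl(2)[OF x]] \<beta>(2)[OF x])
      then have "h (\<phi> x) = \<zero>\<^bsub>M\<^esub>"
        by (rule M.M.add_eq_right_imp_zero) (use cl(3)[OF x] cl(3)[OF mod_homD(1)[OF \<phi> x]] in auto)
      then show ?thesis using mod_homD(1)[OF \<phi> x] by (simp add: a_kernel_def')
    qed
    then have "\<phi> ` carrier ?F \<subseteq> a_kernel ?F M h" by (rule image_subsetI)
    then have "V \<subseteq> a_kernel ?F M h" unfolding V(3) using F.lspan_incl[OF V(2)] by (rule subset_trans[rotated])
    moreover have "\<alpha> ` W \<subseteq> a_kernel ?F M h"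
      using W(2) cl(1) \<alpha>(2) unfolding a_kernel_def' by auto
    ultimately show "lspan R ?F (V \<union> \<alpha> ` W) \<subseteq> a_kernel ?F M h"
      by (intro mod_hom_kernel_closed[OF F.module_axioms M h(1)]) auto
    show "a_kernel ?F M h \<subseteq> lspan R ?F (V \<union> \<alpha> ` W)"
    proof
      fix x assume "x \<in> a_kernel ?F M h"
      then have x: "x \<in> carrier ?F" "h x = \<zero>\<^bsub>M\<^esub>" unfolding a_kernel_def' by auto
      have ax: "\<alpha> (\<beta> x) \<in> carrier ?F" using cl x by blast
      have "\<phi> x \<oplus>\<^bsub>?F\<^esub> \<alpha> (\<beta> x) = x"
        unfolding \<phi>_def using x(1) ax by (rule F.M.minus_add_cancel)
      moreover have "\<phi> x \<in> lspan R ?F (V \<union> \<alpha> ` W)"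
        using V(3) x lspan_mono[of V "V \<union> \<alpha> ` W" R ?F] by blast
      moreover have "\<beta> x \<in> a_kernel ?G M f"
        unfolding a_kernel_def' using x \<beta>(2) cl(2) by auto
      then have "\<alpha> (\<beta> x) \<in> lspan R ?F (\<alpha> ` W)"
        using W(3) image_lspan[OF G.module_axioms F.module_axioms \<alpha>(1) Wc] by blast
      then have "\<alpha> (\<beta> x) \<in> lspan R ?F (V \<union> \<alpha> ` W)"
        using lspan_mono[of "\<alpha> ` W" "V \<union> \<alpha> ` W" R ?F] by blast
      moreover have "V \<union> \<alpha> ` W \<subseteq> carrier ?F" using V(2) Wc cl(1) by auto
      ultimately show "x \<in> lspan R ?F (V \<union> \<alpha> ` W)"
        using F.lspan_add[of "V \<union> \<alpha> ` W" "\<phi> x" "\<alpha> (\<beta> x)"] by (simp only:)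
    qed
  qed
  then show ?thesis
    using V(1,2) W(1) Wc cl(1) by (intro fg_subI[OF F.module_axioms, of "V \<union> \<alpha> ` W"]) auto
qed

text \<open>A relation of \<open>N\<close> becomes a relation of \<open>M\<close> after subtracting
  a combination of lifts of generators of the kernel of \<open>g\<close>. So these finitely many
  lifts and the relations of \<open>M\<close> generate all relations of \<open>N\<close>.\<close>

lemma finitely_presented_quotient:
  assumes M: "module R M" and N: "module R N" and fp: "finitely_presented R M"
    and g: "g \<in> mod_hom R M N" "g ` carrier M = carrier N" "fg_sub R M (a_kernel M N g)"
  shows "finitely_presented R N"
proof -
  interpret M: module R M by fact
  interpret N: module R N by fact
  obtain n f where f: "f \<in> mod_hom R (free_module R n) M" "f ` carrier (free_module R n) = carrier M"
    "fg_sub R (free_module R n) (a_kernel (free_module R n) M f)"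
    by (rule finitely_presentedE[OF M fp])
  let ?F = "free_module R n"
  interpret F: module R ?F by (rule M.module_free_module)
  obtain W where W: "finite W" "W \<subseteq> a_kernel ?F M f" "a_kernel ?F M f = lspan R ?F W"
    using f(3) by (auto simp: fg_sub_def)
  obtain V where V: "finite V" "V \<subseteq> a_kernel M N g" "a_kernel M N g = lspan R M V"
    using g(3) by (auto simp: fg_sub_def)
  have "V \<subseteq> f ` carrier ?F" using V(2) f(2) by (auto simp: a_kernel_def')
  then obtain V' where V': "finite V'" "V' \<subseteq> carrier ?F" "V = f ` V'"
    using finite_subset_image[OF V(1)] by metis
  have gf: "g \<circ> f \<in> mod_hom R ?F N" by (rule mod_hom_comp[OF f(1) g(1)])
  have Wc: "W \<subseteq> carrier ?F" using W(2) unfolding a_kernel_def' by auto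
  have c: "W \<union> V' \<subseteq> carrier ?F" using V'(2) Wc by blast
  have "a_kernel ?F N (g \<circ> f) = lspan R ?F (W \<union> V')"
  proof
    have "g (f v) = \<zero>\<^bsub>N\<^esub>" if "v \<in> W" for v
      using that W(2) mod_hom_zero[OF M N g(1)] unfolding a_kernel_def' by auto
    moreover have "g (f v) = \<zero>\<^bsub>N\<^esub>" if "v \<in> V'" for v
      using that V(2) V'(3) unfolding a_kernel_def' by auto
    ultimately have "W \<union> V' \<subseteq> a_kernel ?F N (g \<circ> f)"
      using c unfolding a_kernel_def' by auto
    then show "lspan R ?F (W \<union> V') \<subseteq> a_kernel ?F N (g \<circ> f)"
      by (rule mod_hom_kernel_closed[OF F.module_axioms N gf])
    show "a_kernel ?F N (g \<circ> f) \<subseteq> lspan R ?F (W \<union> V')"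
    proof
      fix x assume "x \<in> a_kernel ?F N (g \<circ> f)"
      then have x: "x \<in> carrier ?F" "f x \<in> a_kernel M N g"
        using mod_homD(1)[OF f(1)] unfolding a_kernel_def' by auto
      then have "f x \<in> f ` lspan R ?F V'"
        using V(3) V'(3) image_lspan[OF F.module_axioms M f(1) V'(2)] by simp
      then obtain y where y: "y \<in> lspan R ?F V'" "f x = f y" by blast
      have yc: "y \<in> carrier ?F" using y F.lspan_closed[OF V'(2)] by blast
      have d: "x \<ominus>\<^bsub>?F\<^esub> y \<in> carrier ?F" using x(1) yc by (rule F.M.minus_closed)
      have e: "(x \<ominus>\<^bsub>?F\<^esub> y) \<oplus>\<^bsub>?F\<^esub> y = x" using x(1) yc by (rule F.M.minus_add_cancel)
      have "f (x \<ominus>\<^bsub>?F\<^esub> y) \<oplus>\<^bsub>M\<^esub> f y = f y"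
        using mod_homD(2)[OF f(1) d yc] by (simp only: e y(2))
      then have "f (x \<ominus>\<^bsub>?F\<^esub> y) = \<zero>\<^bsub>M\<^esub>"
        by (rule M.M.add_eq_right_imp_zero[OF _ mod_homD(1)[OF f(1) d] mod_homD(1)[OF f(1) yc]])
      then have "x \<ominus>\<^bsub>?F\<^esub> y \<in> lspan R ?F W"
        using d W(3) unfolding a_kernel_def' by blast
      then have "(x \<ominus>\<^bsub>?F\<^esub> y) \<oplus>\<^bsub>?F\<^esub> y \<in> lspan R ?F (W \<union> V')"
        using y(1) lspan_mono[of W "W \<union> V'" R ?F] lspan_mono[of V' "W \<union> V'" R ?F]
        by (intro F.lspan_add[OF c]) auto
      then show "x \<in> lspan R ?F (W \<union> V')" by (simp only: e)
    qed
  qed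
  then have "fg_sub R ?F (a_kernel ?F N (g \<circ> f))"
    using W(1) V'(1) by (intro fg_subI[OF F.module_axioms _ c]) auto
  moreover have "(g \<circ> f) ` carrier ?F = carrier N" by (simp only: image_comp[symmetric] f(2) g(2))
  ultimately show ?thesis using finitely_presentedI[OF N gf] by blast
qed

lemma fg_sub_zero: "module R M \<Longrightarrow> fg_sub R M {\<zero>\<^bsub>M\<^esub>}"
  using lspan.zero[of M R "{}"] lspan_least[of M "{\<zero>\<^bsub>M\<^esub>}" R "{}"]
  by (intro fg_subI[of R M "{}"]) auto

lemma finitely_presented_iso:
  assumes M: "module R M" and N: "module R N" and fp: "finitely_presented R M"
    and g: "g \<in> mod_hom R M N" "g ` carrier M = carrier N" "inj_on g (carrier M)"
  shows "finitely_presented R N"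
proof (rule finitely_presented_quotient[OF M N fp g(1,2)])
  interpret M: module R M by fact
  have z: "g \<zero>\<^bsub>M\<^esub> = \<zero>\<^bsub>N\<^esub>" by (rule mod_hom_zero[OF M N g(1)])
  have "x = \<zero>\<^bsub>M\<^esub>" if "x \<in> carrier M" "g x = \<zero>\<^bsub>N\<^esub>" for x
    using inj_onD[OF g(3), of x "\<zero>\<^bsub>M\<^esub>"] that z by simp
  then have "a_kernel M N g = {\<zero>\<^bsub>M\<^esub>}"
    using z M.M.zero_closed unfolding a_kernel_def' by blast
  then show "fg_sub R M (a_kernel M N g)" using fg_sub_zero[OF M] by simp
qed

lemma fg_sub_image:
  assumes M: "module R M" and N: "module R N" and g: "g \<in> mod_hom R M N" "g ` carrier M = Y"
    and fg: "fg_sub R M (carrier M)"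
  shows "fg_sub R N Y"
proof -
  obtain W where W: "finite W" "W \<subseteq> carrier M" "carrier M = lspan R M W"
    using fg unfolding fg_sub_def by blast
  then have "Y = lspan R N (g ` W)" using image_lspan[OF M N g(1) W(2)] g(2) by metis
  moreover have "g ` W \<subseteq> Y" using W(2) g(2) by blast
  ultimately show ?thesis using W(1) unfolding fg_sub_def by blast
qed

section \<open>Ideals as modules\<close>

lemma mult_module_simps [simp]:
  "carrier (mult_module S N) = N"
  "\<zero>\<^bsub>mult_module S N\<^esub> = \<zero>\<^bsub>S\<^esub>"
  "x \<oplus>\<^bsub>mult_module S N\<^esub> y = x \<oplus>\<^bsub>S\<^esub> y"
  "a \<odot>\<^bsub>mult_module S N\<^esub> x = a \<otimes>\<^bsub>S\<^esub> x"
  by (simp_all add: mult_module_def)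

lemma (in cring) ideal_closed:
  assumes "ideal I R"
  shows "x \<in> I \<Longrightarrow> x \<in> carrier R" "\<zero> \<in> I" "x \<in> I \<Longrightarrow> y \<in> I \<Longrightarrow> x \<oplus> y \<in> I"
    "x \<in> I \<Longrightarrow> \<ominus> x \<in> I" "a \<in> carrier R \<Longrightarrow> x \<in> I \<Longrightarrow> a \<otimes> x \<in> I" "a \<in> carrier R \<Longrightarrow> x \<in> I \<Longrightarrow> x \<otimes> a \<in> I"
proof -
  interpret ideal I R by fact
  show "x \<in> I \<Longrightarrow> x \<in> carrier R" "\<zero> \<in> I" "x \<in> I \<Longrightarrow> y \<in> I \<Longrightarrow> x \<oplus> y \<in> I"
    "x \<in> I \<Longrightarrow> \<ominus> x \<in> I" "a \<in> carrier R \<Longrightarrow> x \<in> I \<Longrightarrow> a \<otimes> x \<in> I" "a \<in> carrier R \<Longrightarrow> x \<in> I \<Longrightarrow> x \<otimes> a \<in> I"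
    by (auto intro: I_l_closed I_r_closed)
qed

lemma (in cring) module_mult_module:
  assumes "ideal I R" shows "module R (mult_module R I)"
proof (rule moduleI)
  note c = ideal_closed[OF assms]
  show "abelian_group (mult_module R I)"
  proof (rule abelian_groupI)
    fix x assume "x \<in> carrier (mult_module R I)"
    then show "\<exists>y\<in>carrier (mult_module R I). y \<oplus>\<^bsub>mult_module R I\<^esub> x = \<zero>\<^bsub>mult_module R I\<^esub>"
      by (intro bexI[of _ "\<ominus> x"]) (auto simp: c l_neg)
  qed (auto simp: c a_ac)
qed (auto simp: ideal_closed[OF assms] l_distr r_distr m_assoc is_cring)

lemma (in cring) ideal_lspan:
  assumes "W \<subseteq> carrier R" shows "ideal (lspan R (mult_module R (carrier R)) W) R"
proof -
  interpret M: module R "mult_module R (carrier R)" by (rule module_mult_module[OF oneideal])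
  let ?I = "lspan R (mult_module R (carrier R)) W"
  have W: "W \<subseteq> carrier (mult_module R (carrier R))" using assms by simp
  note cl = M.lspan_closed[OF W]
  have mult: "a \<otimes> x \<in> ?I" if "a \<in> carrier R" "x \<in> ?I" for a x
    using M.lspan_smult[OF W] that by simp
  show ?thesis
  proof (rule idealI[OF ring_axioms])
    show "subgroup ?I (add_monoid R)"
    proof (rule add.subgroupI)
      fix x assume x: "x \<in> ?I"
      then have "\<ominus> \<one> \<otimes> x \<in> ?I" by (intro mult) auto
      then show "\<ominus> x \<in> ?I" using x cl by (auto simp: l_minus)
    next
      fix x y assume "x \<in> ?I" "y \<in> ?I"
      then show "x \<oplus> y \<in> ?I" using M.lspan_add[OF W] by simp
    qed (use cl lspan.zero[of "mult_module R (carrier R)" R W] in auto)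
    fix a x assume a: "a \<in> ?I" "x \<in> carrier R"
    then show "x \<otimes> a \<in> ?I" by (intro mult)
    then show "a \<otimes> x \<in> ?I" using a cl m_comm[of a x] by auto
  qed
qed

lemma (in cring) genideal_eq_lspan:
  assumes "W \<subseteq> carrier R" shows "Idl W = lspan R (mult_module R (carrier R)) W"
proof
  interpret M: module R "mult_module R (carrier R)" by (rule module_mult_module[OF oneideal])
  have "W \<subseteq> lspan R (mult_module R (carrier R)) W" using M.lspan_incl assms by simp
  then show "Idl W \<subseteq> lspan R (mult_module R (carrier R)) W"
    by (rule genideal_minimal[OF ideal_lspan[OF assms]])
  note c = ideal_closed[OF genideal_ideal[OF assms]] genideal_self[OF assms]
  then show "lspan R (mult_module R (carrier R)) W \<subseteq> Idl W"
    by (intro lspan_least) auto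
qed

text \<open>A span never looks at the carrier of its module, so generators of an ideal may be read
  in the ideal or in the whole ring.\<close>

lemma lspan_mult_module: "lspan R (mult_module S N) W = lspan R (mult_module S N') W"
  by (intro equalityI lspan_least)
    (use lspan.zero[of "mult_module S N" R W] lspan.zero[of "mult_module S N'" R W]
      lspan.step[of _ R _ W _ "mult_module S N"] lspan.step[of _ R _ W _ "mult_module S N'"] in auto)

lemma (in cring) fg_ideal_iff:
  "fg_ideal I R \<longleftrightarrow> ideal I R \<and> fg_sub R (mult_module R I) I"
proof
  assume "fg_ideal I R"
  then obtain W where W: "finite W" "W \<subseteq> carrier R" "I = Idl W" by (auto simp: fg_ideal_def)
  then have "I = lspan R (mult_module R I) W"
    using genideal_eq_lspan lspan_mult_module by metis
  then show "ideal I R \<and> fg_sub R (mult_module R I) I"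
    unfolding fg_sub_def using W genideal_ideal genideal_self by metis
next
  assume I: "ideal I R \<and> fg_sub R (mult_module R I) I"
  then obtain W where W: "finite W" "W \<subseteq> I" "I = lspan R (mult_module R I) W"
    by (auto simp: fg_sub_def)
  moreover from this have "W \<subseteq> carrier R" using I ideal_closed(1) by blast
  ultimately show "fg_ideal I R"
    unfolding fg_ideal_def using genideal_eq_lspan lspan_mult_module by metis
qed

section \<open>Descent of finite presentation along a conductor square\<close>

text \<open>\<open>A\<close> is any image of \<open>R\<close> with kernel \<open>C\<close>, so the
  arguments work with \<open>\<pi>\<close> and never with cosets. \<open>C\<close> is an ideal of
  \<open>T\<close> inside \<open>R\<close>: a product of an element of \<open>C\<close> with any
  element of \<open>T\<close> is back in \<open>R\<close>.\<close>

locale conductor_pullback = R: cring R + T: cring T + A: cring A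
  for R :: "('a, 'x) ring_scheme" and T :: "('a, 'x) ring_scheme" and A :: "('b, 'z) ring_scheme" +
  fixes \<pi> :: "'a \<Rightarrow> 'b" and C :: "'a set"
  assumes sub: "carrier R \<subseteq> carrier T"
    and ops: "monoid.mult R = monoid.mult T" "ring.add R = ring.add T" "\<one>\<^bsub>R\<^esub> = \<one>\<^bsub>T\<^esub>" "\<zero>\<^bsub>R\<^esub> = \<zero>\<^bsub>T\<^esub>"
    and C_ideal: "ideal C T" and C_sub: "C \<subseteq> carrier R"
    and \<pi>_hom: "\<pi> \<in> ring_hom R A" and \<pi>_onto: "\<pi> ` carrier R = carrier A"
    and \<pi>_ker: "\<And>x. x \<in> carrier R \<Longrightarrow> \<pi> x = \<zero>\<^bsub>A\<^esub> \<longleftrightarrow> x \<in> C"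
begin

lemma \<pi>_simps [simp]:
  "x \<in> carrier R \<Longrightarrow> \<pi> x \<in> carrier A"
  "x \<in> carrier R \<Longrightarrow> y \<in> carrier R \<Longrightarrow> \<pi> (x \<oplus>\<^bsub>R\<^esub> y) = \<pi> x \<oplus>\<^bsub>A\<^esub> \<pi> y"
  "x \<in> carrier R \<Longrightarrow> y \<in> carrier R \<Longrightarrow> \<pi> (x \<otimes>\<^bsub>R\<^esub> y) = \<pi> x \<otimes>\<^bsub>A\<^esub> \<pi> y"
  "\<pi> \<one>\<^bsub>R\<^esub> = \<one>\<^bsub>A\<^esub>" "\<pi> \<zero>\<^bsub>R\<^esub> = \<zero>\<^bsub>A\<^esub>"
proof -
  interpret ring_hom_cring R A \<pi>
    using \<pi>_hom by (simp add: ring_hom_cring_def ring_hom_cring_axioms_def R.is_cring A.is_cring)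
  show "x \<in> carrier R \<Longrightarrow> \<pi> x \<in> carrier A"
  "x \<in> carrier R \<Longrightarrow> y \<in> carrier R \<Longrightarrow> \<pi> (x \<oplus>\<^bsub>R\<^esub> y) = \<pi> x \<oplus>\<^bsub>A\<^esub> \<pi> y"
  "x \<in> carrier R \<Longrightarrow> y \<in> carrier R \<Longrightarrow> \<pi> (x \<otimes>\<^bsub>R\<^esub> y) = \<pi> x \<otimes>\<^bsub>A\<^esub> \<pi> y"
  "\<pi> \<one>\<^bsub>R\<^esub> = \<one>\<^bsub>A\<^esub>" "\<pi> \<zero>\<^bsub>R\<^esub> = \<zero>\<^bsub>A\<^esub>" by auto
qed

lemma \<pi>_eq_iff:
  assumes "x \<in> carrier R" "y \<in> carrier R" shows "\<pi> x = \<pi> y \<longleftrightarrow> x \<ominus>\<^bsub>R\<^esub> y \<in> C"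
proof -
  have "\<pi> (x \<ominus>\<^bsub>R\<^esub> y) \<oplus>\<^bsub>A\<^esub> \<pi> y = \<pi> x"
    using assms \<pi>_simps(2)[of "x \<ominus>\<^bsub>R\<^esub> y" y]
    by (simp add: R.minus_add_cancel)
  then have "\<pi> x = \<pi> y \<longleftrightarrow> \<pi> (x \<ominus>\<^bsub>R\<^esub> y) = \<zero>\<^bsub>A\<^esub>"
    using assms A.add_eq_right_imp_zero[of "\<pi> (x \<ominus>\<^bsub>R\<^esub> y)" "\<pi> y"]
    by (auto dest: sym)
  then show ?thesis using assms \<pi>_ker by simp
qed

lemmas C_closed = T.ideal_closed[OF C_ideal]

lemma ideal_image:
  assumes "ideal I R" shows "ideal (\<pi> ` I) A"
proof (rule idealI[OF A.ring_axioms])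
  note c = R.ideal_closed[OF assms]
  show "subgroup (\<pi> ` I) (add_monoid A)"
  proof (rule A.add.subgroupI)
    fix x assume "x \<in> \<pi> ` I"
    then obtain i where i: "i \<in> I" "x = \<pi> i" by blast
    have "\<pi> (\<ominus>\<^bsub>R\<^esub> i) \<oplus>\<^bsub>A\<^esub> \<pi> i = \<zero>\<^bsub>A\<^esub>"
      using i c(1) \<pi>_simps(2)[of "\<ominus>\<^bsub>R\<^esub> i" i] by (simp add: R.l_neg)
    then have "\<ominus>\<^bsub>A\<^esub> x = \<pi> (\<ominus>\<^bsub>R\<^esub> i)" using i c(1) by (intro A.minus_equality) auto
    then show "\<ominus>\<^bsub>A\<^esub> x \<in> \<pi> ` I" using i c by auto
  next
    fix x y assume "x \<in> \<pi> ` I" "y \<in> \<pi> ` I"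
    then show "x \<oplus>\<^bsub>A\<^esub> y \<in> \<pi> ` I" using c by (auto simp flip: \<pi>_simps(2))
  qed (use c in auto)
  fix a x assume "a \<in> \<pi> ` I" and "x \<in> carrier A"
  moreover from this obtain x' where "x' \<in> carrier R" "x = \<pi> x'" using \<pi>_onto by blast
  ultimately show "x \<otimes>\<^bsub>A\<^esub> a \<in> \<pi> ` I" "a \<otimes>\<^bsub>A\<^esub> x \<in> \<pi> ` I" using c by (auto simp flip: \<pi>_simps(3))
qed

lemma image_lspan_ideal:
  assumes "ideal I R" "W \<subseteq> I"
  shows "\<pi> ` lspan R (mult_module R I) W = lspan A (mult_module A (\<pi> ` I)) (\<pi> ` W)"
  by (rule semilinear_image_lspan[OF R.module_mult_module[OF assms(1)]
        A.module_mult_module[OF ideal_image[OF assms(1)]] _ \<pi>_onto])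
    (use assms R.ideal_closed(1)[OF assms(1)] in auto)

lemma fg_sub_image_ideal:
  assumes "ideal I R" "fg_sub R (mult_module R I) I"
  shows "fg_sub A (mult_module A (\<pi> ` I)) (\<pi> ` I)"
proof -
  obtain W where W: "finite W" "W \<subseteq> I" "I = lspan R (mult_module R I) W"
    using assms(2) by (auto simp: fg_sub_def)
  then show ?thesis
    using image_lspan_ideal[OF assms(1) W(2)] unfolding fg_sub_def
    by (intro exI[of _ "\<pi> ` W"]) auto
qed

section \<open>Coordinatewise reduction modulo the conductor\<close>

definition \<pi>vec :: "nat \<Rightarrow> (nat \<Rightarrow> 'a) \<Rightarrow> nat \<Rightarrow> 'b" where
  "\<pi>vec n v = (\<lambda>i\<in>{..<n}. \<pi> (v i))"

lemma \<pi>vec_image_lspan: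
  assumes "W \<subseteq> carrier (free_module R n)"
  shows "\<pi>vec n ` lspan R (free_module R n) W = lspan A (free_module A n) (\<pi>vec n ` W)"
  by (rule semilinear_image_lspan[OF R.module_free_module A.module_free_module assms \<pi>_onto])
    (auto simp: \<pi>vec_def PiE_iff fun_eq_iff free_module_simps)

lemma \<pi>vec_onto: "\<pi>vec n ` carrier (free_module R n) = carrier (free_module A n)"
proof
  show "\<pi>vec n ` carrier (free_module R n) \<subseteq> carrier (free_module A n)"
    unfolding free_module_simps \<pi>vec_def
    by (intro image_subsetI restrict_PiE_iff[THEN iffD2] ballI) (drule PiE_mem, auto)
  show "carrier (free_module A n) \<subseteq> \<pi>vec n ` carrier (free_module R n)"
  proof
    fix w assume w: "w \<in> carrier (free_module A n)"
    define v where "v = (\<lambda>i\<in>{..<n}. inv_into (carrier R) \<pi> (w i))"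
    have w': "w i \<in> \<pi> ` carrier R" if "i < n" for i
      using w that \<pi>_onto by (auto simp: free_module_simps)
    have "v \<in> carrier (free_module R n)"
      using inv_into_into[OF w'] by (simp add: v_def free_module_simps)
    moreover have "\<pi>vec n v i = w i" for i
    proof (cases "i < n")
      case True
      then show ?thesis using f_inv_into_f[OF w'[OF True]] by (simp add: v_def \<pi>vec_def)
    next
      case False
      then show ?thesis using w by (auto simp: \<pi>vec_def free_module_simps PiE_iff extensional_def)
    qed
    then have "w = \<pi>vec n v" by auto
    ultimately show "w \<in> \<pi>vec n ` carrier (free_module R n)" by blast
  qed
qed

text \<open>\<open>h\<close> is only linear over \<open>R\<close>, but \<open>h v\<close> is a sum
  of products of the \<open>v i\<close> with elements of \<open>U\<close>, formed inside
  \<open>T\<close>. Scaling by \<open>t\<close> keeps the entries in \<open>C\<close>, hence in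
  \<open>R\<close>, and can be taken out of this sum. So \<open>h\<close> is linear over
  \<open>T\<close> on vectors over \<open>C\<close>, and its kernel there is a
  \<open>T\<close>-module.\<close>

lemma conductor_vec_scale:
  assumes M: "ideal U R" and h: "h \<in> mod_hom R (free_module R n) (mult_module R U)"
    and v: "v \<in> {..<n} \<rightarrow>\<^sub>E C" and t: "t \<in> carrier T"
  shows "h v \<in> C \<and> h (\<lambda>i\<in>{..<n}. t \<otimes>\<^bsub>T\<^esub> v i) = t \<otimes>\<^bsub>T\<^esub> h v"
  using h v
proof (induction n arbitrary: h v)
  case 0
  then show ?case
    using free_module_hom_0[OF R.module_mult_module[OF M] 0(1)] t C_closed
    by (simp add: ops free_module_simps)
next
  case (Suc n)
  note c = R.ideal_closed[OF M]
  obtain g m where g: "g \<in> mod_hom R (free_module R n) (mult_module R U)" "m \<in> U"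
    "\<And>v. v \<in> carrier (free_module R (Suc n)) \<Longrightarrow> h v = g (restrict v {..<n}) \<oplus>\<^bsub>T\<^esub> v n \<otimes>\<^bsub>T\<^esub> m"
    using free_module_hom_Suc[OF R.module_mult_module[OF M] Suc.prems(1)]
    by (metis mult_module_simps(1,3,4) ops(1,2))
  let ?r = "restrict v {..<n}"
  have r: "?r \<in> {..<n} \<rightarrow>\<^sub>E C" "v n \<in> C" "v \<in> {..<Suc n} \<rightarrow>\<^sub>E carrier R"
    using Suc.prems(2) C_sub by (auto simp: PiE_iff)
  have tr: "(\<lambda>i\<in>{..<Suc n}. t \<otimes>\<^bsub>T\<^esub> v i) \<in> carrier (free_module R (Suc n))"
    using Suc.prems(2) C_sub C_closed t by (auto simp: PiE_iff subset_iff free_module_simps)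
  have mT: "m \<in> carrier T" using c(1)[OF g(2)] sub by auto
  have e: "restrict (\<lambda>i\<in>{..<Suc n}. t \<otimes>\<^bsub>T\<^esub> v i) {..<n} = (\<lambda>i\<in>{..<n}. t \<otimes>\<^bsub>T\<^esub> ?r i)"
    by (auto simp: fun_eq_iff)
  have IH: "g ?r \<in> C" "g (\<lambda>i\<in>{..<n}. t \<otimes>\<^bsub>T\<^esub> ?r i) = t \<otimes>\<^bsub>T\<^esub> g ?r"
    using conjunct1[OF Suc.IH[OF g(1) r(1)]] conjunct2[OF Suc.IH[OF g(1) r(1)]] .
  have "h v \<in> C" using g(3)[of v] r IH(1) free_module_simps(1)[of R] C_closed mT by auto
  moreover have "h (\<lambda>i\<in>{..<Suc n}. t \<otimes>\<^bsub>T\<^esub> v i) = t \<otimes>\<^bsub>T\<^esub> g ?r \<oplus>\<^bsub>T\<^esub> t \<otimes>\<^bsub>T\<^esub> v n \<otimes>\<^bsub>T\<^esub> m"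
    unfolding g(3)[OF tr] e IH(2) by simp
  moreover have "\<dots> = t \<otimes>\<^bsub>T\<^esub> h v"
    using g(3)[of v] r IH(1) free_module_simps(1)[of R] C_closed(1) mT t by (simp add: T.r_distr T.m_assoc)
  ultimately show ?case by (simp only: simp_thms)
qed

text \<open>Passes a property from the generators \<open>W\<close> to all of \<open>T\<close>,
  provided that the elements having it form an ideal of \<open>T\<close>.\<close>

lemma ideal_eq_carrier_of_generators:
  assumes S: "ideal S T" and U: "ideal U R" and UT: "Idl\<^bsub>T\<^esub> U = carrier T"
    and W: "W \<subseteq> U" "U = lspan R (mult_module R U) W" "W \<subseteq> S"
  shows "S = carrier T"
proof -
  note s = T.ideal_closed[OF S] and u = R.ideal_closed[OF U]
  have "lspan R (mult_module R U) W \<subseteq> S"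
    using s W(3) sub by (intro lspan_least) (auto simp: ops subset_iff)
  then have "Idl\<^bsub>T\<^esub> U \<subseteq> S" using W(2) by (intro T.genideal_minimal[OF S]) simp
  then show ?thesis using UT s(1) by auto
qed

text \<open>As \<open>U T = T\<close>, the unit is a sum of products \<open>u t\<close>, so each
  \<open>x\<close> in \<open>C\<close> is a sum of terms \<open>u (t x)\<close> with
  \<open>t x\<close> again in \<open>C\<close>. Applied with \<open>H\<close> the image of the
  vectors over \<open>C\<close>, and with \<open>H = U\<close>.\<close>

lemma conductor_absorb:
  assumes UT: "Idl\<^bsub>T\<^esub> U = carrier T" and U: "U \<subseteq> carrier T"
    and H: "\<zero>\<^bsub>T\<^esub> \<in> H" "\<And>x y. x \<in> H \<Longrightarrow> y \<in> H \<Longrightarrow> x \<oplus>\<^bsub>T\<^esub> y \<in> H"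
    and UC: "\<And>u c. u \<in> U \<Longrightarrow> c \<in> C \<Longrightarrow> u \<otimes>\<^bsub>T\<^esub> c \<in> H"
  shows "C \<subseteq> H"
proof -
  \<comment> \<open>The multipliers of \<open>C\<close> into \<open>H\<close>. Showing that they
    form an ideal of \<open>T\<close> avoids an explicit expression of the unit as a sum.\<close>
  define S where "S = {b \<in> carrier T. \<forall>c\<in>C. b \<otimes>\<^bsub>T\<^esub> c \<in> H}"
  have S: "ideal S T"
  proof (rule idealI[OF T.ring_axioms])
    show "subgroup S (add_monoid T)"
    proof (rule T.add.subgroupI)
      show "S \<noteq> {}" using H(1) C_closed(1) by (auto simp: S_def intro!: exI[of _ "\<zero>\<^bsub>T\<^esub>"])
    next
      fix a assume "a \<in> S"
      \<comment> \<open>\<open>H\<close> is only closed under sums, so the sign is moved onto the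
        element of \<open>C\<close>.\<close>
      moreover have "(\<ominus>\<^bsub>T\<^esub> a) \<otimes>\<^bsub>T\<^esub> c = a \<otimes>\<^bsub>T\<^esub> (\<ominus>\<^bsub>T\<^esub> c)" if "a \<in> carrier T" "c \<in> C" for c
        using that C_closed(1) by (simp add: T.l_minus T.r_minus)
      ultimately show "\<ominus>\<^bsub>T\<^esub> a \<in> S" using C_closed by (auto simp: S_def)
    next
      fix a b assume "a \<in> S" "b \<in> S"
      then show "a \<oplus>\<^bsub>T\<^esub> b \<in> S" using C_closed(1) H(2) by (auto simp: S_def T.l_distr)
    qed (auto simp: S_def)
    fix a t assume a: "a \<in> S" and t: "t \<in> carrier T"
    then have "a \<otimes>\<^bsub>T\<^esub> t \<otimes>\<^bsub>T\<^esub> c = a \<otimes>\<^bsub>T\<^esub> (t \<otimes>\<^bsub>T\<^esub> c)" if "c \<in> C" for c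
      using that C_closed(1) by (simp add: S_def T.m_assoc)
    then show "a \<otimes>\<^bsub>T\<^esub> t \<in> S" using a t C_closed by (auto simp: S_def)
    then show "t \<otimes>\<^bsub>T\<^esub> a \<in> S" using a t by (simp add: S_def T.m_comm)
  qed
  have "Idl\<^bsub>T\<^esub> U \<subseteq> S" using U UC by (intro T.genideal_minimal[OF S]) (auto simp: S_def)
  then have "\<one>\<^bsub>T\<^esub> \<in> S" using UT by auto
  then show ?thesis using C_closed(1) by (auto simp: S_def)
qed

text \<open>If \<open>u = h p\<close>, then \<open>u c = h (c p)\<close>, and \<open>c p\<close> has
  entries in \<open>C\<close>; \<open>conductor_absorb\<close> does the rest. Consequently a vector
  that \<open>h\<close> sends into \<open>C\<close> differs from a relation by a vector over
  \<open>C\<close>.\<close>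

lemma conductor_image_onto:
  assumes U: "ideal U R" and UT: "Idl\<^bsub>T\<^esub> U = carrier T"
    and h: "h \<in> mod_hom R (free_module R n) (mult_module R U)" "h ` carrier (free_module R n) = U"
  shows "C \<subseteq> h ` ({..<n} \<rightarrow>\<^sub>E C)"
proof -
  define H where "H = h ` ({..<n} \<rightarrow>\<^sub>E C)"
  have vC: "v \<in> carrier (free_module R n)" if "v \<in> {..<n} \<rightarrow>\<^sub>E C" for v
    using that C_sub by (auto simp: free_module_simps PiE_iff)
  have H_add: "x \<oplus>\<^bsub>T\<^esub> y \<in> H" if xy: "x \<in> H" "y \<in> H" for x y
  proof -
    obtain v w where vw: "v \<in> {..<n} \<rightarrow>\<^sub>E C" "w \<in> {..<n} \<rightarrow>\<^sub>E C" "x = h v" "y = h w"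
      using xy by (auto simp: H_def)
    have "x \<oplus>\<^bsub>T\<^esub> y = h (v \<oplus>\<^bsub>free_module R n\<^esub> w)"
      using mod_homD(2)[OF h(1) vC[OF vw(1)] vC[OF vw(2)]] vw by (simp add: ops)
    moreover have "v \<oplus>\<^bsub>free_module R n\<^esub> w \<in> {..<n} \<rightarrow>\<^sub>E C"
      using vw(1,2) C_closed(3) by (auto simp: free_module_simps ops dest!: PiE_mem)
    ultimately show ?thesis by (auto simp: H_def)
  qed
  have H0: "\<zero>\<^bsub>T\<^esub> \<in> H"
  proof -
    have "h \<zero>\<^bsub>free_module R n\<^esub> = \<zero>\<^bsub>T\<^esub>"
      using mod_hom_zero[OF R.module_free_module R.module_mult_module[OF U] h(1)] by (simp add: ops)
    moreover have "\<zero>\<^bsub>free_module R n\<^esub> \<in> {..<n} \<rightarrow>\<^sub>E C"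
      using C_closed by (auto simp: free_module_simps ops)
    ultimately show ?thesis by (metis H_def imageI)
  qed
  have "C \<subseteq> H"
  proof (rule conductor_absorb[OF UT _ H0 H_add])
    show "U \<subseteq> carrier T" using R.ideal_closed(1)[OF U] sub by auto
    fix u c assume u: "u \<in> U" and c: "c \<in> C"
    then obtain p where p: "p \<in> carrier (free_module R n)" "u = h p" using h(2) by blast
    have uR: "u \<in> carrier R" using R.ideal_closed(1)[OF U] u .
    have cR: "c \<in> carrier R" using c C_sub by auto
    have "u \<otimes>\<^bsub>T\<^esub> c = h (c \<odot>\<^bsub>free_module R n\<^esub> p)"
      using mod_homD(3)[OF h(1) cR p(1)] p(2) uR cR sub by (simp add: ops T.m_comm subset_iff)
    moreover have "c \<odot>\<^bsub>free_module R n\<^esub> p \<in> {..<n} \<rightarrow>\<^sub>E C"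
      using p(1) c C_closed(6) sub by (auto simp: free_module_simps ops dest!: PiE_mem)
    ultimately show "u \<otimes>\<^bsub>T\<^esub> c \<in> H" by (auto simp: H_def)
  qed
  then show ?thesis by (simp add: H_def)
qed

text \<open>If \<open>h p = w\<close>, the map \<open>v \<mapsto> w v - h(v) p\<close> takes values in the kernel of \<open>h\<close> and is
  multiplication by \<open>w\<close> there. As the kernel vectors with entries in \<open>C\<close> form a \<open>T\<close>-module, being a
  multiplier of it into the submodule spanned by these images is a property that passes from the
  generators \<open>w\<close> of \<open>U\<close> to \<open>U T = T\<close>.\<close>

lemma conductor_kernel_fg:
  assumes U: "ideal U R" and UT: "Idl\<^bsub>T\<^esub> U = carrier T"
    and h: "h \<in> mod_hom R (free_module R n) (mult_module R U)" "h ` carrier (free_module R n) = U"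
  obtains N where "finite N" "N \<subseteq> a_kernel (free_module R n) (mult_module R U) h"
    "a_kernel (free_module R n) (mult_module R U) h \<inter> ({..<n} \<rightarrow>\<^sub>E C) \<subseteq> lspan R (free_module R n) N"
proof -
  let ?F = "free_module R n"
  let ?K = "a_kernel ?F (mult_module R U) h"
  interpret F: module R ?F by (rule R.module_free_module)
  interpret U: module R "mult_module R U" by (rule R.module_mult_module[OF U])
  note u = R.ideal_closed[OF U]
  obtain W where W: "finite W" "W \<subseteq> U" "U = lspan R (mult_module R U) W"
    using free_module_image[OF U.module_axioms h(1)] h(2) by (metis mult_module_simps(1))
  have ex: "\<exists>V. finite V \<and> V \<subseteq> ?K \<and> (\<forall>x\<in>?K. w \<odot>\<^bsub>?F\<^esub> x \<in> lspan R ?F V)" if w: "w \<in> W" for w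
  proof -
    obtain p where p: "p \<in> carrier ?F" "w = h p" using w W(2) h(2) by blast
    have wR: "w \<in> carrier R" using w W(2) u(1) by auto
    have hR: "h v \<in> carrier R" if "v \<in> carrier ?F" for v
      using mod_homD(1)[OF h(1) that] u(1) by simp
    \<comment> \<open>If \<open>p\<close> is a unit vector, the values of \<open>\<kappa>\<close> on
      the other unit vectors are Koszul relations; any other preimage \<open>p\<close> of
      \<open>w\<close> does as well.\<close>
    define \<kappa> where "\<kappa> = (\<lambda>v. w \<odot>\<^bsub>?F\<^esub> v \<ominus>\<^bsub>?F\<^esub> h v \<odot>\<^bsub>?F\<^esub> p)"
    have \<kappa>: "\<kappa> \<in> mod_hom R ?F ?F"
      unfolding mod_hom_def
    proof (intro CollectI conjI ballI funcsetI)
      fix v assume v: "v \<in> carrier ?F"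
      show "\<kappa> v \<in> carrier ?F" unfolding \<kappa>_def using v p wR hR by simp
      fix v' assume v': "v' \<in> carrier ?F"
      have "h (v \<oplus>\<^bsub>?F\<^esub> v') = h v \<oplus>\<^bsub>R\<^esub> h v'" using mod_homD(2)[OF h(1) v v'] by simp
      then show "\<kappa> (v \<oplus>\<^bsub>?F\<^esub> v') = \<kappa> v \<oplus>\<^bsub>?F\<^esub> \<kappa> v'"
        unfolding \<kappa>_def a_minus_def using v v' p wR hR
        by (simp add: F.smult_r_distr F.smult_l_distr F.M.minus_add F.M.a_ac)
    next
      fix a v assume a: "a \<in> carrier R" and v: "v \<in> carrier ?F"
      have "h (a \<odot>\<^bsub>?F\<^esub> v) = a \<otimes>\<^bsub>R\<^esub> h v" using mod_homD(3)[OF h(1) a v] by simp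
      moreover have "w \<odot>\<^bsub>?F\<^esub> (a \<odot>\<^bsub>?F\<^esub> v) = a \<odot>\<^bsub>?F\<^esub> (w \<odot>\<^bsub>?F\<^esub> v)"
        using a v wR by (simp add: F.smult_assoc1[symmetric] R.m_comm)
      ultimately show "\<kappa> (a \<odot>\<^bsub>?F\<^esub> v) = a \<odot>\<^bsub>?F\<^esub> \<kappa> v"
        unfolding \<kappa>_def using a v p wR hR by (simp add: F.smult_minus_distr F.smult_assoc1)
    qed
    have \<kappa>_ker: "\<kappa> v \<in> ?K" if v: "v \<in> carrier ?F" for v
    proof -
      have e: "\<kappa> v \<oplus>\<^bsub>?F\<^esub> h v \<odot>\<^bsub>?F\<^esub> p = w \<odot>\<^bsub>?F\<^esub> v"
        unfolding \<kappa>_def using v p wR hR by (intro F.M.minus_add_cancel) auto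
      have kc: "\<kappa> v \<in> carrier ?F" by (rule mod_homD(1)[OF \<kappa> v])
      have "h (\<kappa> v) \<oplus>\<^bsub>R\<^esub> h (h v \<odot>\<^bsub>?F\<^esub> p) = h (w \<odot>\<^bsub>?F\<^esub> v)"
        using mod_homD(2)[OF h(1) kc F.smult_closed[OF hR[OF v] p(1)]] by (simp only: e mult_module_simps)
      moreover have "h (h v \<odot>\<^bsub>?F\<^esub> p) = h v \<otimes>\<^bsub>R\<^esub> w" "h (w \<odot>\<^bsub>?F\<^esub> v) = w \<otimes>\<^bsub>R\<^esub> h v"
        using mod_homD(3)[OF h(1) hR[OF v] p(1)] mod_homD(3)[OF h(1) wR v] p(2) by simp_all
      ultimately have "h (\<kappa> v) \<oplus>\<^bsub>R\<^esub> w \<otimes>\<^bsub>R\<^esub> h v = w \<otimes>\<^bsub>R\<^esub> h v"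
        using R.m_comm[OF hR[OF v] wR] by simp
      then have "h (\<kappa> v) = \<zero>\<^bsub>R\<^esub>"
        by (rule R.add_eq_right_imp_zero) (use hR[OF kc] hR[OF v] wR in auto)
      then show ?thesis using kc by (simp add: a_kernel_def')
    qed
    obtain V where V: "finite V" "V \<subseteq> carrier ?F" "\<kappa> ` carrier ?F = lspan R ?F V"
      by (rule free_module_image[OF F.module_axioms \<kappa>])
    have "V \<subseteq> ?K"
      using subset_trans[OF F.lspan_incl[OF V(2)]] V(3)[symmetric] \<kappa>_ker by blast
    moreover have "w \<odot>\<^bsub>?F\<^esub> x \<in> lspan R ?F V" if "x \<in> ?K" for x
    proof -
      have x: "x \<in> carrier ?F" "h x = \<zero>\<^bsub>R\<^esub>" using that unfolding a_kernel_def' by auto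
      then have "\<kappa> x = w \<odot>\<^bsub>?F\<^esub> x"
        unfolding \<kappa>_def a_minus_def using p wR by simp
      then show ?thesis using V(3) x(1) by (metis imageI)
    qed
    ultimately show ?thesis using V(1) by blast
  qed
  then obtain N where N: "\<And>w. w \<in> W \<Longrightarrow> finite (N w) \<and> N w \<subseteq> ?K \<and> (\<forall>x\<in>?K. w \<odot>\<^bsub>?F\<^esub> x \<in> lspan R ?F (N w))"
    by metis
  define N' where "N' = (\<Union>w\<in>W. N w)"
  have N': "finite N'" "N' \<subseteq> ?K" using N W(1) unfolding N'_def by auto
  have N'F: "N' \<subseteq> carrier ?F" using N'(2) unfolding a_kernel_def' by auto
  have wN': "w \<odot>\<^bsub>?F\<^esub> x \<in> lspan R ?F N'" if "w \<in> W" "x \<in> ?K" for w x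
    using N[OF that(1)] that lspan_mono[of "N w" N' R ?F] unfolding N'_def by blast
  \<comment> \<open>Scaling by elements of \<open>T\<close> is not an operation of the module
    \<open>?F\<close>. It is needed only on vectors over \<open>C\<close>, where it stays within
    \<open>?F\<close>, and for elements of \<open>R\<close> it agrees with the scalar
    action.\<close>
  define sc where "sc = (\<lambda>t x. \<lambda>i\<in>{..<n}. t \<otimes>\<^bsub>T\<^esub> (x i :: 'a))"
  let ?E = "?K \<inter> ({..<n} \<rightarrow>\<^sub>E C)"
  have scE: "sc t x \<in> ?E" if t: "t \<in> carrier T" and x: "x \<in> ?E" for t x
  proof -
    have x': "x \<in> {..<n} \<rightarrow>\<^sub>E C" "h x = \<zero>\<^bsub>T\<^esub>" using x unfolding a_kernel_def' by (auto simp: ops)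
    have "sc t x \<in> {..<n} \<rightarrow>\<^sub>E C" using x'(1) t C_closed(5) unfolding sc_def by (auto dest!: PiE_mem)
    moreover from this have "sc t x \<in> carrier ?F" using C_sub by (auto simp: free_module_simps)
    moreover have "h (sc t x) = \<zero>\<^bsub>T\<^esub>"
      using conductor_vec_scale[OF U h(1) x'(1) t] x'(2) t unfolding sc_def by simp
    ultimately show ?thesis unfolding a_kernel_def' by (simp add: ops)
  qed
  define S where "S = {b \<in> carrier T. \<forall>x\<in>?E. sc b x \<in> lspan R ?F N'}"
  have xT: "x i \<in> carrier T" if "x \<in> ?E" "i < n" for x i
    using that C_closed(1) by (auto simp: PiE_iff)
  have S: "ideal S T"
  proof (rule idealI[OF T.ring_axioms])
    have mult: "a \<otimes>\<^bsub>T\<^esub> t \<in> S" if a: "a \<in> S" and t: "t \<in> carrier T" for a t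
    proof -
      have aT: "a \<in> carrier T" using a by (simp add: S_def)
      have "sc (a \<otimes>\<^bsub>T\<^esub> t) x = sc a (sc t x)" if "x \<in> ?E" for x
        using xT[OF that] aT t by (auto simp: sc_def fun_eq_iff T.m_assoc)
      then show ?thesis using a t scE unfolding S_def by auto
    qed
    show "subgroup S (add_monoid T)"
    proof (rule T.add.subgroupI)
      have "sc \<zero>\<^bsub>T\<^esub> x = \<zero>\<^bsub>?F\<^esub>" if "x \<in> ?E" for x
        using xT[OF that] by (auto simp: sc_def fun_eq_iff free_module_simps ops)
      then have "\<zero>\<^bsub>T\<^esub> \<in> S" using lspan.zero[of ?F R N'] unfolding S_def by auto
      then show "S \<noteq> {}" by auto
    next
      fix a assume a: "a \<in> S"
      then have "a \<otimes>\<^bsub>T\<^esub> (\<ominus>\<^bsub>T\<^esub> \<one>\<^bsub>T\<^esub>) \<in> S" by (rule mult) simp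
      then show "\<ominus>\<^bsub>T\<^esub> a \<in> S" using a by (simp add: S_def T.r_minus)
    next
      fix a b assume ab: "a \<in> S" "b \<in> S"
      then have "sc (a \<oplus>\<^bsub>T\<^esub> b) x = sc a x \<oplus>\<^bsub>?F\<^esub> sc b x" if "x \<in> ?E" for x
        using xT[OF that] by (auto simp: S_def sc_def fun_eq_iff T.l_distr free_module_simps ops)
      then show "a \<oplus>\<^bsub>T\<^esub> b \<in> S" using ab F.lspan_add[OF N'F] unfolding S_def by auto
    qed (auto simp: S_def)
    fix a t assume a: "a \<in> S" and t: "t \<in> carrier T"
    then show "a \<otimes>\<^bsub>T\<^esub> t \<in> S" by (rule mult)
    then show "t \<otimes>\<^bsub>T\<^esub> a \<in> S" using a t by (simp add: S_def T.m_comm)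
  qed
  have "W \<subseteq> S"
  proof
    fix w assume w: "w \<in> W"
    have "sc w x = w \<odot>\<^bsub>?F\<^esub> x" for x by (simp add: sc_def free_module_simps ops)
    moreover have "w \<in> carrier T" using w W(2) u(1) sub by blast
    ultimately show "w \<in> S" using w wN' unfolding S_def by auto
  qed
  then have "\<one>\<^bsub>T\<^esub> \<in> S" using ideal_eq_carrier_of_generators[OF S U UT W(2,3)] by simp
  moreover have "sc \<one>\<^bsub>T\<^esub> x = x" if "x \<in> ?E" for x
    using xT[OF that] that by (auto simp: sc_def fun_eq_iff PiE_iff extensional_def)
  ultimately have "?E \<subseteq> lspan R ?F N'" unfolding S_def by auto
  then show ?thesis using that N' by blast
qed

lemma \<pi>vec_simps:
  assumes "v \<in> carrier (free_module R n)"
  shows "\<pi>vec n v \<in> carrier (free_module A n)"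
    "w \<in> carrier (free_module R n) \<Longrightarrow>
      \<pi>vec n (v \<oplus>\<^bsub>free_module R n\<^esub> w) = \<pi>vec n v \<oplus>\<^bsub>free_module A n\<^esub> \<pi>vec n w"
    "a \<in> carrier R \<Longrightarrow> \<pi>vec n (a \<odot>\<^bsub>free_module R n\<^esub> v) = \<pi> a \<odot>\<^bsub>free_module A n\<^esub> \<pi>vec n v"
proof -
  note v = PiE_mem[OF assms[unfolded free_module_simps]]
  show "\<pi>vec n v \<in> carrier (free_module A n)" using assms \<pi>vec_onto by blast
  show "w \<in> carrier (free_module R n) \<Longrightarrow>
      \<pi>vec n (v \<oplus>\<^bsub>free_module R n\<^esub> w) = \<pi>vec n v \<oplus>\<^bsub>free_module A n\<^esub> \<pi>vec n w"
    using v by (auto simp: \<pi>vec_def free_module_simps fun_eq_iff dest: PiE_mem)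
  show "a \<in> carrier R \<Longrightarrow> \<pi>vec n (a \<odot>\<^bsub>free_module R n\<^esub> v) = \<pi> a \<odot>\<^bsub>free_module A n\<^esub> \<pi>vec n v"
    using v by (auto simp: \<pi>vec_def free_module_simps fun_eq_iff)
qed

lemma \<pi>vec_eq_diff:
  assumes "v \<in> carrier (free_module R n)" "w \<in> carrier (free_module R n)" "\<pi>vec n v = \<pi>vec n w"
  shows "v \<ominus>\<^bsub>free_module R n\<^esub> w \<in> {..<n} \<rightarrow>\<^sub>E C"
proof -
  interpret F: module R "free_module R n" by (rule R.module_free_module)
  let ?d = "v \<ominus>\<^bsub>free_module R n\<^esub> w"
  have d: "?d \<in> carrier (free_module R n)" using assms by simp
  have "?d i \<in> C" if i: "i < n" for i
  proof -
    \<comment> \<open>Subtraction in \<open>free_module\<close> is derived from addition, so its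
      entries are read off from this equation.\<close>
    have dw: "?d \<oplus>\<^bsub>free_module R n\<^esub> w = v" using assms by (intro F.M.minus_add_cancel)
    have "?d i \<oplus>\<^bsub>R\<^esub> w i = v i" using fun_cong[OF dw, of i] i by (simp add: free_module_simps)
    moreover have "\<pi> (v i) = \<pi> (w i)" using fun_cong[OF assms(3), of i] i by (simp add: \<pi>vec_def)
    moreover have r: "?d i \<in> carrier R" "w i \<in> carrier R"
      using d assms(2) i by (auto simp: free_module_simps)
    ultimately have "\<pi> (?d i) \<oplus>\<^bsub>A\<^esub> \<pi> (w i) = \<pi> (w i)" by (metis \<pi>_simps(2))
    then have "\<pi> (?d i) = \<zero>\<^bsub>A\<^esub>"
      by (rule A.add_eq_right_imp_zero) (use r in auto)
    then show ?thesis using \<pi>_ker r(1) by blast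
  qed
  then show ?thesis using d by (auto simp: free_module_simps PiE_iff)
qed

lemma \<pi>vec_conductor:
  "v \<in> {..<n} \<rightarrow>\<^sub>E C \<Longrightarrow> \<pi>vec n v = \<zero>\<^bsub>free_module A n\<^esub>"
  using \<pi>_ker C_sub by (auto simp: \<pi>vec_def free_module_simps fun_eq_iff dest!: PiE_mem)

text \<open>A map \<open>h\<close> from \<open>R^n\<close> onto \<open>U\<close> reduces to a map
  \<open>g\<close> from \<open>A^n\<close> onto the image of \<open>U\<close>. Since every element
  of \<open>C\<close> is the value of \<open>h\<close> at a vector over \<open>C\<close>, the
  relations of the image are exactly the reduced relations of \<open>U\<close>. So generators of
  relations can be reduced; conversely, lifted generators miss only relations over \<open>C\<close>,
  which \<open>conductor_kernel_fg\<close> covers.\<close>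

lemma finitely_presented_ideal_iff:
  assumes U: "ideal U R" and UT: "Idl\<^bsub>T\<^esub> U = carrier T" and fg: "fg_sub R (mult_module R U) U"
  shows "finitely_presented R (mult_module R U) \<longleftrightarrow> finitely_presented A (mult_module A (\<pi> ` U))"
proof -
  let ?M = "mult_module R U" and ?N = "mult_module A (\<pi> ` U)"
  have M: "module R ?M" by (rule R.module_mult_module[OF U])
  have UA: "ideal (\<pi> ` U) A" by (rule ideal_image[OF U])
  have N: "module A ?N" by (rule A.module_mult_module[OF UA])
  note u = R.ideal_closed[OF U]
  obtain n h where h: "h \<in> mod_hom R (free_module R n) ?M" "h ` carrier (free_module R n) = U"
    using fg free_module_onto_lspan[OF M] unfolding fg_sub_def by (metis mult_module_simps(1))
  let ?F = "free_module R n" and ?G = "free_module A n"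
  interpret F: module R ?F by (rule R.module_free_module)
  interpret G: module A ?G by (rule A.module_free_module)
  let ?K = "a_kernel ?F ?M h"
  have hU: "h v \<in> U" if "v \<in> carrier ?F" for v using that h(2) by blast
  have CF: "v \<in> carrier ?F" if "v \<in> {..<n} \<rightarrow>\<^sub>E C" for v
    using that C_sub by (auto simp: free_module_simps PiE_iff)
  \<comment> \<open>Defined through an arbitrary lift of \<open>w\<close> to a vector over
    \<open>R\<close>. Two lifts differ by a vector over \<open>C\<close>, which \<open>h\<close>
    sends into \<open>C\<close>, so the choice is invisible after \<open>\<pi>\<close>.\<close>
  define g where "g = (\<lambda>w. \<pi> (h (inv_into (carrier ?F) (\<pi>vec n) w)))"
  have g\<pi>: "g (\<pi>vec n v) = \<pi> (h v)" if v: "v \<in> carrier ?F" for v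
  proof -
    let ?v' = "inv_into (carrier ?F) (\<pi>vec n) (\<pi>vec n v)"
    let ?d = "?v' \<ominus>\<^bsub>?F\<^esub> v"
    have v': "?v' \<in> carrier ?F" "\<pi>vec n ?v' = \<pi>vec n v"
      by (rule inv_into_into[OF imageI[OF v]], rule f_inv_into_f[OF imageI[OF v]])
    have d: "?d \<in> {..<n} \<rightarrow>\<^sub>E C" using \<pi>vec_eq_diff[OF v'(1) v v'(2)] .
    have hd: "h ?d \<in> C" using conductor_vec_scale[OF U h(1) d T.one_closed] by simp
    have "h ?v' = h ?d \<oplus>\<^bsub>R\<^esub> h v"
      using mod_homD(2)[OF h(1) CF[OF d] v] by (simp only: F.M.minus_add_cancel[OF v'(1) v] mult_module_simps)
    then have "\<pi> (h ?v') = \<pi> (h ?d) \<oplus>\<^bsub>A\<^esub> \<pi> (h v)"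
      using u(1)[OF hU[OF v]] u(1)[OF hU[OF CF[OF d]]] by (simp only: \<pi>_simps)
    moreover have "\<pi> (h ?d) = \<zero>\<^bsub>A\<^esub>" using hd \<pi>_ker C_sub by auto
    ultimately show ?thesis using u(1)[OF hU[OF v]] unfolding g_def by simp
  qed
  have ex: "\<exists>v\<in>carrier ?F. w = \<pi>vec n v" if "w \<in> carrier ?G" for w
    using that \<pi>vec_onto[of n] by blast
  have g: "g \<in> mod_hom A ?G ?N"
    unfolding mod_hom_def
  proof (intro CollectI conjI ballI funcsetI)
    fix w assume "w \<in> carrier ?G"
    then obtain v where v: "v \<in> carrier ?F" "w = \<pi>vec n v" using ex by blast
    then show "g w \<in> carrier ?N" using g\<pi> hU by auto
    fix w' assume "w' \<in> carrier ?G"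
    then obtain v' where v': "v' \<in> carrier ?F" "w' = \<pi>vec n v'" using ex by blast
    have "g (w \<oplus>\<^bsub>?G\<^esub> w') = g (\<pi>vec n (v \<oplus>\<^bsub>?F\<^esub> v'))"
      using v v' by (simp only: \<pi>vec_simps)
    also have "\<dots> = \<pi> (h v \<oplus>\<^bsub>R\<^esub> h v')"
      using g\<pi>[OF F.M.a_closed[OF v(1) v'(1)]] mod_homD(2)[OF h(1) v(1) v'(1)] by simp
    also have "\<dots> = g w \<oplus>\<^bsub>A\<^esub> g w'" using g\<pi> v v' u(1) hU by simp
    finally show "g (w \<oplus>\<^bsub>?G\<^esub> w') = g w \<oplus>\<^bsub>?N\<^esub> g w'" by simp
  next
    fix a w assume "a \<in> carrier A" "w \<in> carrier ?G"
    then obtain b v where v: "v \<in> carrier ?F" "w = \<pi>vec n v" and b: "b \<in> carrier R" "a = \<pi> b"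
      using ex \<pi>_onto by blast
    have "g (a \<odot>\<^bsub>?G\<^esub> w) = g (\<pi>vec n (b \<odot>\<^bsub>?F\<^esub> v))"
      using v b by (simp only: \<pi>vec_simps)
    also have "\<dots> = \<pi> (b \<otimes>\<^bsub>R\<^esub> h v)"
      using g\<pi>[OF F.smult_closed[OF b(1) v(1)]] mod_homD(3)[OF h(1) b(1) v(1)] by simp
    also have "\<dots> = a \<otimes>\<^bsub>A\<^esub> g w" using g\<pi> v b u(1) hU by simp
    finally show "g (a \<odot>\<^bsub>?G\<^esub> w) = a \<odot>\<^bsub>?N\<^esub> g w" by simp
  qed
  have g_onto: "g ` carrier ?G = carrier ?N"
  proof -
    have "g ` carrier ?G = (\<lambda>v. g (\<pi>vec n v)) ` carrier ?F" by (simp only: \<pi>vec_onto[symmetric] image_image)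
    also have "\<dots> = (\<lambda>v. \<pi> (h v)) ` carrier ?F" using g\<pi> by (intro image_cong) auto
    also have "\<dots> = \<pi> ` U" by (simp only: image_image[symmetric] h(2))
    finally show ?thesis by simp
  qed
  have ker: "a_kernel ?G ?N g = \<pi>vec n ` ?K"
  proof
    show "\<pi>vec n ` ?K \<subseteq> a_kernel ?G ?N g"
      using g\<pi> \<pi>vec_simps(1) unfolding a_kernel_def' by auto
    show "a_kernel ?G ?N g \<subseteq> \<pi>vec n ` ?K"
    proof
      fix w assume "w \<in> a_kernel ?G ?N g"
      then have w: "w \<in> carrier ?G" "g w = \<zero>\<^bsub>A\<^esub>" unfolding a_kernel_def' by auto
      then obtain v where v: "v \<in> carrier ?F" "w = \<pi>vec n v" using ex by blast
      then have "\<pi> (h v) = \<zero>\<^bsub>A\<^esub>" using g\<pi> w(2) by simp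
      then have "h v \<in> C" using \<pi>_ker u(1)[OF hU[OF v(1)]] by blast
      \<comment> \<open>Subtracting \<open>c\<close> moves \<open>v\<close> into the kernel of
        \<open>h\<close> without changing its residues.\<close>
      then obtain c where c: "c \<in> {..<n} \<rightarrow>\<^sub>E C" "h v = h c"
        using conductor_image_onto[OF U UT h] by blast
      let ?d = "v \<ominus>\<^bsub>?F\<^esub> c"
      have d: "?d \<in> carrier ?F" "?d \<oplus>\<^bsub>?F\<^esub> c = v"
        using v(1) CF[OF c(1)] F.M.minus_add_cancel by auto
      have "h ?d \<oplus>\<^bsub>R\<^esub> h c = h c"
        using mod_homD(2)[OF h(1) d(1) CF[OF c(1)]] by (simp only: d(2) c(2) mult_module_simps)
      then have "h ?d = \<zero>\<^bsub>R\<^esub>"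
        by (rule R.add_eq_right_imp_zero) (use u(1)[OF hU] d(1) CF[OF c(1)] in auto)
      then have "?d \<in> ?K" using d(1) unfolding a_kernel_def' by simp
      moreover have "\<pi>vec n v = \<pi>vec n ?d"
        using \<pi>vec_simps(2)[OF d(1) CF[OF c(1)]] \<pi>vec_conductor[OF c(1)] \<pi>vec_simps(1)[OF d(1)]
        by (simp add: d(2))
      ultimately show "w \<in> \<pi>vec n ` ?K" using v(2) by blast
    qed
  qed
  show ?thesis
  proof
    assume "finitely_presented R ?M"
    then have "fg_sub R ?F ?K" using finitely_presented_kernel[OF M _ h(1)] h(2) by simp
    then obtain W where W: "finite W" "W \<subseteq> ?K" "?K = lspan R ?F W" unfolding fg_sub_def by blast
    have WF: "W \<subseteq> carrier ?F" using W(2) unfolding a_kernel_def' by blast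
    have "\<pi>vec n ` W \<subseteq> carrier ?G" using WF \<pi>vec_onto[of n] by blast
    then have "fg_sub A ?G (a_kernel ?G ?N g)"
      using W(1) \<pi>vec_image_lspan[OF WF] ker W(3) by (intro fg_subI[OF G.module_axioms]) auto
    then show "finitely_presented A ?N" by (rule finitely_presentedI[OF N g g_onto])
  next
    assume "finitely_presented A ?N"
    then have "fg_sub A ?G (a_kernel ?G ?N g)" by (rule finitely_presented_kernel[OF N _ g g_onto])
    then obtain V where V: "finite V" "V \<subseteq> \<pi>vec n ` ?K" "\<pi>vec n ` ?K = lspan A ?G V"
      unfolding fg_sub_def ker by blast
    then obtain V' where V': "finite V'" "V' \<subseteq> ?K" "V = \<pi>vec n ` V'"
      using finite_subset_image[OF V(1,2)] by blast
    \<comment> \<open>\<open>N\<close> absorbs the difference between a relation of \<open>U\<close>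
      and a combination of the lifts \<open>V'\<close> that has the same residues.\<close>
    obtain N where N: "finite N" "N \<subseteq> ?K" "?K \<inter> ({..<n} \<rightarrow>\<^sub>E C) \<subseteq> lspan R ?F N"
      by (rule conductor_kernel_fg[OF U UT h])
    have V'F: "V' \<subseteq> carrier ?F" and NF: "N \<subseteq> carrier ?F"
      using V'(2) N(2) unfolding a_kernel_def' by blast+
    have c: "V' \<union> N \<subseteq> carrier ?F" using V'F NF by blast
    have "?K = lspan R ?F (V' \<union> N)"
    proof
      show "lspan R ?F (V' \<union> N) \<subseteq> ?K"
        using V'(2) N(2) by (intro mod_hom_kernel_closed[OF F.module_axioms M h(1)]) blast
      show "?K \<subseteq> lspan R ?F (V' \<union> N)"
      proof
        fix x assume xK: "x \<in> ?K"
        then have x: "x \<in> carrier ?F" "h x = \<zero>\<^bsub>R\<^esub>" unfolding a_kernel_def' by auto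
        have "\<pi>vec n x \<in> \<pi>vec n ` lspan R ?F V'"
          using xK V(3) \<pi>vec_image_lspan[OF V'F] V'(3) by blast
        then obtain y where y: "y \<in> lspan R ?F V'" "\<pi>vec n x = \<pi>vec n y" by blast
        have yK: "y \<in> ?K" using y(1) mod_hom_kernel_closed[OF F.module_axioms M h(1) V'(2)] by blast
        then have y': "y \<in> carrier ?F" "h y = \<zero>\<^bsub>R\<^esub>" unfolding a_kernel_def' by auto
        let ?d = "x \<ominus>\<^bsub>?F\<^esub> y"
        have d: "?d \<in> carrier ?F" "?d \<oplus>\<^bsub>?F\<^esub> y = x"
          using x(1) y'(1) F.M.minus_add_cancel by auto
        have "h ?d \<oplus>\<^bsub>R\<^esub> h y = h x"
          using mod_homD(2)[OF h(1) d(1) y'(1)] by (simp only: d(2) mult_module_simps)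
        then have "h ?d = \<zero>\<^bsub>R\<^esub>" using x(2) y'(2) u(1)[OF hU[OF d(1)]] by simp
        then have "?d \<in> ?K" using d(1) unfolding a_kernel_def' by simp
        then have "?d \<in> lspan R ?F N" using N(3) \<pi>vec_eq_diff[OF x(1) y'(1) y(2)] by blast
        then have "?d \<oplus>\<^bsub>?F\<^esub> y \<in> lspan R ?F (V' \<union> N)"
          using y(1) lspan_mono[of V' "V' \<union> N" R ?F] lspan_mono[of N "V' \<union> N" R ?F]
          by (intro F.lspan_add[OF c]) auto
        then show "x \<in> lspan R ?F (V' \<union> N)" by (simp only: d(2))
      qed
    qed
    then have "fg_sub R ?F ?K"
      using V'(1) N(1) by (intro fg_subI[OF F.module_axioms _ c]) auto
    then show "finitely_presented R ?M"
      using finitely_presentedI[OF M h(1)] h(2) by simp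
  qed
qed

end

section \<open>Annihilators in a locally integral ring\<close>

lemma (in cring) exists_maximalideal:
  assumes "ideal I R" "\<one> \<notin> I"
  obtains P where "maximalideal P R" "I \<subseteq> P"
proof -
  define S where "S = {J. ideal J R \<and> I \<subseteq> J \<and> \<one> \<notin> J}"
  have "\<exists>P\<in>S. \<forall>Y\<in>S. P \<subseteq> Y \<longrightarrow> Y = P"
  proof (rule subset_Zorn_nonempty)
    show "S \<noteq> {}" using assms by (auto simp: S_def)
  next
    fix \<C> assume c: "\<C> \<noteq> {}" "subset.chain S \<C>"
    then have sub: "\<C> \<subseteq> S" by (auto simp: subset.chain_def)
    have "subset.chain {J. ideal J R} \<C>"
      using c(2) unfolding subset.chain_def S_def by blast
    then have "ideal (\<Union>\<C>) R" using chain_Union_is_ideal[of \<C>] c(1) by simp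
    then show "\<Union>\<C> \<in> S" using sub c(1) unfolding S_def by blast
  qed
  then obtain P where P: "P \<in> S" "\<And>Y. Y \<in> S \<Longrightarrow> P \<subseteq> Y \<Longrightarrow> Y = P" by blast
  have "maximalideal P R"
  proof (rule maximalidealI)
    show "ideal P R" "carrier R \<noteq> P" using P(1) by (auto simp: S_def)
    fix J assume J: "ideal J R" "P \<subseteq> J" "J \<subseteq> carrier R"
    show "J = P \<or> J = carrier R"
    proof (cases "\<one> \<in> J")
      case True
      then show ?thesis using ideal.one_imp_carrier[OF J(1)] by blast
    next
      case False
      then have "J \<in> S" using J P(1) by (auto simp: S_def)
      then show ?thesis using P(2) J(2) by blast
    qed
  qed
  then show ?thesis using that P(1) by (auto simp: S_def)
qed

section \<open>Equality and multiplication of fractions\<close>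

locale mult_set = cring R for R (structure) + fixes S
  assumes S_sub: "S \<subseteq> carrier R" and S_one: "\<one> \<in> S" and S_mult: "s \<in> S \<Longrightarrow> t \<in> S \<Longrightarrow> s \<otimes> t \<in> S"
begin

lemma fraction_memI:
  assumes "a \<in> carrier R" "s \<in> S" shows "(a, s) \<in> fraction R S a s"
  using assms S_sub S_one by (auto simp: fraction_def intro!: bexI[of _ \<one>])

lemma fraction_eqD:
  assumes "fraction R S a s = fraction R S b t" "a \<in> carrier R" "b \<in> carrier R" "s \<in> S" "t \<in> S"
  shows "\<exists>u\<in>S. u \<otimes> (b \<otimes> s) = u \<otimes> (a \<otimes> t)"
proof -
  have "(a, s) \<in> fraction R S b t" using fraction_memI assms by blast
  then obtain u where u: "u \<in> S" "u \<otimes> (b \<otimes> s \<ominus> a \<otimes> t) = \<zero>" by (auto simp: fraction_def)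
  have c: "u \<in> carrier R" "a \<in> carrier R" "b \<in> carrier R" "s \<in> carrier R" "t \<in> carrier R"
    using u assms S_sub by auto
  then have "u \<otimes> (b \<otimes> s) = u \<otimes> (b \<otimes> s \<ominus> a \<otimes> t) \<oplus> u \<otimes> (a \<otimes> t)" by algebra
  then show ?thesis using u c by auto
qed

lemma fraction_subset:
  assumes u: "u \<in> S" "u \<otimes> (b \<otimes> s) = u \<otimes> (a \<otimes> t)"
    and ab: "a \<in> carrier R" "b \<in> carrier R" "s \<in> S" "t \<in> S"
  shows "fraction R S a s \<subseteq> fraction R S b t"
proof
  fix z assume "z \<in> fraction R S a s"
  then obtain c r v where z: "z = (c, r)" "c \<in> carrier R" "r \<in> S" "v \<in> S" "v \<otimes> (a \<otimes> r \<ominus> c \<otimes> s) = \<zero>"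
    by (auto simp: fraction_def)
  have k: "u \<in> carrier R" "v \<in> carrier R" "s \<in> carrier R" "t \<in> carrier R" "r \<in> carrier R"
    using z u ab S_sub by auto
  \<comment> \<open>Transitivity of the equality of fractions: the new witness is the product of the
    two given ones, \<open>u\<close> and \<open>v\<close>, with the middle denominator
    \<open>s\<close>.\<close>
  have "(s \<otimes> u \<otimes> v) \<otimes> (b \<otimes> r \<ominus> c \<otimes> t) = (v \<otimes> r) \<otimes> (u \<otimes> (b \<otimes> s)) \<ominus> (v \<otimes> s \<otimes> u \<otimes> c \<otimes> t)"
    using k ab z(2) by algebra
  also have "\<dots> = (v \<otimes> r) \<otimes> (u \<otimes> (a \<otimes> t)) \<ominus> (v \<otimes> s \<otimes> u \<otimes> c \<otimes> t)" by (simp only: u(2))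
  also have "\<dots> = (u \<otimes> t) \<otimes> (v \<otimes> (a \<otimes> r \<ominus> c \<otimes> s))" using k ab z(2) by algebra
  finally have "(s \<otimes> u \<otimes> v) \<otimes> (b \<otimes> r \<ominus> c \<otimes> t) = \<zero>" using z(5) k by simp
  then show "z \<in> fraction R S b t"
    using z ab u S_mult by (auto simp: fraction_def intro!: bexI[of _ "s \<otimes> u \<otimes> v"])
qed

lemma fraction_eqI:
  assumes "u \<in> S" "u \<otimes> (b \<otimes> s) = u \<otimes> (a \<otimes> t)" "a \<in> carrier R" "b \<in> carrier R" "s \<in> S" "t \<in> S"
  shows "fraction R S a s = fraction R S b t"
  using fraction_subset[OF assms] fraction_subset[OF assms(1) assms(2)[symmetric] assms(4,3,6,5)] by blast

text \<open>The product in \<open>localization\<close> is a union over all representatives. It is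
  the expected fraction because every pair of representatives contributes the same set and there is
  at least one pair.\<close>

lemma fraction_mult:
  assumes "a \<in> carrier R" "b \<in> carrier R" "s \<in> S" "t \<in> S"
  shows "fraction R S a s \<otimes>\<^bsub>localization R S\<^esub> fraction R S b t = fraction R S (a \<otimes> b) (s \<otimes> t)"
proof -
  have "fraction R S (c \<otimes> d) (p \<otimes> q) = fraction R S (a \<otimes> b) (s \<otimes> t)"
    if cd: "(c, p) \<in> fraction R S a s" "(d, q) \<in> fraction R S b t" for c d p q
  proof -
    obtain u where u: "c \<in> carrier R" "p \<in> S" "u \<in> S" "u \<otimes> (a \<otimes> p \<ominus> c \<otimes> s) = \<zero>"
      using cd(1) by (auto simp: fraction_def)
    obtain v where v: "d \<in> carrier R" "q \<in> S" "v \<in> S" "v \<otimes> (b \<otimes> q \<ominus> d \<otimes> t) = \<zero>"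
      using cd(2) by (auto simp: fraction_def)
    have k: "u \<in> carrier R" "v \<in> carrier R" "s \<in> carrier R" "t \<in> carrier R" "p \<in> carrier R" "q \<in> carrier R"
      using u v assms S_sub by auto
    have "(u \<otimes> v) \<otimes> ((a \<otimes> b) \<otimes> (p \<otimes> q)) = (u \<otimes> v) \<otimes> ((c \<otimes> d) \<otimes> (s \<otimes> t))
      \<oplus> (u \<otimes> (a \<otimes> p \<ominus> c \<otimes> s)) \<otimes> (v \<otimes> b \<otimes> q) \<oplus> (u \<otimes> c \<otimes> s) \<otimes> (v \<otimes> (b \<otimes> q \<ominus> d \<otimes> t))"
      using k assms(1,2) u(1) v(1) by algebra
    also have "\<dots> = (u \<otimes> v) \<otimes> ((c \<otimes> d) \<otimes> (s \<otimes> t))" using k assms(1,2) u v by simp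
    finally show ?thesis using assms u v S_mult by (intro fraction_eqI[of "u \<otimes> v"]) auto
  qed
  then have "(\<Union>(c, p)\<in>fraction R S a s. \<Union>(d, q)\<in>fraction R S b t. fraction R S (c \<otimes> d) (p \<otimes> q)) =
      (\<Union>(c, p)\<in>fraction R S a s. \<Union>(d, q)\<in>fraction R S b t. fraction R S (a \<otimes> b) (s \<otimes> t))"
    by (intro SUP_cong refl) auto
  also have "\<dots> = fraction R S (a \<otimes> b) (s \<otimes> t)"
    using fraction_memI[of a s] fraction_memI[of b t] assms by fast
  finally show ?thesis by (simp add: localization_def)
qed

end

text \<open>A form of the purity of annihilators of finitely generated ideals.\<close>

lemma locally_domain_annihilator:
  assumes A: "locally_domain A" and W: "finite W" "W \<subseteq> carrier A"
    and x: "x \<in> carrier A" "\<And>w. w \<in> W \<Longrightarrow> x \<otimes>\<^bsub>A\<^esub> w = \<zero>\<^bsub>A\<^esub>"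
  obtains y where "y \<in> carrier A" "\<And>w. w \<in> W \<Longrightarrow> y \<otimes>\<^bsub>A\<^esub> w = \<zero>\<^bsub>A\<^esub>" "x \<otimes>\<^bsub>A\<^esub> y = x"
proof -
  interpret A: cring A using A by (simp add: locally_domain_def)
  define K where "K = {y \<in> carrier A. \<forall>w\<in>W. y \<otimes>\<^bsub>A\<^esub> w = \<zero>\<^bsub>A\<^esub>}"
  \<comment> \<open>\<open>L\<close> is the sum of \<open>K\<close> and the annihilator of
    \<open>x\<close>. Once it contains the unit, some \<open>y\<close> in \<open>K\<close> satisfies
    \<open>x (1 - y) = 0\<close>, which is the claim.\<close>
  define L where "L = {y \<in> carrier A. \<exists>z\<in>K. x \<otimes>\<^bsub>A\<^esub> (y \<ominus>\<^bsub>A\<^esub> z) = \<zero>\<^bsub>A\<^esub>}"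
  have K_add: "y \<oplus>\<^bsub>A\<^esub> z \<in> K" if "y \<in> K" "z \<in> K" for y z
    using that W(2) by (auto simp: K_def A.l_distr subset_iff)
  have K_mult: "a \<otimes>\<^bsub>A\<^esub> y \<in> K" if "y \<in> K" "a \<in> carrier A" for y a
    using that W(2) by (auto simp: K_def A.m_assoc subset_iff)
  have K0: "\<zero>\<^bsub>A\<^esub> \<in> K" using W(2) by (auto simp: K_def subset_iff)
  have L_mult: "a \<otimes>\<^bsub>A\<^esub> y \<in> L" if y: "y \<in> L" and a: "a \<in> carrier A" for y a
  proof -
    obtain z where z: "y \<in> carrier A" "z \<in> K" "x \<otimes>\<^bsub>A\<^esub> (y \<ominus>\<^bsub>A\<^esub> z) = \<zero>\<^bsub>A\<^esub>"
      using y by (auto simp: L_def)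
    then have zc: "z \<in> carrier A" by (simp add: K_def)
    have "x \<otimes>\<^bsub>A\<^esub> (a \<otimes>\<^bsub>A\<^esub> y \<ominus>\<^bsub>A\<^esub> a \<otimes>\<^bsub>A\<^esub> z) = a \<otimes>\<^bsub>A\<^esub> (x \<otimes>\<^bsub>A\<^esub> (y \<ominus>\<^bsub>A\<^esub> z))"
      using x(1) z(1) zc a by algebra
    then show ?thesis using z a K_mult[OF z(2) a] by (auto simp: L_def)
  qed
  have L: "ideal L A"
  proof (rule idealI[OF A.ring_axioms])
    show "subgroup L (add_monoid A)"
    proof (rule A.add.subgroupI)
      have "\<zero>\<^bsub>A\<^esub> \<in> L" using K0 x(1) by (auto simp: L_def A.minus_eq intro!: bexI[of _ "\<zero>\<^bsub>A\<^esub>"])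
      then show "L \<noteq> {}" by auto
    next
      fix a assume a: "a \<in> L"
      then have "(\<ominus>\<^bsub>A\<^esub> \<one>\<^bsub>A\<^esub>) \<otimes>\<^bsub>A\<^esub> a \<in> L" by (rule L_mult) simp
      then show "\<ominus>\<^bsub>A\<^esub> a \<in> L" using a by (simp add: L_def A.l_minus)
    next
      fix a b assume "a \<in> L" "b \<in> L"
      then obtain y z where y: "a \<in> carrier A" "y \<in> K" "x \<otimes>\<^bsub>A\<^esub> (a \<ominus>\<^bsub>A\<^esub> y) = \<zero>\<^bsub>A\<^esub>"
        and z: "b \<in> carrier A" "z \<in> K" "x \<otimes>\<^bsub>A\<^esub> (b \<ominus>\<^bsub>A\<^esub> z) = \<zero>\<^bsub>A\<^esub>"
        by (auto simp: L_def)
      then have c: "y \<in> carrier A" "z \<in> carrier A" by (auto simp: K_def)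
      have "x \<otimes>\<^bsub>A\<^esub> ((a \<oplus>\<^bsub>A\<^esub> b) \<ominus>\<^bsub>A\<^esub> (y \<oplus>\<^bsub>A\<^esub> z)) =
          x \<otimes>\<^bsub>A\<^esub> (a \<ominus>\<^bsub>A\<^esub> y) \<oplus>\<^bsub>A\<^esub> x \<otimes>\<^bsub>A\<^esub> (b \<ominus>\<^bsub>A\<^esub> z)"
        using c x(1) y(1) z(1) by algebra
      then show "a \<oplus>\<^bsub>A\<^esub> b \<in> L" using y z K_add[OF y(2) z(2)] by (auto simp: L_def)
    qed (auto simp: L_def)
    fix a t assume a: "a \<in> L" and t: "t \<in> carrier A"
    then show "t \<otimes>\<^bsub>A\<^esub> a \<in> L" by (rule L_mult)
    then show "a \<otimes>\<^bsub>A\<^esub> t \<in> L" using a t by (simp add: L_def A.m_comm)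
  qed
  have "\<one>\<^bsub>A\<^esub> \<in> L"
  proof (rule ccontr)
    assume "\<one>\<^bsub>A\<^esub> \<notin> L"
    then obtain P where P: "maximalideal P A" "L \<subseteq> P" by (rule A.exists_maximalideal[OF L])
    have prime: "primeideal P A" by (rule A.maximalideal_prime[OF P(1)])
    interpret P: primeideal P A by (rule prime)
    let ?S = "carrier A - P"
    have oneS: "\<one>\<^bsub>A\<^esub> \<in> ?S" using P.one_imp_carrier P.I_notcarr by auto
    interpret S: mult_set A ?S
    proof
      show "s \<otimes>\<^bsub>A\<^esub> t \<in> ?S" if "s \<in> ?S" "t \<in> ?S" for s t
        using that P.I_prime by auto
    qed (use oneS in auto)
    let ?Q = "localization A ?S"
    interpret Q: domain ?Q using A prime by (simp add: locally_domain_def)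
    have zero: "\<exists>u\<in>?S. u \<otimes>\<^bsub>A\<^esub> a = \<zero>\<^bsub>A\<^esub>"
      if a: "a \<in> carrier A" "fraction A ?S a \<one>\<^bsub>A\<^esub> = \<zero>\<^bsub>?Q\<^esub>" for a
    proof -
      have "fraction A ?S a \<one>\<^bsub>A\<^esub> = fraction A ?S \<zero>\<^bsub>A\<^esub> \<one>\<^bsub>A\<^esub>"
        using a(2) by (simp add: localization_def)
      from S.fraction_eqD[OF this a(1) A.zero_closed oneS oneS]
      obtain u where "u \<in> ?S" "u \<otimes>\<^bsub>A\<^esub> (\<zero>\<^bsub>A\<^esub> \<otimes>\<^bsub>A\<^esub> \<one>\<^bsub>A\<^esub>) = u \<otimes>\<^bsub>A\<^esub> (a \<otimes>\<^bsub>A\<^esub> \<one>\<^bsub>A\<^esub>)" by blast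
      then show ?thesis using a(1) by (intro bexI[of _ u]) auto
    qed
    \<comment> \<open>An element outside \<open>P\<close> that kills \<open>x\<close> would lie in
      \<open>L\<close> and thus in \<open>P\<close>. So \<open>x\<close> stays non-zero in the
      localization, and in that domain every \<open>w\<close> must become zero.\<close>
    have x_ann: False if "u \<in> ?S" "u \<otimes>\<^bsub>A\<^esub> x = \<zero>\<^bsub>A\<^esub>" for u
    proof -
      have "u \<in> L" using that x(1) K0 by (auto simp: L_def A.minus_eq A.m_comm intro!: bexI[of _ "\<zero>\<^bsub>A\<^esub>"])
      then show False using that P(2) by auto
    qed
    have "\<exists>u\<in>?S. u \<otimes>\<^bsub>A\<^esub> w = \<zero>\<^bsub>A\<^esub>" if w: "w \<in> W" for w
    proof -
      have wA: "w \<in> carrier A" using w W(2) by auto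
      have cl: "fraction A ?S a \<one>\<^bsub>A\<^esub> \<in> carrier ?Q" if "a \<in> carrier A" for a
        using that oneS by (auto simp: localization_def)
      have "fraction A ?S x \<one>\<^bsub>A\<^esub> \<otimes>\<^bsub>?Q\<^esub> fraction A ?S w \<one>\<^bsub>A\<^esub> = \<zero>\<^bsub>?Q\<^esub>"
        using S.fraction_mult[OF x(1) wA oneS oneS] x(2)[OF w] by (simp add: localization_def)
      then show ?thesis
        using Q.integral[OF _ cl[OF x(1)] cl[OF wA]] zero[OF x(1)] zero[OF wA] x_ann by blast
    qed
    then obtain u where u: "\<And>w. w \<in> W \<Longrightarrow> u w \<in> ?S \<and> u w \<otimes>\<^bsub>A\<^esub> w = \<zero>\<^bsub>A\<^esub>" by metis
    \<comment> \<open>The product of the multipliers of the single \<open>w\<close> kills all of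
      them; this is where \<open>W\<close> has to be finite.\<close>
    have "\<exists>s\<in>?S. \<forall>w\<in>W. s \<otimes>\<^bsub>A\<^esub> w = \<zero>\<^bsub>A\<^esub>"
      using W u
    proof (induction W rule: finite_induct)
      case empty
      then show ?case using oneS by auto
    next
      case (insert w W)
      then obtain s where s: "s \<in> ?S" "\<And>w. w \<in> W \<Longrightarrow> s \<otimes>\<^bsub>A\<^esub> w = \<zero>\<^bsub>A\<^esub>" by auto
      have k: "s \<in> carrier A" "u w \<in> carrier A" "w \<in> carrier A" "u w \<in> ?S" "u w \<otimes>\<^bsub>A\<^esub> w = \<zero>\<^bsub>A\<^esub>"
        using s insert by auto
      have "(u w \<otimes>\<^bsub>A\<^esub> s) \<otimes>\<^bsub>A\<^esub> w' = \<zero>\<^bsub>A\<^esub>" if "w' \<in> insert w W" for w'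
      proof (cases "w' = w")
        case True
        have "(u w \<otimes>\<^bsub>A\<^esub> s) \<otimes>\<^bsub>A\<^esub> w = s \<otimes>\<^bsub>A\<^esub> (u w \<otimes>\<^bsub>A\<^esub> w)" using k(1-3) by (simp add: A.m_ac)
        then show ?thesis using True k by simp
      next
        case False
        then show ?thesis using that s k insert by (auto simp: A.m_assoc)
      qed
      then show ?case using S.S_mult[OF k(4) s(1)] by blast
    qed
    then obtain s where s: "s \<in> ?S" "\<And>w. w \<in> W \<Longrightarrow> s \<otimes>\<^bsub>A\<^esub> w = \<zero>\<^bsub>A\<^esub>" by blast
    \<comment> \<open>This puts \<open>s\<close> into \<open>L\<close> and so into \<open>P\<close>,
      although it was chosen outside \<open>P\<close>.\<close>
    then have "s \<in> K" by (auto simp: K_def)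
    then have "s \<in> L" using s(1) x(1) by (auto simp: L_def A.minus_eq A.r_neg intro!: bexI[of _ s])
    then show False using s(1) P(2) by auto
  qed
  then obtain y where y: "y \<in> K" "x \<otimes>\<^bsub>A\<^esub> (\<one>\<^bsub>A\<^esub> \<ominus>\<^bsub>A\<^esub> y) = \<zero>\<^bsub>A\<^esub>" by (auto simp: L_def)
  have yc: "y \<in> carrier A" using y by (simp add: K_def)
  have "x = x \<otimes>\<^bsub>A\<^esub> (\<one>\<^bsub>A\<^esub> \<ominus>\<^bsub>A\<^esub> y) \<oplus>\<^bsub>A\<^esub> x \<otimes>\<^bsub>A\<^esub> y" using x(1) yc by algebra
  then have "x \<otimes>\<^bsub>A\<^esub> y = x" using y(2) x(1) yc by simp
  then show ?thesis using that[OF yc] y(1) by (auto simp: K_def)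
qed

section \<open>Coherence along a regular conductor square\<close>

lemma mod_hom_inv:
  assumes M: "module R M" and f: "f \<in> mod_hom R M N" "inj_on f (carrier M)" "f ` carrier M = carrier N"
  shows "inv_into (carrier M) f \<in> mod_hom R N M"
proof -
  interpret M: module R M by fact
  let ?g = "inv_into (carrier M) f"
  have g: "?g x \<in> carrier M" "f (?g x) = x" if "x \<in> carrier N" for x
    using that f(3) inv_into_into[of x f "carrier M"] f_inv_into_f[of x f "carrier M"] by auto
  have gf: "?g z = x" if "x \<in> carrier M" "f x = z" for x z
    using that f(2) by (auto simp: inv_into_f_f)
  show ?thesis
    unfolding mod_hom_def
  proof (intro CollectI conjI ballI funcsetI)
    fix x assume x: "x \<in> carrier N"
    then show "?g x \<in> carrier M" by (rule g)
    fix y assume y: "y \<in> carrier N"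
    show "?g (x \<oplus>\<^bsub>N\<^esub> y) = ?g x \<oplus>\<^bsub>M\<^esub> ?g y"
      using g[OF x] g[OF y] mod_homD(2)[OF f(1), of "?g x" "?g y"] by (intro gf) auto
  next
    fix a x assume a: "a \<in> carrier R" and x: "x \<in> carrier N"
    show "?g (a \<odot>\<^bsub>N\<^esub> x) = a \<odot>\<^bsub>M\<^esub> ?g x"
      using a g[OF x] mod_homD(3)[OF f(1) a, of "?g x"] by (intro gf) auto
  qed
qed

lemma (in cring) finitely_presented_self: "finitely_presented R (mult_module R (carrier R))"
proof (rule finitely_presentedI)
  let ?F = "free_module R (Suc 0)" and ?f = "\<lambda>v :: nat \<Rightarrow> 'a. v 0"
  show "module R (mult_module R (carrier R))" by (rule module_mult_module[OF oneideal])
  show "?f \<in> mod_hom R ?F (mult_module R (carrier R))"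
    by (auto simp: mod_hom_def free_module_simps)
  have "(\<lambda>i\<in>{..<Suc 0}. a) \<in> carrier ?F" if "a \<in> carrier R" for a
    using that by (auto simp: free_module_simps)
  then have "a \<in> ?f ` carrier ?F" if "a \<in> carrier R" for a
    using that by (intro image_eqI[of _ _ "\<lambda>i\<in>{..<Suc 0}. a"]) auto
  moreover have "?f ` carrier ?F \<subseteq> carrier R" by (auto simp: free_module_simps)
  ultimately show "?f ` carrier ?F = carrier (mult_module R (carrier R))" by auto
  have "v = \<zero>\<^bsub>?F\<^esub>" if "v \<in> carrier ?F" "v 0 = \<zero>" for v
    using that by (auto simp: free_module_simps fun_eq_iff PiE_iff extensional_def)
  moreover have "\<zero>\<^bsub>?F\<^esub> \<in> carrier ?F" "?f \<zero>\<^bsub>?F\<^esub> = \<zero>" by (auto simp: free_module_simps)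
  ultimately have "a_kernel ?F (mult_module R (carrier R)) ?f = {\<zero>\<^bsub>?F\<^esub>}"
    unfolding a_kernel_def' mult_module_simps by blast
  then show "fg_sub R ?F (a_kernel ?F (mult_module R (carrier R)) ?f)"
    using fg_sub_zero[OF module_free_module] by simp
qed

lemma (in cring) finitely_presented_zero: "finitely_presented R (mult_module R {\<zero>})"
proof -
  have M: "module R (mult_module R {\<zero>})" by (rule module_mult_module[OF zeroideal])
  let ?F = "free_module R 0" and ?f = "\<lambda>v :: nat \<Rightarrow> 'a. \<zero>"
  have "carrier ?F = {\<zero>\<^bsub>?F\<^esub>}" by (auto simp: free_module_simps)
  then have "a_kernel ?F (mult_module R {\<zero>}) ?f = {\<zero>\<^bsub>?F\<^esub>}" "?f ` carrier ?F = {\<zero>}"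
    unfolding a_kernel_def' by auto
  then show ?thesis
    using free_module_0_hom[OF M, of 0] fg_sub_zero[OF module_free_module, of 0]
    by (intro finitely_presentedI[OF M, of ?f 0]) auto
qed

text \<open>\<open>d\<close> stands for \<open>s / r\<close>. That \<open>c\<close> is non-zero is
  stated beside its regularity, since zero counts as a non-zero-divisor in the zero ring; it makes
  \<open>factor\<close> applicable to finitely generated ideals containing \<open>c\<close>.\<close>

locale regular_conductor_pullback = conductor_pullback R T A \<pi> C
  for R :: "('a, 'x) ring_scheme" and T :: "('a, 'x) ring_scheme" and A :: "('b, 'z) ring_scheme"
    and \<pi> :: "'a \<Rightarrow> 'b" and C :: "'a set" +
  fixes c :: 'a
  assumes c: "c \<in> C" "C = (\<lambda>t. c \<otimes>\<^bsub>T\<^esub> t) ` carrier T" "non_zero_divisor T c" "c \<noteq> \<zero>\<^bsub>T\<^esub>"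
    and factor: "\<And>I. fg_ideal I R \<Longrightarrow> I \<noteq> {\<zero>\<^bsub>R\<^esub>} \<Longrightarrow> \<exists>d U. ideal U R \<and>
        Idl\<^bsub>T\<^esub> U = carrier T \<and> I = (\<lambda>u. d \<otimes>\<^bsub>T\<^esub> u) ` U \<and> non_zero_divisor T d"
begin

lemma nzd_cancel:
  assumes "non_zero_divisor T d" "x \<in> carrier T" "y \<in> carrier T" "d \<otimes>\<^bsub>T\<^esub> x = d \<otimes>\<^bsub>T\<^esub> y"
  shows "x = y"
proof -
  have d: "d \<in> carrier T" using assms by (simp add: non_zero_divisor_def)
  have "d \<otimes>\<^bsub>T\<^esub> (x \<ominus>\<^bsub>T\<^esub> y) = d \<otimes>\<^bsub>T\<^esub> x \<ominus>\<^bsub>T\<^esub> d \<otimes>\<^bsub>T\<^esub> y" using d assms(2,3) by algebra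
  then have "x \<ominus>\<^bsub>T\<^esub> y = \<zero>\<^bsub>T\<^esub>"
    using assms d by (simp add: non_zero_divisor_def T.r_neg T.minus_eq)
  then show ?thesis using assms(2,3) T.minus_add_cancel[of x y] by simp
qed

lemma scaled_ideal_iso:
  assumes I: "ideal I R" and U: "ideal U R" and d: "non_zero_divisor T d" and eq: "I = (\<lambda>u. d \<otimes>\<^bsub>T\<^esub> u) ` U"
  shows "(\<lambda>u. d \<otimes>\<^bsub>T\<^esub> u) \<in> mod_hom R (mult_module R U) (mult_module R I)"
    "inj_on (\<lambda>u. d \<otimes>\<^bsub>T\<^esub> u) U"
proof -
  have dT: "d \<in> carrier T" using d by (simp add: non_zero_divisor_def)
  have u: "u \<in> carrier T" if "u \<in> U" for u using R.ideal_closed(1)[OF U that] sub by auto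
  show "inj_on (\<lambda>u. d \<otimes>\<^bsub>T\<^esub> u) U" using nzd_cancel[OF d] u by (auto intro: inj_onI)
  have "d \<otimes>\<^bsub>T\<^esub> (a \<otimes>\<^bsub>T\<^esub> x) = a \<otimes>\<^bsub>T\<^esub> (d \<otimes>\<^bsub>T\<^esub> x)" if "a \<in> carrier R" "x \<in> U" for a x
    using that sub dT u by (auto simp: T.m_lcomm)
  then show "(\<lambda>u. d \<otimes>\<^bsub>T\<^esub> u) \<in> mod_hom R (mult_module R U) (mult_module R I)"
    using eq dT u by (auto simp: mod_hom_def ops T.r_distr)
qed

text \<open>A non-zero finitely generated ideal \<open>K\<close> of \<open>T\<close> is principal with a regular generator:
  the generators of \<open>c K\<close> generate an ideal \<open>d U\<close> of \<open>R\<close>, so \<open>c K = d U T = d T\<close>.\<close>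

lemma coherent_overring: "coherent_ring T"
  unfolding coherent_ring_def
proof (intro conjI allI impI)
  show "cring T" by (rule T.is_cring)
  fix K assume "fg_ideal K T"
  then obtain W where W: "finite W" "W \<subseteq> carrier T" "K = Idl\<^bsub>T\<^esub> W" by (auto simp: fg_ideal_def)
  have K: "ideal K T" unfolding W(3) by (rule T.genideal_ideal[OF W(2)])
  note k = T.ideal_closed[OF K]
  have WK: "W \<subseteq> K" unfolding W(3) by (rule T.genideal_self[OF W(2)])
  have cT: "c \<in> carrier T" using c(1) C_closed(1) by blast
  show "finitely_presented T (mult_module T K)"
  proof (cases "W \<subseteq> {\<zero>\<^bsub>T\<^esub>}")
    case True
    then have "K \<subseteq> {\<zero>\<^bsub>T\<^esub>}" unfolding W(3) by (rule T.genideal_minimal[OF T.zeroideal])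
    then have "K = {\<zero>\<^bsub>T\<^esub>}" using k(2) by auto
    then show ?thesis using T.finitely_presented_zero by simp
  next
    case False
    then obtain w where w: "w \<in> W" "w \<noteq> \<zero>\<^bsub>T\<^esub>" by auto
    \<comment> \<open>Multiplication by \<open>c\<close> brings the generators into
      \<open>C\<close>, hence into \<open>R\<close>, where \<open>factor\<close> applies.\<close>
    let ?V = "(\<lambda>w. c \<otimes>\<^bsub>T\<^esub> w) ` W"
    have V: "?V \<subseteq> carrier R" using W(2) C_closed(6)[OF _ c(1)] C_sub by blast
    define I where "I = Idl\<^bsub>R\<^esub> ?V"
    have VI: "?V \<subseteq> I" unfolding I_def by (rule R.genideal_self[OF V])
    have "c \<otimes>\<^bsub>T\<^esub> w \<noteq> \<zero>\<^bsub>T\<^esub>" using c(3) w W(2) by (auto simp: non_zero_divisor_def)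
    then have "I \<noteq> {\<zero>\<^bsub>R\<^esub>}" using VI w(1) by (auto simp: ops)
    moreover have "fg_ideal I R" using V W(1) by (auto simp: fg_ideal_def I_def)
    ultimately obtain d U where dU: "ideal U R" "Idl\<^bsub>T\<^esub> U = carrier T" "I = (\<lambda>u. d \<otimes>\<^bsub>T\<^esub> u) ` U"
      "non_zero_divisor T d" using factor by blast
    have dT: "d \<in> carrier T" using dU(4) by (simp add: non_zero_divisor_def)
    have U: "u \<in> carrier T" if "u \<in> U" for u using R.ideal_closed(1)[OF dU(1) that] sub by auto
    let ?cK = "(\<lambda>x. c \<otimes>\<^bsub>T\<^esub> x) ` K"
    have cK_mult: "t \<otimes>\<^bsub>T\<^esub> x \<in> ?cK" if t: "t \<in> carrier T" and x: "x \<in> ?cK" for t x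
    proof -
      obtain z where z: "z \<in> K" "x = c \<otimes>\<^bsub>T\<^esub> z" using x by blast
      then have "t \<otimes>\<^bsub>T\<^esub> x = c \<otimes>\<^bsub>T\<^esub> (t \<otimes>\<^bsub>T\<^esub> z)" using t cT k(1) by (simp add: T.m_lcomm)
      then show ?thesis using k(5)[OF t z(1)] by blast
    qed
    have cK_add: "x \<oplus>\<^bsub>T\<^esub> y \<in> ?cK" if x: "x \<in> ?cK" and y: "y \<in> ?cK" for x y
    proof -
      obtain z z' where z: "z \<in> K" "x = c \<otimes>\<^bsub>T\<^esub> z" "z' \<in> K" "y = c \<otimes>\<^bsub>T\<^esub> z'" using x y by blast
      then have "x \<oplus>\<^bsub>T\<^esub> y = c \<otimes>\<^bsub>T\<^esub> (z \<oplus>\<^bsub>T\<^esub> z')" using cT k(1) by (simp add: T.r_distr)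
      then show ?thesis using k(3)[OF z(1,3)] by blast
    qed
    have cK0: "\<zero>\<^bsub>T\<^esub> \<in> ?cK" using k(2) cT by (intro image_eqI[of _ _ "\<zero>\<^bsub>T\<^esub>"]) auto
    have IK: "I \<subseteq> ?cK"
    proof -
      have "lspan R (mult_module R (carrier R)) ?V \<subseteq> ?cK"
      proof (rule lspan_least)
        fix a v x assume "a \<in> carrier R" "v \<in> ?V" "x \<in> ?cK"
        moreover from this have "a \<in> carrier T" "v \<in> ?cK" using sub WK by auto
        ultimately show "a \<odot>\<^bsub>mult_module R (carrier R)\<^esub> v \<oplus>\<^bsub>mult_module R (carrier R)\<^esub> x \<in> ?cK"
          using cK_add cK_mult by (simp only: mult_module_simps ops)
      qed (use cK0 in \<open>simp only: mult_module_simps ops\<close>)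
      then show ?thesis unfolding I_def R.genideal_eq_lspan[OF V] .
    qed
    \<comment> \<open>The elements of \<open>T\<close> that carry \<open>d\<close> into
      \<open>c K\<close>. They include \<open>U\<close>, since \<open>d U = I\<close> lies in
      \<open>c K\<close>, and therefore the unit, as \<open>U T = T\<close>; hence
      \<open>d = c z\<close> for some \<open>z\<close> in \<open>K\<close>.\<close>
    have "ideal {t \<in> carrier T. d \<otimes>\<^bsub>T\<^esub> t \<in> ?cK} T" (is "ideal ?S T")
    proof (rule idealI[OF T.ring_axioms])
      have m: "t \<otimes>\<^bsub>T\<^esub> a \<in> ?S" if "a \<in> ?S" "t \<in> carrier T" for a t
        using that dT cK_mult[of t "d \<otimes>\<^bsub>T\<^esub> a"] by (simp add: T.m_lcomm)
      show "subgroup ?S (add_monoid T)"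
      proof (rule T.add.subgroupI)
        have "d \<otimes>\<^bsub>T\<^esub> \<zero>\<^bsub>T\<^esub> \<in> ?cK" unfolding T.r_null[OF dT] by (rule cK0)
        then show "?S \<noteq> {}" using T.zero_closed by blast
        fix a assume a: "a \<in> ?S"
        then have "(\<ominus>\<^bsub>T\<^esub> \<one>\<^bsub>T\<^esub>) \<otimes>\<^bsub>T\<^esub> a \<in> ?S" by (rule m) simp
        then show "\<ominus>\<^bsub>T\<^esub> a \<in> ?S" using a by (simp add: T.l_minus)
        fix b assume "b \<in> ?S"
        then show "a \<oplus>\<^bsub>T\<^esub> b \<in> ?S" using a dT cK_add by (simp add: T.r_distr)
      qed auto
      fix a t assume a: "a \<in> ?S" and t: "t \<in> carrier T"
      then show "t \<otimes>\<^bsub>T\<^esub> a \<in> ?S" by (rule m)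
      then show "a \<otimes>\<^bsub>T\<^esub> t \<in> ?S" using a t by (simp add: T.m_comm)
    qed
    moreover have "U \<subseteq> ?S" using U IK dU(3) by blast
    ultimately have "Idl\<^bsub>T\<^esub> U \<subseteq> ?S" by (rule T.genideal_minimal)
    then have "\<one>\<^bsub>T\<^esub> \<in> ?S" using dU(2) by auto
    then obtain z where z: "z \<in> K" "d = c \<otimes>\<^bsub>T\<^esub> z" using dT by auto
    have zT: "z \<in> carrier T" using z k by auto
    \<comment> \<open>\<open>z\<close> inherits regularity from its multiple
      \<open>d = c z\<close>.\<close>
    have "z \<otimes>\<^bsub>T\<^esub> t = \<zero>\<^bsub>T\<^esub> \<Longrightarrow> t = \<zero>\<^bsub>T\<^esub>" if "t \<in> carrier T" for t
      using dU(4) that cT zT z(2) by (auto simp: non_zero_divisor_def T.m_assoc)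
    then have nz: "non_zero_divisor T z" using zT by (simp add: non_zero_divisor_def)
    have "W \<subseteq> PIdl\<^bsub>T\<^esub> z"
    proof
      fix x assume x: "x \<in> W"
      then obtain u where u: "u \<in> U" "c \<otimes>\<^bsub>T\<^esub> x = d \<otimes>\<^bsub>T\<^esub> u" using VI dU(3) by blast
      \<comment> \<open>Cancel \<open>c\<close> in \<open>c x = d u = c z u\<close>.\<close>
      have "x = z \<otimes>\<^bsub>T\<^esub> u"
      proof (rule nzd_cancel[OF c(3)])
        show "x \<in> carrier T" "z \<otimes>\<^bsub>T\<^esub> u \<in> carrier T" using x W(2) zT U[OF u(1)] by auto
        show "c \<otimes>\<^bsub>T\<^esub> x = c \<otimes>\<^bsub>T\<^esub> (z \<otimes>\<^bsub>T\<^esub> u)"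
          unfolding u(2) z(2) by (rule T.m_assoc[OF cT zT U[OF u(1)]])
      qed
      then have "x = u \<otimes>\<^bsub>T\<^esub> z" using zT U[OF u(1)] by (simp add: T.m_comm)
      then show "x \<in> PIdl\<^bsub>T\<^esub> z" using U[OF u(1)] by (auto simp: cgenideal_def)
    qed
    then have "K \<subseteq> PIdl\<^bsub>T\<^esub> z" unfolding W(3) by (rule T.genideal_minimal[OF T.cgenideal_ideal[OF zT]])
    moreover have "PIdl\<^bsub>T\<^esub> z \<subseteq> K" using k(5) z(1) by (auto simp: cgenideal_def)
    ultimately have Kz: "K = (\<lambda>t. z \<otimes>\<^bsub>T\<^esub> t) ` carrier T"
      using zT by (auto simp: cgenideal_def T.m_comm)
    show ?thesis
    proof (rule finitely_presented_iso[OF _ _ T.finitely_presented_self])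
      show "module T (mult_module T (carrier T))" by (rule T.module_mult_module[OF T.oneideal])
      show "module T (mult_module T K)" by (rule T.module_mult_module[OF K])
      show "(\<lambda>t. z \<otimes>\<^bsub>T\<^esub> t) \<in> mod_hom T (mult_module T (carrier T)) (mult_module T K)"
        using zT Kz by (auto simp: mod_hom_def T.r_distr T.m_lcomm)
      show "(\<lambda>t. z \<otimes>\<^bsub>T\<^esub> t) ` carrier (mult_module T (carrier T)) = carrier (mult_module T K)"
        using Kz by simp
      show "inj_on (\<lambda>t. z \<otimes>\<^bsub>T\<^esub> t) (carrier (mult_module T (carrier T)))"
        using nzd_cancel[OF nz] by (auto intro: inj_onI)
    qed
  qed
qed

text \<open>Multiplication by the regular element \<open>d\<close> is an isomorphism of
  \<open>R\<close>-modules from \<open>U\<close> to \<open>I\<close>. So \<open>U\<close> inherits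
  finite generation from \<open>I\<close> and the two share finite presentability;
  \<open>finitely_presented_ideal_iff\<close> then moves the question to \<open>A\<close>.\<close>

lemma scaled_ideal:
  assumes fg: "fg_ideal I R" and U: "ideal U R" "Idl\<^bsub>T\<^esub> U = carrier T"
    and d: "non_zero_divisor T d" and eq: "I = (\<lambda>u. d \<otimes>\<^bsub>T\<^esub> u) ` U"
  shows "fg_sub R (mult_module R U) U" "fg_ideal (\<pi> ` U) A"
    "finitely_presented R (mult_module R I) \<longleftrightarrow> finitely_presented A (mult_module A (\<pi> ` U))"
proof -
  have I: "ideal I R" "fg_sub R (mult_module R I) I" using fg R.fg_ideal_iff by auto
  have MU: "module R (mult_module R U)" and MI: "module R (mult_module R I)"
    by (rule R.module_mult_module, fact)+
  let ?f = "\<lambda>u. d \<otimes>\<^bsub>T\<^esub> u"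
  note f = scaled_ideal_iso[OF I(1) U(1) d eq]
  have g: "inv_into U ?f \<in> mod_hom R (mult_module R I) (mult_module R U)"
    using mod_hom_inv[OF MU f(1)] f(2) eq by simp
  have g': "inv_into U ?f ` I = U" "inj_on (inv_into U ?f) I"
    using f(2) eq by (auto intro: inj_on_inv_into simp: inv_into_image_cancel)
  show fgU: "fg_sub R (mult_module R U) U"
    using fg_sub_image[OF MI MU g] I(2) g'(1) by simp
  show "fg_ideal (\<pi> ` U) A"
    unfolding A.fg_ideal_iff using ideal_image[OF U(1)] fg_sub_image_ideal[OF U(1) fgU] by blast
  have "finitely_presented R (mult_module R I) \<longleftrightarrow> finitely_presented R (mult_module R U)"
    using finitely_presented_iso[OF MI MU _ g] g' finitely_presented_iso[OF MU MI _ f(1)] f(2) eq by auto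
  then show "finitely_presented R (mult_module R I) \<longleftrightarrow> finitely_presented A (mult_module A (\<pi> ` U))"
    using finitely_presented_ideal_iff[OF U fgU] by simp
qed

lemma coherent_if_quotient:
  assumes "coherent_ring A" shows "coherent_ring R"
  unfolding coherent_ring_def
proof (intro conjI allI impI)
  show "cring R" by (rule R.is_cring)
  fix I assume I: "fg_ideal I R"
  show "finitely_presented R (mult_module R I)"
  proof (cases "I = {\<zero>\<^bsub>R\<^esub>}")
    case True
    then show ?thesis using R.finitely_presented_zero by simp
  next
    case False
    then obtain d U where dU: "ideal U R" "Idl\<^bsub>T\<^esub> U = carrier T" "I = (\<lambda>u. d \<otimes>\<^bsub>T\<^esub> u) ` U"
      "non_zero_divisor T d" using factor[OF I] by blast
    show ?thesis
      using scaled_ideal(2,3)[OF I dU(1,2,4,3)] assms by (simp add: coherent_ring_def)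
  qed
qed

text \<open>Lift \<open>J\<close> to \<open>I = d U\<close> with \<open>c = d c'\<close> in \<open>I\<close>. Multiplication by \<open>d\<close> maps \<open>U / C\<close> onto \<open>J\<close>
  with kernel \<open>(U \<inter> c' T) / C\<close>; as \<open>c'\<close> kills \<open>J\<close>, some \<open>y\<close> killing \<open>J\<close> fixes \<open>c'\<close> modulo \<open>C\<close>, and the
  kernel is \<open>y (U / C)\<close>.\<close>

lemma coherent_quotient:
  assumes coh: "coherent_ring R" and loc: "locally_domain A"
  shows "coherent_ring A"
  unfolding coherent_ring_def
proof (intro conjI allI impI)
  show "cring A" by (rule A.is_cring)
  fix J assume J: "fg_ideal J A"
  then obtain V where V: "finite V" "V \<subseteq> \<pi> ` carrier R" "J = Idl\<^bsub>A\<^esub> V"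
    using \<pi>_onto by (auto simp: fg_ideal_def)
  then obtain W where W: "finite W" "W \<subseteq> carrier R" "V = \<pi> ` W"
    using finite_subset_image[OF V(1,2)] by blast
  have VA: "V \<subseteq> carrier A" using V(2) \<pi>_onto by simp
  have cR: "c \<in> carrier R" and cT: "c \<in> carrier T" using c(1) C_sub C_closed(1) by auto
  have W': "insert c W \<subseteq> carrier R" using W(2) cR by auto
  \<comment> \<open>Adjoining \<open>c\<close> does not change the image in \<open>A\<close>, as
    \<open>\<pi>\<close> kills \<open>c\<close>, but it makes the lift non-zero and yields
    \<open>c = d c'\<close> with \<open>c'\<close> in \<open>U\<close>.\<close>
  define I where "I = Idl\<^bsub>R\<^esub> (insert c W)"
  have WI: "insert c W \<subseteq> I" unfolding I_def by (rule R.genideal_self[OF W'])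
  have I: "fg_ideal I R" using W(1) W' by (auto simp: fg_ideal_def I_def)
  have "I \<noteq> {\<zero>\<^bsub>R\<^esub>}" using WI c(4) by (auto simp: ops)
  then obtain d U where dU: "ideal U R" "Idl\<^bsub>T\<^esub> U = carrier T" "I = (\<lambda>u. d \<otimes>\<^bsub>T\<^esub> u) ` U"
    "non_zero_divisor T d" using factor[OF I] by blast
  have dT: "d \<in> carrier T" using dU(4) by (simp add: non_zero_divisor_def)
  note u = R.ideal_closed[OF dU(1)]
  have uT: "x \<in> carrier T" if "x \<in> U" for x using u(1)[OF that] sub by auto
  have IR: "ideal I R" using I R.fg_ideal_iff by auto
  have duR: "d \<otimes>\<^bsub>T\<^esub> x \<in> carrier R" if "x \<in> U" for x
    using R.ideal_closed(1)[OF IR] dU(3) that by blast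
  have \<pi>I: "\<pi> ` I = J"
  proof -
    have "\<pi> ` I = lspan A (mult_module A (carrier A)) (\<pi> ` insert c W)"
      using image_lspan_ideal[OF R.oneideal W'] unfolding I_def R.genideal_eq_lspan[OF W'] \<pi>_onto .
    also have "\<dots> = Idl\<^bsub>A\<^esub> (\<pi> ` insert c W)"
      using W' by (intro A.genideal_eq_lspan[symmetric]) auto
    also have "\<pi> ` insert c W = insert \<zero>\<^bsub>A\<^esub> V" using W(3) \<pi>_ker[OF cR] c(1) by auto
    also have "Idl\<^bsub>A\<^esub> (insert \<zero>\<^bsub>A\<^esub> V) = J"
    proof
      have "insert \<zero>\<^bsub>A\<^esub> V \<subseteq> J"
        using A.genideal_self[OF VA] A.ideal_closed(2)[OF A.genideal_ideal[OF VA]] V(3) by auto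
      then show "Idl\<^bsub>A\<^esub> (insert \<zero>\<^bsub>A\<^esub> V) \<subseteq> J"
        unfolding V(3) by (intro A.genideal_minimal[OF A.genideal_ideal[OF VA]])
      have "insert \<zero>\<^bsub>A\<^esub> V \<subseteq> carrier A" using VA by auto
      from A.genideal_minimal[OF A.genideal_ideal[OF this]] A.genideal_self[OF this]
      show "J \<subseteq> Idl\<^bsub>A\<^esub> (insert \<zero>\<^bsub>A\<^esub> V)" unfolding V(3) by blast
    qed
    finally show ?thesis .
  qed
  obtain c' where c': "c' \<in> U" "c = d \<otimes>\<^bsub>T\<^esub> c'" using WI dU(3) by blast
  have c'R: "c' \<in> carrier R" using u(1) c'(1) .
  \<comment> \<open>For \<open>w = d x\<close> with \<open>x\<close> in \<open>U\<close>, the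
    product \<open>c' w = c x\<close> lies in \<open>C\<close>.\<close>
  have "\<pi> c' \<otimes>\<^bsub>A\<^esub> v = \<zero>\<^bsub>A\<^esub>" if v: "v \<in> V" for v
  proof -
    obtain w where w: "w \<in> W" "v = \<pi> w" using v W(3) by blast
    then obtain x where x: "x \<in> U" "w = d \<otimes>\<^bsub>T\<^esub> x" using WI dU(3) by blast
    have "c' \<otimes>\<^bsub>T\<^esub> w = c \<otimes>\<^bsub>T\<^esub> x" using x c' dT uT by (simp add: T.m_ac)
    then have "c' \<otimes>\<^bsub>R\<^esub> w \<in> C" using C_closed(6)[OF uT[OF x(1)] c(1)] by (simp add: ops)
    then show ?thesis using \<pi>_ker[of "c' \<otimes>\<^bsub>R\<^esub> w"] w W(2) c'R by auto
  qed
  then obtain y' where y': "y' \<in> carrier A" "\<And>v. v \<in> V \<Longrightarrow> y' \<otimes>\<^bsub>A\<^esub> v = \<zero>\<^bsub>A\<^esub>" "\<pi> c' \<otimes>\<^bsub>A\<^esub> y' = \<pi> c'"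
    using locally_domain_annihilator[OF loc V(1) VA \<pi>_simps(1)[OF c'R]] by metis
  obtain y where y: "y \<in> carrier R" "y' = \<pi> y" using y'(1) \<pi>_onto by blast
  have yJ: "y' \<otimes>\<^bsub>A\<^esub> x = \<zero>\<^bsub>A\<^esub>" if "x \<in> J" for x
  proof -
    have "lspan A (mult_module A (carrier A)) V \<subseteq> {x \<in> carrier A. y' \<otimes>\<^bsub>A\<^esub> x = \<zero>\<^bsub>A\<^esub>}"
      using y' VA by (intro lspan_least) (auto simp: A.r_distr A.m_lcomm subset_iff)
    then show ?thesis using that unfolding V(3) A.genideal_eq_lspan[OF VA] by blast
  qed
  \<comment> \<open>An element \<open>d x\<close> of \<open>C\<close> is
    \<open>c t = d c' t\<close>, so \<open>x = c' t\<close> with \<open>t\<close> in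
    \<open>T\<close>. Since \<open>c'\<close> and \<open>c' y\<close> are congruent modulo
    \<open>C\<close> and \<open>C\<close> is an ideal of \<open>T\<close>, multiplying by
    \<open>t\<close> shows that \<open>x\<close> and \<open>y x\<close> are congruent.\<close>
  have fixed: "\<pi> x = y' \<otimes>\<^bsub>A\<^esub> \<pi> x" if x: "x \<in> U" and dx: "d \<otimes>\<^bsub>T\<^esub> x \<in> C" for x
  proof -
    obtain t where t: "t \<in> carrier T" "d \<otimes>\<^bsub>T\<^esub> x = c \<otimes>\<^bsub>T\<^esub> t" using dx c(2) by blast
    have xt: "x = c' \<otimes>\<^bsub>T\<^esub> t"
    proof (rule nzd_cancel[OF dU(4)])
      show "x \<in> carrier T" "c' \<otimes>\<^bsub>T\<^esub> t \<in> carrier T" using uT x c'(1) t(1) by auto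
      show "d \<otimes>\<^bsub>T\<^esub> x = d \<otimes>\<^bsub>T\<^esub> (c' \<otimes>\<^bsub>T\<^esub> t)"
        unfolding t(2) using T.m_assoc[OF dT uT[OF c'(1)] t(1)] by (simp only: c'(2)[symmetric])
    qed
    let ?e = "c' \<ominus>\<^bsub>R\<^esub> c' \<otimes>\<^bsub>R\<^esub> y"
    have e: "?e \<in> C" using \<pi>_eq_iff[of c' "c' \<otimes>\<^bsub>R\<^esub> y"] y y'(3) c'R by simp
    have eT: "?e \<in> carrier T" "y \<in> carrier T" "c' \<in> carrier T"
      using e C_closed(1) y(1) c'R sub by auto
    have "?e \<oplus>\<^bsub>T\<^esub> c' \<otimes>\<^bsub>T\<^esub> y = c'"
      using R.minus_add_cancel[OF c'R R.m_closed[OF c'R y(1)]] by (simp only: ops)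
    then have "x = (?e \<oplus>\<^bsub>T\<^esub> c' \<otimes>\<^bsub>T\<^esub> y) \<otimes>\<^bsub>T\<^esub> t" using xt by simp
    also have "\<dots> = ?e \<otimes>\<^bsub>T\<^esub> t \<oplus>\<^bsub>T\<^esub> c' \<otimes>\<^bsub>T\<^esub> y \<otimes>\<^bsub>T\<^esub> t"
      by (rule T.l_distr[OF eT(1) T.m_closed[OF eT(3,2)] t(1)])
    also have "c' \<otimes>\<^bsub>T\<^esub> y \<otimes>\<^bsub>T\<^esub> t = y \<otimes>\<^bsub>T\<^esub> x"
      unfolding xt using eT(2,3) t(1) by (simp add: T.m_ac)
    finally have "x = ?e \<otimes>\<^bsub>T\<^esub> t \<oplus>\<^bsub>R\<^esub> y \<otimes>\<^bsub>R\<^esub> x" by (simp add: ops)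
    moreover have et: "?e \<otimes>\<^bsub>T\<^esub> t \<in> C" "?e \<otimes>\<^bsub>T\<^esub> t \<in> carrier R"
      using C_closed(6)[OF t(1) e] C_sub by auto
    ultimately have "\<pi> x = \<pi> (?e \<otimes>\<^bsub>T\<^esub> t) \<oplus>\<^bsub>A\<^esub> \<pi> y \<otimes>\<^bsub>A\<^esub> \<pi> x"
      using \<pi>_simps(2)[of "?e \<otimes>\<^bsub>T\<^esub> t" "y \<otimes>\<^bsub>R\<^esub> x"] \<pi>_simps(3)[of y x] y(1) u(1)[OF x] by simp
    also have "\<pi> (?e \<otimes>\<^bsub>T\<^esub> t) = \<zero>\<^bsub>A\<^esub>" using et \<pi>_ker by blast
    also have "\<zero>\<^bsub>A\<^esub> \<oplus>\<^bsub>A\<^esub> \<pi> y \<otimes>\<^bsub>A\<^esub> \<pi> x = y' \<otimes>\<^bsub>A\<^esub> \<pi> x" using y u(1)[OF x] by simp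
    finally show ?thesis .
  qed
  let ?M = "mult_module A (\<pi> ` U)" and ?N = "mult_module A J"
  have MA: "ideal (\<pi> ` U) A" by (rule ideal_image[OF dU(1)])
  have M: "module A ?M" by (rule A.module_mult_module[OF MA])
  have "ideal J A" using J A.fg_ideal_iff by auto
  then have N: "module A ?N" by (rule A.module_mult_module)
  \<comment> \<open>Multiplication by \<open>d\<close> on residues, taken through a lift to
    \<open>U\<close>. Although \<open>d\<close> is only in \<open>T\<close>, this makes sense:
    \<open>d U = I\<close> lies in \<open>R\<close>, and \<open>d C\<close> lies in
    \<open>C\<close>, so the choice of the lift does not matter.\<close>
  define \<psi> where "\<psi> = (\<lambda>w. \<pi> (d \<otimes>\<^bsub>T\<^esub> inv_into U \<pi> w))"
  have \<psi>\<pi>: "\<psi> (\<pi> x) = \<pi> (d \<otimes>\<^bsub>T\<^esub> x)" if x: "x \<in> U" for x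
  proof -
    let ?x = "inv_into U \<pi> (\<pi> x)"
    have x': "?x \<in> U" "\<pi> ?x = \<pi> x"
      by (rule inv_into_into[OF imageI[OF x]], rule f_inv_into_f[OF imageI[OF x]])
    let ?e = "?x \<ominus>\<^bsub>R\<^esub> x"
    have e: "?e \<in> C" using \<pi>_eq_iff[OF u(1)[OF x'(1)] u(1)[OF x]] x'(2) by blast
    have "?e \<oplus>\<^bsub>T\<^esub> x = ?x"
      using R.minus_add_cancel[OF u(1)[OF x'(1)] u(1)[OF x]] by (simp add: ops)
    then have "d \<otimes>\<^bsub>T\<^esub> ?x = d \<otimes>\<^bsub>T\<^esub> ?e \<oplus>\<^bsub>R\<^esub> d \<otimes>\<^bsub>T\<^esub> x"
      using T.r_distr[OF C_closed(1)[OF e] uT[OF x] dT] by (simp add: ops)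
    moreover have de: "d \<otimes>\<^bsub>T\<^esub> ?e \<in> C" "d \<otimes>\<^bsub>T\<^esub> ?e \<in> carrier R" using C_closed(5)[OF dT e] C_sub by auto
    ultimately have "\<pi> (d \<otimes>\<^bsub>T\<^esub> ?x) = \<pi> (d \<otimes>\<^bsub>T\<^esub> ?e) \<oplus>\<^bsub>A\<^esub> \<pi> (d \<otimes>\<^bsub>T\<^esub> x)"
      using \<pi>_simps(2) duR[OF x] by simp
    then show ?thesis using de \<pi>_ker duR[OF x] unfolding \<psi>_def by simp
  qed
  have \<psi>: "\<psi> \<in> mod_hom A ?M ?N"
    unfolding mod_hom_def
  proof (intro CollectI conjI ballI funcsetI)
    fix w assume "w \<in> carrier ?M"
    then obtain x where x: "x \<in> U" "w = \<pi> x" by auto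
    then show "\<psi> w \<in> carrier ?N" using \<psi>\<pi> \<pi>I dU(3) by auto
    fix w' assume "w' \<in> carrier ?M"
    then obtain x' where x': "x' \<in> U" "w' = \<pi> x'" by auto
    have "\<psi> (w \<oplus>\<^bsub>A\<^esub> w') = \<pi> (d \<otimes>\<^bsub>T\<^esub> (x \<oplus>\<^bsub>R\<^esub> x'))"
      using \<psi>\<pi>[OF u(3)[OF x(1) x'(1)]] x x' u(1) by simp
    also have "d \<otimes>\<^bsub>T\<^esub> (x \<oplus>\<^bsub>R\<^esub> x') = d \<otimes>\<^bsub>T\<^esub> x \<oplus>\<^bsub>R\<^esub> d \<otimes>\<^bsub>T\<^esub> x'"
      using uT x(1) x'(1) dT by (simp add: ops T.r_distr)
    finally show "\<psi> (w \<oplus>\<^bsub>?M\<^esub> w') = \<psi> w \<oplus>\<^bsub>?N\<^esub> \<psi> w'" using x x' duR \<psi>\<pi> by simp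
  next
    fix a w assume "a \<in> carrier A" "w \<in> carrier ?M"
    then have "a \<in> \<pi> ` carrier R" "w \<in> \<pi> ` U" using \<pi>_onto by simp_all
    then obtain b x where x: "x \<in> U" "w = \<pi> x" and b: "b \<in> carrier R" "a = \<pi> b"
      by blast
    have "\<psi> (a \<otimes>\<^bsub>A\<^esub> w) = \<pi> (d \<otimes>\<^bsub>T\<^esub> (b \<otimes>\<^bsub>R\<^esub> x))"
      using \<psi>\<pi>[OF u(5)[OF b(1) x(1)]] x b u(1) by simp
    also have "d \<otimes>\<^bsub>T\<^esub> (b \<otimes>\<^bsub>R\<^esub> x) = b \<otimes>\<^bsub>R\<^esub> (d \<otimes>\<^bsub>T\<^esub> x)"
      using uT x(1) b(1) sub dT by (simp add: ops T.m_lcomm subset_iff)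
    finally show "\<psi> (a \<odot>\<^bsub>?M\<^esub> w) = a \<odot>\<^bsub>?N\<^esub> \<psi> w" using x b duR \<psi>\<pi> by simp
  qed
  have \<psi>_onto: "\<psi> ` carrier ?M = carrier ?N"
  proof -
    have "\<psi> ` \<pi> ` U = (\<lambda>x. \<pi> (d \<otimes>\<^bsub>T\<^esub> x)) ` U"
      unfolding image_image using \<psi>\<pi> by (intro image_cong) auto
    also have "\<dots> = J" unfolding \<pi>I[symmetric] dU(3) image_image ..
    finally show ?thesis by simp
  qed
  have ker: "a_kernel ?M ?N \<psi> = (\<lambda>v. y' \<otimes>\<^bsub>A\<^esub> v) ` \<pi> ` U"
  proof
    show "a_kernel ?M ?N \<psi> \<subseteq> (\<lambda>v. y' \<otimes>\<^bsub>A\<^esub> v) ` \<pi> ` U"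
    proof
      fix w assume "w \<in> a_kernel ?M ?N \<psi>"
      then have w: "w \<in> \<pi> ` U" "\<psi> w = \<zero>\<^bsub>A\<^esub>" unfolding a_kernel_def' by auto
      then obtain x where x: "x \<in> U" "w = \<pi> x" by blast
      then have "d \<otimes>\<^bsub>T\<^esub> x \<in> C" using w(2) \<psi>\<pi> \<pi>_ker duR by auto
      then have "w = y' \<otimes>\<^bsub>A\<^esub> w" using fixed x by blast
      then show "w \<in> (\<lambda>v. y' \<otimes>\<^bsub>A\<^esub> v) ` \<pi> ` U" using w(1) by (rule image_eqI)
    qed
    show "(\<lambda>v. y' \<otimes>\<^bsub>A\<^esub> v) ` \<pi> ` U \<subseteq> a_kernel ?M ?N \<psi>"
    proof
      fix w assume "w \<in> (\<lambda>v. y' \<otimes>\<^bsub>A\<^esub> v) ` \<pi> ` U"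
      then obtain v where v: "v \<in> \<pi> ` U" "w = y' \<otimes>\<^bsub>A\<^esub> v" by blast
      have "\<psi> w = y' \<otimes>\<^bsub>A\<^esub> \<psi> v" using mod_homD(3)[OF \<psi> y'(1)] v by simp
      also have "\<dots> = \<zero>\<^bsub>A\<^esub>" using yJ mod_homD(1)[OF \<psi>] v(1) by simp
      finally show "w \<in> a_kernel ?M ?N \<psi>"
        using A.ideal_closed(5)[OF MA y'(1) v(1)] v(2) unfolding a_kernel_def' by simp
    qed
  qed
  have mult_y: "(\<lambda>v. y' \<otimes>\<^bsub>A\<^esub> v) \<in> mod_hom A ?M ?M"
    using A.ideal_closed(1,5)[OF MA] y'(1) by (auto simp: mod_hom_def A.r_distr A.m_lcomm)
  have fgM: "fg_sub A ?M (carrier ?M)"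
    using scaled_ideal(2)[OF I dU(1,2,4,3)] A.fg_ideal_iff by simp
  \<comment> \<open>The kernel is the image of the finitely generated module \<open>?M\<close> under
    multiplication by \<open>y'\<close>.\<close>
  have "fg_sub A ?M (a_kernel ?M ?N \<psi>)"
    using fg_sub_image[OF M M mult_y refl fgM] by (simp add: ker)
  moreover have "finitely_presented A ?M"
    using scaled_ideal(3)[OF I dU(1,2,4,3)] coh I by (simp add: coherent_ring_def)
  ultimately show "finitely_presented A ?N"
    using finitely_presented_quotient[OF M N _ \<psi> \<psi>_onto] by blast
qed

end

section \<open>From the conductor square to the locales, and the conclusion\<close>

lemma conductor_square_pullback:
  assumes "conductor_square R T C"
  shows "conductor_pullback R T (R Quot C) (\<lambda>a. C +>\<^bsub>R\<^esub> a) C"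
proof -
  have T: "cring T" and sub: "subring (carrier R) T" and R: "R = T\<lparr>carrier := carrier R\<rparr>"
    and C: "ideal C R" "ideal C T"
    using assms by (auto simp: conductor_square_def common_ideal_def)
  interpret T: cring T by (rule T)
  have cR: "carrier R \<subseteq> carrier T" by (rule subringE(1)[OF sub])
  have "cring (T\<lparr>carrier := carrier R\<rparr>)"
    using T.subring_is_ring[OF sub] cR T.m_comm
    by (intro cring.intro comm_monoid.intro comm_monoid_axioms.intro) (auto simp: ring_def)
  then interpret R: cring R using R by simp
  interpret C: ideal C R by (rule C)
  have mult: "monoid.mult R = monoid.mult T" and add: "ring.add R = ring.add T"
    and one: "\<one>\<^bsub>R\<^esub> = \<one>\<^bsub>T\<^esub>" and zero: "\<zero>\<^bsub>R\<^esub> = \<zero>\<^bsub>T\<^esub>"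
    by (subst R, simp)+
  show ?thesis
  proof (intro conductor_pullback.intro conductor_pullback_axioms.intro)
    show "cring (R Quot C)" by (rule C.quotient_is_cring[OF R.is_cring])
    show "(\<lambda>a. C +>\<^bsub>R\<^esub> a) ` carrier R = carrier (R Quot C)"
      by (auto simp: FactRing_def A_RCOSETS_def')
    show "C +>\<^bsub>R\<^esub> x = \<zero>\<^bsub>R Quot C\<^esub> \<longleftrightarrow> x \<in> C" if "x \<in> carrier R" for x
      using that C.a_rcos_const C.a_rcos_self[of x] by (auto simp: FactRing_def)
  qed (use T R.is_cring cR mult add one zero C C.rcos_ring_hom C.a_subset in auto)
qed

theorem theorem4p8:
  fixes R T :: "('a, 'x) ring_scheme" and C :: "'a set"
  assumes "regular_conductor_square R T C"
    and "flat_module R (mult_module T (carrier T))"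
    and "principalideal C T"
    and "\<And>I. fg_ideal I R \<Longrightarrow> I \<noteq> {\<zero>\<^bsub>R\<^esub>} \<Longrightarrow>
      \<exists>r\<in>carrier R. \<exists>s\<in>carrier R. \<exists>U. ideal U R \<and>
        Idl\<^bsub>T\<^esub> U = carrier T \<and> carrier T = PIdl\<^bsub>T\<^esub> r \<and>
        r <#\<^bsub>R\<^esub> I = s <#\<^bsub>R\<^esub> U \<and>
        (\<lambda>x. r \<otimes>\<^bsub>R\<^esub> x) \<in> mod_iso R (mult_module R I) (mult_module R (r <#\<^bsub>R\<^esub> I)) \<and>
        (\<lambda>x. s \<otimes>\<^bsub>R\<^esub> x) \<in> mod_iso R (mult_module R U) (mult_module R (s <#\<^bsub>R\<^esub> U))"
    and "locally_domain (R Quot C)"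
    and "krull_dim (R Quot C) < \<infinity>"
  shows "(coherent_ring R \<longleftrightarrow> coherent_ring (R Quot C)) \<and>
    (coherent_ring R \<longrightarrow> coherent_ring T) \<and>
    (coherent_ring (R Quot C) \<longrightarrow> coherent_ring T)"
proof -
  have sq: "conductor_square R T C" using assms(1) by (simp add: regular_conductor_square_def)
  interpret conductor_pullback R T "R Quot C" "\<lambda>a. C +>\<^bsub>R\<^esub> a" C
    by (rule conductor_square_pullback[OF sq])
  interpret P: principalideal C T by (rule assms(3))
  obtain c where cT: "c \<in> carrier T" and "C = Idl\<^bsub>T\<^esub> {c}" using P.generate by blast
  then have C_PIdl: "C = PIdl\<^bsub>T\<^esub> c" using T.cgenideal_eq_genideal[OF cT] by simp
  then have cC: "c \<in> C" using T.cgenideal_self[OF cT] by simp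
  have "PIdl\<^bsub>T\<^esub> c = (\<lambda>t. c \<otimes>\<^bsub>T\<^esub> t) ` carrier T"
    unfolding cgenideal_def using T.m_comm[OF cT] by auto
  then have Cc: "C = (\<lambda>t. c \<otimes>\<^bsub>T\<^esub> t) ` carrier T" using C_PIdl by (rule trans[rotated])
  \<comment> \<open>The regular element of \<open>C\<close> is a multiple of the generator
    \<open>c\<close>, so \<open>c\<close> is regular too.\<close>
  obtain c0 where c0: "c0 \<in> C" "non_zero_divisor T c0"
    using assms(1) by (auto simp: regular_conductor_square_def)
  then obtain t0 where t0: "t0 \<in> carrier T" "c0 = c \<otimes>\<^bsub>T\<^esub> t0" using Cc by blast
  have c_reg: "t = \<zero>\<^bsub>T\<^esub>" if "t \<in> carrier T" "c \<otimes>\<^bsub>T\<^esub> t = \<zero>\<^bsub>T\<^esub>" for t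
  proof -
    have "c0 \<otimes>\<^bsub>T\<^esub> t = t0 \<otimes>\<^bsub>T\<^esub> (c \<otimes>\<^bsub>T\<^esub> t)" using that(1) t0 cT by (simp add: T.m_ac)
    then show ?thesis using that t0(1) c0(2) by (simp add: non_zero_divisor_def)
  qed
  then have c_nzd: "non_zero_divisor T c" using cT by (simp add: non_zero_divisor_def)
  \<comment> \<open>A non-zero common ideal shows that \<open>T\<close> is not the zero ring, so its
    regular element \<open>c\<close> cannot be zero.\<close>
  obtain I where "ideal I T" "I \<noteq> {\<zero>\<^bsub>T\<^esub>}"
    using sq by (auto simp: conductor_square_def common_ideal_def)
  then obtain i where i: "i \<in> carrier T" "i \<noteq> \<zero>\<^bsub>T\<^esub>" using T.ideal_closed(1,2) by blast
  then have c_nz: "c \<noteq> \<zero>\<^bsub>T\<^esub>" using c_reg[OF i(1)] by auto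
  interpret regular_conductor_pullback R T "R Quot C" "\<lambda>a. C +>\<^bsub>R\<^esub> a" C c
  proof
    show "c \<in> C" "C = (\<lambda>t. c \<otimes>\<^bsub>T\<^esub> t) ` carrier T" "non_zero_divisor T c" "c \<noteq> \<zero>\<^bsub>T\<^esub>"
      by fact+
  next
    fix I assume fg: "fg_ideal I R" and nz: "I \<noteq> {\<zero>\<^bsub>R\<^esub>}"
    have I: "ideal I R" using fg R.fg_ideal_iff by simp
    obtain r s U where r: "r \<in> carrier R" and s: "s \<in> carrier R" and U: "ideal U R"
      and UT: "Idl\<^bsub>T\<^esub> U = carrier T" and rT: "carrier T = PIdl\<^bsub>T\<^esub> r"
      and eq: "r <#\<^bsub>R\<^esub> I = s <#\<^bsub>R\<^esub> U"
      and iso: "(\<lambda>x. s \<otimes>\<^bsub>R\<^esub> x) \<in> mod_iso R (mult_module R U) (mult_module R (s <#\<^bsub>R\<^esub> U))"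
      using assms(4)[OF fg nz] by (elim bexE exE conjE)
    have rsT: "r \<in> carrier T" "s \<in> carrier T" using r s sub by auto
    have IT: "x \<in> carrier T" if "x \<in> I" for x using R.ideal_closed(1)[OF I that] sub by auto
    have UT': "x \<in> carrier T" if "x \<in> U" for x using R.ideal_closed(1)[OF U that] sub by auto
    have "\<one>\<^bsub>T\<^esub> \<in> PIdl\<^bsub>T\<^esub> r" using rT by auto
    then obtain q where q: "q \<in> carrier T" "q \<otimes>\<^bsub>T\<^esub> r = \<one>\<^bsub>T\<^esub>" by (auto simp: cgenideal_def)
    \<comment> \<open>\<open>q\<close> is the inverse of \<open>r\<close> in \<open>T\<close>;
      multiplying \<open>r I = s U\<close> by it gives \<open>I = d U\<close>.\<close>
    define d where "d = q \<otimes>\<^bsub>T\<^esub> s"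
    have dT: "d \<in> carrier T" using q rsT by (simp add: d_def)
    have qr: "q \<otimes>\<^bsub>T\<^esub> (r \<otimes>\<^bsub>T\<^esub> x) = x" if "x \<in> carrier T" for x
      using that q rsT by (simp add: T.m_assoc[symmetric])
    have rI: "(\<lambda>x. r \<otimes>\<^bsub>T\<^esub> x) ` I = (\<lambda>x. s \<otimes>\<^bsub>T\<^esub> x) ` U"
      using eq by (auto simp: l_coset_def ops)
    have "I = (\<lambda>x. q \<otimes>\<^bsub>T\<^esub> x) ` (\<lambda>x. r \<otimes>\<^bsub>T\<^esub> x) ` I"
      unfolding image_image using qr IT by simp
    also have "\<dots> = (\<lambda>u. d \<otimes>\<^bsub>T\<^esub> u) ` U"
      unfolding rI image_image d_def using q rsT UT' by (simp add: T.m_assoc)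
    finally have IdU: "I = (\<lambda>u. d \<otimes>\<^bsub>T\<^esub> u) ` U" .
    \<comment> \<open>Here \<open>H = U\<close>: a product of an element of \<open>U\<close> with
      one of \<open>C\<close> stays in \<open>U\<close>, because \<open>C\<close> lies in
      \<open>R\<close> and \<open>U\<close> is an ideal of \<open>R\<close>.\<close>
    have CU: "C \<subseteq> U"
    proof (rule conductor_absorb[OF UT])
      show "U \<subseteq> carrier T" using UT' by auto
      show "u \<otimes>\<^bsub>T\<^esub> x \<in> U" if "u \<in> U" "x \<in> C" for u x
        using R.ideal_closed(6)[OF U _ that(1)] that(2) C_sub by (auto simp: ops)
    qed (use R.ideal_closed(2,3)[OF U] in \<open>auto simp: ops\<close>)
    \<comment> \<open>Injectivity of multiplication by \<open>s\<close> is known on \<open>U\<close>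
      only, so \<open>t\<close> is first moved into \<open>C\<close>, and so into \<open>U\<close>,
      by the factor \<open>c\<close>, which is cancelled at the end.\<close>
    have "t = \<zero>\<^bsub>T\<^esub>" if t: "t \<in> carrier T" "d \<otimes>\<^bsub>T\<^esub> t = \<zero>\<^bsub>T\<^esub>" for t
    proof -
      have "s \<otimes>\<^bsub>T\<^esub> t = r \<otimes>\<^bsub>T\<^esub> (d \<otimes>\<^bsub>T\<^esub> t)"
        using qr[of "s \<otimes>\<^bsub>T\<^esub> t"] q(1) rsT t(1) by (simp add: d_def T.m_ac)
      then have st: "s \<otimes>\<^bsub>T\<^esub> t = \<zero>\<^bsub>T\<^esub>" using t rsT by simp
      have ct: "c \<otimes>\<^bsub>T\<^esub> t \<in> C" using C_closed(6)[OF t(1) cC] .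
      have "s \<otimes>\<^bsub>T\<^esub> (c \<otimes>\<^bsub>T\<^esub> t) = c \<otimes>\<^bsub>T\<^esub> (s \<otimes>\<^bsub>T\<^esub> t)" using cT t(1) rsT by (simp add: T.m_lcomm)
      then have "s \<otimes>\<^bsub>T\<^esub> (c \<otimes>\<^bsub>T\<^esub> t) = s \<otimes>\<^bsub>T\<^esub> \<zero>\<^bsub>T\<^esub>" using st cT rsT by simp
      moreover have "inj_on (\<lambda>x. s \<otimes>\<^bsub>T\<^esub> x) U"
        using iso by (auto simp: mod_iso_def bij_betw_def ops)
      moreover have "c \<otimes>\<^bsub>T\<^esub> t \<in> U" "\<zero>\<^bsub>T\<^esub> \<in> U" using ct C_closed(2) CU by auto
      ultimately have "c \<otimes>\<^bsub>T\<^esub> t = \<zero>\<^bsub>T\<^esub>" by (meson inj_onD)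
      then show ?thesis by (rule c_reg[OF t(1)])
    qed
    then have "non_zero_divisor T d" using dT by (simp add: non_zero_divisor_def)
    then show "\<exists>d U. ideal U R \<and> Idl\<^bsub>T\<^esub> U = carrier T \<and> I = (\<lambda>u. d \<otimes>\<^bsub>T\<^esub> u) ` U \<and> non_zero_divisor T d"
      using U UT IdU by blast
  qed
  show ?thesis
    using coherent_overring coherent_if_quotient coherent_quotient[OF _ assms(5)] by blast
qed

end
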